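(* Let $f:\mathbb R\to\mathbb R$ be a lifting of a degree $1$ circle homeomorphism with an irrational rotation number $\rho(f)$. Suppose that $f$ satisfies the cross-ratio inequality with respect to the cross-ratio modulus $\chi$ (defined in the context) with bound $Q$. Then there exists a lift $h:\mathbb R\to\mathbb R$ of a degree $1$ circle homeomorphism which conjugates $f$ to the translation by $\rho(f)$: $$f(h(x))=h(x+\rho(f))\quad\text{for all }x\in\mathbb R.$$ Furthermore, if $\rho(f)=[a_1,a_2,\ldots]$ is of bounded type, $a_n\le B$ for all $n$, then $h$ is quasisymmetric with the quasisymmetric constant $$K_2=\max\{2,K_1^{B+1}\},\qquad K_1=2\left(1-\left(\mu^{-1}\left(\frac{1}{8\pi}Q^{-6}\ln\frac53\right)\right)^2\right)^{-6}.$$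
   Context: Cross-ratio modulus $\chi$: for real $A<B<C<D$, the upper half-plane with the marked boundary points $A,B,C,D$ is a quadrilateral; map it conformally onto a rectangle with vertices $0,1,1+ia,ia$ so that $A,B,C,D$ go to the vertices and the base $(A,B)$ is mapped onto $(0,1)$. Then $\operatorname{mod}Q(A,B,C,D)=a$ and $\chi(A,B,C,D)=1/\operatorname{mod}Q(A,B,C,D)$. Cross-ratio inequality: a finite collection of quadruples $(a_i,b_i,c_i,d_i)$, $i=1,\dots,n$, $a_i<b_i<c_i<d_i$, is allowable if $d_i-a_i<1$ and the intervals $(a_i,d_i)$ are pairwise disjoint modulo $1$. A strictly increasing $g:\mathbb R\to\mathbb R$ with $g(x)-x$ $1$-periodic satisfies the cross-ratio inequality with respect to $\chi$ with bound $Q$ if for every allowable configuration $\prod_{i=1}^n\frac{\chi(g(a_i),g(b_i),g(c_i),g(d_i))}{\chi(a_i,b_i,c_i,d_i)}\le Q$. For $0<r<1$, $\mu(r)=\frac14\,\frac{\mathcal K(\sqrt{1-r^2})}{\mathcal K(r)}$ with $\mathcal K(r)=\int_0^1\frac{dx}{\sqrt{1-x^2}\sqrt{1-r^2x^2}}$, and $\mu^{-1}$ is its inverse $(0,\infty)\to(0,1)$. An increasing homeomorphism $h:\mathbb R\to\mathbb R$ is quasisymmetric with constant $K$ if $K^{-1}\le\frac{|h(x+\delta)-h(x)|}{|h(x)-h(x-\delta)|}\le K$ for all $x\in\mathbb R$, $\delta>0$. Here $[a_1,a_2,\ldots]$ is the continued fraction expansion $\cfrac{1}{a_1+\cfrac{1}{a_2+\cdots}}$.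 *)

theory Defs
  imports "HOL-Complex_Analysis.Complex_Analysis"
begin

text \<open>Continuous lifts, with respect to the covering \<open>x \<mapsto> exp (2 \<pi> i x)\<close>, of homeomorphisms of the
  unit circle of degree 1.\<close>

definition degree_one_circle_homeo_lift :: "(real \<Rightarrow> real) \<Rightarrow> bool" where
  "degree_one_circle_homeo_lift f \<longleftrightarrow>
     continuous_on UNIV f \<and>
     (\<forall>x. f (x + 1) = f x + 1) \<and>
     (\<exists>F F'. homeomorphism (sphere (0::complex) 1) (sphere 0 1) F F' \<and>
        (\<forall>x. F (cis (2 * pi * x)) = cis (2 * pi * f x)))"

definition rotation_number :: "(real \<Rightarrow> real) \<Rightarrow> real" where
  "rotation_number f = (THE \<rho>. \<forall>x. (\<lambda>n. ((f ^^ n) x - x) / real n) \<longlonglongrightarrow> \<rho>)"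

text \<open>A conformal map from the upper half-plane onto the open rectangle with vertices
  \<open>0, 1, 1 + i a, i a\<close>, together with its homeomorphic extension to the closures, sending
  \<open>A, B, C, D\<close> to these vertices in order. The closure of the half-plane is taken in the Riemann
  sphere: \<open>p\<close> is the value of the extension at infinity.\<close>

definition rectangle_map ::
  "real \<Rightarrow> real \<Rightarrow> real \<Rightarrow> real \<Rightarrow> real \<Rightarrow> (complex \<Rightarrow> complex) \<Rightarrow> bool" where
  "rectangle_map A B C D a \<phi> \<longleftrightarrow>
     \<phi> holomorphic_on {z. Im z > 0} \<and>
     bij_betw \<phi> {z. Im z > 0} (box 0 (Complex 1 a)) \<and>
     continuous_on {z. Im z \<ge> 0} \<phi> \<and>
     (\<exists>p. bij_betw \<phi> {z. Im z \<ge> 0} (cbox 0 (Complex 1 a) - {p}) \<and>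
          p \<in> cbox 0 (Complex 1 a) \<and>
          (\<phi> \<longlongrightarrow> p) (inf at_infinity (principal {z. Im z \<ge> 0}))) \<and>
     \<phi> (of_real A) = 0 \<and> \<phi> (of_real B) = 1 \<and>
     \<phi> (of_real C) = Complex 1 a \<and> \<phi> (of_real D) = Complex 0 a \<and>
     \<phi> ` of_real ` {A<..<B} = of_real ` {0<..<1}"

definition quad_modulus :: "real \<Rightarrow> real \<Rightarrow> real \<Rightarrow> real \<Rightarrow> real" where
  "quad_modulus A B C D = (THE a. a > 0 \<and> (\<exists>\<phi>. rectangle_map A B C D a \<phi>))"

definition cross_ratio_modulus :: "real \<Rightarrow> real \<Rightarrow> real \<Rightarrow> real \<Rightarrow> real" where
  "cross_ratio_modulus A B C D = 1 / quad_modulus A B C D"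

definition allowable ::
  "nat \<Rightarrow> (nat \<Rightarrow> real) \<Rightarrow> (nat \<Rightarrow> real) \<Rightarrow> (nat \<Rightarrow> real) \<Rightarrow> (nat \<Rightarrow> real) \<Rightarrow> bool" where
  "allowable n a b c d \<longleftrightarrow>
     (\<forall>i\<in>{1..n}. a i < b i \<and> b i < c i \<and> c i < d i \<and> d i - a i < 1) \<and>
     (\<forall>i\<in>{1..n}. \<forall>j\<in>{1..n}. i \<noteq> j \<longrightarrow>
        (\<forall>k::int. {a i<..<d i} \<inter> {a j + of_int k<..<d j + of_int k} = {}))"

definition cross_ratio_inequality ::
  "(real \<Rightarrow> real \<Rightarrow> real \<Rightarrow> real \<Rightarrow> real) \<Rightarrow> (real \<Rightarrow> real) \<Rightarrow> real \<Rightarrow> bool" where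
  "cross_ratio_inequality X g Q \<longleftrightarrow>
     (\<forall>n a b c d. allowable n a b c d \<longrightarrow>
        (\<Prod>i=1..n. X (g (a i)) (g (b i)) (g (c i)) (g (d i)) / X (a i) (b i) (c i) (d i)) \<le> Q)"

definition elliptic_K :: "real \<Rightarrow> real" where
  "elliptic_K r = integral {0..1} (\<lambda>x. 1 / (sqrt (1 - x\<^sup>2) * sqrt (1 - r\<^sup>2 * x\<^sup>2)))"

text \<open>The normalising factor is 1/4, not the \<open>\<pi>/2\<close> of the usual Groetzsch ring modulus.\<close>

definition grotzsch_mu :: "real \<Rightarrow> real" where
  "grotzsch_mu r = 1 / 4 * (elliptic_K (sqrt (1 - r\<^sup>2)) / elliptic_K r)"

definition grotzsch_mu_inv :: "real \<Rightarrow> real" where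
  "grotzsch_mu_inv = inv_into {0<..<1} grotzsch_mu"

definition quasisymmetric :: "(real \<Rightarrow> real) \<Rightarrow> real \<Rightarrow> bool" where
  "quasisymmetric h K \<longleftrightarrow>
     strict_mono h \<and> (\<exists>h'. homeomorphism UNIV UNIV h h') \<and>
     (\<forall>x \<delta>. \<delta> > 0 \<longrightarrow>
        1 / K \<le> \<bar>h (x + \<delta>) - h x\<bar> / \<bar>h x - h (x - \<delta>)\<bar> \<and>
        \<bar>h (x + \<delta>) - h x\<bar> / \<bar>h x - h (x - \<delta>)\<bar> \<le> K)"

text \<open>\<open>cfrac_convergent a k n\<close> is the finite continued fraction with the \<open>n\<close> partial quotients
  \<open>a k, \<dots>, a (k + n - 1)\<close> and integer part 0.\<close>

fun cfrac_convergent :: "(nat \<Rightarrow> nat) \<Rightarrow> nat \<Rightarrow> nat \<Rightarrow> real" where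
  "cfrac_convergent a k 0 = 0"
| "cfrac_convergent a k (Suc n) = 1 / (real (a k) + cfrac_convergent a (Suc k) n)"

text \<open>The partial quotients are indexed from 1; the value \<open>a 0\<close> is irrelevant.\<close>

definition has_cfrac :: "real \<Rightarrow> (nat \<Rightarrow> nat) \<Rightarrow> bool" where
  "has_cfrac r a \<longleftrightarrow> (\<forall>n\<ge>1. a n \<ge> 1) \<and> (\<lambda>n. cfrac_convergent a 1 n) \<longlonglongrightarrow> r"

definition qs_K1 :: "real \<Rightarrow> real" where
  "qs_K1 Q =
     2 * (1 - (grotzsch_mu_inv (1 / (8 * pi) * Q powi (-6) * ln (5 / 3)))\<^sup>2) powi (-6)"

definition qs_K2 :: "real \<Rightarrow> nat \<Rightarrow> real" where
  "qs_K2 Q B = max 2 (qs_K1 Q ^ (B + 1))"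

end

theory Submission
  imports Defs
begin

text \<open>The modulus of a quadrilateral is computed with the Schwarz--Christoffel map: the modulus is
  \<open>K(k') / K(k)\<close>, where \<open>k\<^sup>2\<close> is a cross-ratio of the four points. Hence a lower bound on \<open>\<chi>\<close> bounds the
  middle interval by either of its neighbours, with a constant exponential in \<open>1 / \<chi>\<close>.

  For irrational \<open>\<rho>(f)\<close> the orbit of 0 defines a strictly increasing, possibly discontinuous \<open>h\<close> with
  \<open>f(h(u)) = h(u + \<rho>)\<close>. Fix a convergent of \<open>\<rho>\<close> and push a quadruple of \<open>h\<close>-images whose outer
  intervals are longer than the gaps of the orbit into a window on which \<open>h\<close> increases least; there \<open>\<chi>\<close>
  is bounded below. Six allowable configurations contain all the intermediate iterates, so
  \<open>\<chi>\<close> is bounded below by a multiple of \<open>Q\<^sup>-\<^sup>6\<close> for the original quadruple, at every place. Thus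
  enlarging a window by a fixed fraction of the scale multiplies its \<open>h\<close>-length by at most a constant.
  Letting the scale tend to 0 excludes jumps of \<open>h\<close>; for bounded type, boundedly many such
  enlargements relate adjacent intervals of any size, and the slack in \<open>K\<^sub>1\<close> absorbs them.\<close>

section \<open>The Schwarz--Christoffel integral on a quadrant\<close>

text \<open>The numbers fit together as follows. The middle interval of a quadruple has length
  \<open>e = s / 3\<close> and the outer ones \<open>W = g + e\<close>, because a translate of the
  middle one must fit into a window of length \<open>W\<close> although the orbit is only
  \<open>g\<close>-dense. The whole quadruple then has length \<open>2 * g + s <= 5 * s\<close>, so
  iterates with base points \<open>5 * s\<close> apart are disjoint; a colouring with that
  separation takes six colours, whence \<open>Q^6\<close>. Since \<open>g <= 2 * s\<close> holds at
  every convergent, the partial quotients do not enter these estimates: continuity follows for every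
  irrational rotation number, and \<open>B\<close> appears only when neighbouring scales are
  compared. As \<open>h\<close> may still jump at that stage, a window of least increase may fail to
  exist, and the factor 0.965 pays for a nearly least one. \<open>K1\<close> enters only through the
  lower bound \<open>qs_K1_ge\<close>, an explicit exponential in \<open>Q^6\<close>; hence steps
  are counted explicitly, 45 per unit of \<open>B + 1\<close>, each costing
  \<open>4.64 * Q^6\<close> in the exponent.\<close>

lemma csqrt_upper_half_plane:
  assumes "Im z \<ge> 0"
  shows "csqrt z = Complex (sqrt ((cmod z + Re z) / 2)) (sqrt ((cmod z - Re z) / 2))"
  using assms by (cases "Im z = 0") (auto simp: csqrt.code complex_eq_iff)

text \<open>The cut of \<open>csqrt\<close> is the negative axis. Approached from above only, the
  root does not jump there, which is why everything below lives on closed half-planes and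
  quadrants.\<close>

lemma continuous_on_csqrt_upper: "continuous_on {z. Im z \<ge> 0} csqrt"
proof -
  have "continuous_on {z. Im z \<ge> 0}
      (\<lambda>z. Complex (sqrt ((cmod z + Re z) / 2)) (sqrt ((cmod z - Re z) / 2)))"
    by (intro continuous_intros continuous_on_Complex) auto
  then show ?thesis
    by (rule continuous_on_eq) (use csqrt_upper_half_plane in auto)
qed

lemma csqrt_Re_Im_pos:
  assumes "Im z > 0" shows "Re (csqrt z) > 0" "Im (csqrt z) > 0"
proof -
  have "\<bar>Re z\<bar> < cmod z"
    unfolding cmod_def using assms by (intro real_less_rsqrt) (auto simp: zero_less_power)
  then have "cmod z + Re z > 0" "cmod z - Re z > 0" by linarith+
  then show "Re (csqrt z) > 0" "Im (csqrt z) > 0"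
    using csqrt_upper_half_plane[of z] assms by auto
qed

text \<open>The square root of the closed upper half-plane. In this coordinate the
  Schwarz-Christoffel integrand becomes Legendre's integrand of the first kind, with prevertices 0,
  1, \<open>1 / k\<close> and infinity.\<close>

definition closed_quadrant :: "complex set" where
  "closed_quadrant = {w. Re w \<ge> 0 \<and> Im w \<ge> 0}"

definition open_quadrant :: "complex set" where
  "open_quadrant = {w. Re w > 0 \<and> Im w > 0}"

lemma open_open_quadrant: "open open_quadrant"
  unfolding open_quadrant_def by (intro open_Collect_conj open_Collect_less continuous_intros)

lemma closed_closed_quadrant: "closed closed_quadrant"
  unfolding closed_quadrant_def by (intro closed_Collect_conj closed_Collect_le continuous_intros)

lemma convex_open_quadrant: "convex open_quadrant"
proof -
  have "open_quadrant = {w. Re w > 0} \<inter> {w. Im w > 0}" by (auto simp: open_quadrant_def)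
  then show ?thesis
    using convex_Int[OF convex_halfspace_Re_gt[of 0] convex_halfspace_Im_gt[of 0]] by (simp only:)
qed

lemma open_quadrant_subset: "open_quadrant \<subseteq> closed_quadrant"
  by (auto simp: open_quadrant_def closed_quadrant_def)

text \<open>A branch of \<open>1 / sqrt ((1 - w^2) (1 - k^2 w^2))\<close>. For \<open>w\<close> in
  the quadrant both radicands lie in the closed upper half-plane, where \<open>csqrt\<close> is
  continuous; the minus sign cancels the product of two factors i and makes the value positive on
  \<open>(0, 1)\<close>.\<close>

definition sc_density :: "real \<Rightarrow> complex \<Rightarrow> complex" where
  "sc_density k w = - 1 / (csqrt (w\<^sup>2 - 1) * csqrt ((of_real k * w)\<^sup>2 - 1))"

lemma quadrant_square: "w \<in> closed_quadrant \<Longrightarrow> Im (w\<^sup>2 - 1) \<ge> 0"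
  by (auto simp: closed_quadrant_def power2_eq_square)

lemma quadrant_scale: "w \<in> closed_quadrant \<Longrightarrow> k > 0 \<Longrightarrow> of_real k * w \<in> closed_quadrant"
  by (auto simp: closed_quadrant_def)

lemma quadrant_square_eq_1: "w \<in> closed_quadrant \<Longrightarrow> w\<^sup>2 - 1 = 0 \<longleftrightarrow> w = 1"
  by (auto simp: closed_quadrant_def power2_eq_1_iff)

lemma continuous_on_sc_density:
  assumes k: "0 < k"
  shows "continuous_on (closed_quadrant - {1, of_real (1/k)}) (sc_density k)"
  unfolding sc_density_def
proof (intro continuous_intros)
  have 1: "continuous_on closed_quadrant (\<lambda>w. csqrt (w\<^sup>2 - 1))"
    by (rule continuous_on_compose2[OF continuous_on_csqrt_upper])
       (auto intro!: continuous_intros quadrant_square)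
  then show "continuous_on (closed_quadrant - {1, of_real (1/k)}) (\<lambda>w. csqrt (w\<^sup>2 - 1))"
    by (rule continuous_on_subset) auto
  have "continuous_on (closed_quadrant - {1, of_real (1/k)}) (\<lambda>w. csqrt ((of_real k * w)\<^sup>2 - 1))"
    by (rule continuous_on_compose2[OF 1, of _ "\<lambda>w. of_real k * w"])
       (auto intro!: continuous_intros quadrant_scale k)
  then show "continuous_on (closed_quadrant - {1, of_real (1/k)}) (\<lambda>w. csqrt ((of_real k * w)\<^sup>2 - 1))" .
  show "\<forall>w\<in>closed_quadrant - {1, of_real (1/k)}. csqrt (w\<^sup>2 - 1) * csqrt ((of_real k * w)\<^sup>2 - 1) \<noteq> 0"
  proof
    fix w assume w: "w \<in> closed_quadrant - {1, of_real (1/k)}"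
    have "of_real k * w \<noteq> 1" using w k by (auto simp: field_simps)
    then show "csqrt (w\<^sup>2 - 1) * csqrt ((of_real k * w)\<^sup>2 - 1) \<noteq> 0"
      using w quadrant_square_eq_1[of w] quadrant_square_eq_1[of "of_real k * w"] k
      by (auto simp: quadrant_scale)
  qed
qed

lemma open_quadrant_square: "w \<in> open_quadrant \<Longrightarrow> Im (w\<^sup>2 - 1) > 0"
  by (auto simp: open_quadrant_def power2_eq_square)

lemma open_quadrant_scale: "w \<in> open_quadrant \<Longrightarrow> k > 0 \<Longrightarrow> of_real k * w \<in> open_quadrant"
  by (auto simp: open_quadrant_def)

lemma holomorphic_sc_density:
  assumes k: "0 < k"
  shows "sc_density k holomorphic_on open_quadrant"
proof -
  have nz: "Im z > 0 \<Longrightarrow> z \<notin> \<real>\<^sub>\<le>\<^sub>0" for z by (auto simp: complex_nonpos_Reals_iff)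
  have "(\<lambda>w. - 1 / (csqrt (w\<^sup>2 - 1) * csqrt ((of_real k * w)\<^sup>2 - 1))) holomorphic_on open_quadrant"
    using open_quadrant_square open_quadrant_scale[OF _ k]
    by (intro holomorphic_intros) (auto intro!: nz, force+)
  then show ?thesis by (simp add: sc_density_def[abs_def])
qed

text \<open>Both roots lie in the open first quadrant, so their product has positive imaginary part,
  and so has its negative reciprocal. This sign drives the monotonicity along lines and the
  injectivity below.\<close>

lemma Im_sc_density_pos:
  assumes k: "0 < k" and w: "w \<in> open_quadrant"
  shows "Im (sc_density k w) > 0"
proof -
  define p where "p = csqrt (w\<^sup>2 - 1) * csqrt ((of_real k * w)\<^sup>2 - 1)"
  have "Im p > 0" unfolding p_def
    using csqrt_Re_Im_pos[OF open_quadrant_square[OF w]]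
      csqrt_Re_Im_pos[OF open_quadrant_square[OF open_quadrant_scale[OF w k]]]
    by (simp add: add_pos_pos)
  moreover have "Im (- 1 / p) = Im p / (cmod p)\<^sup>2"
    by (simp add: Im_divide cmod_power2)
  ultimately show ?thesis unfolding sc_density_def p_def[symmetric] by (auto simp: zero_less_divide_iff)
qed

lemma cmod_sc_density:
  "cmod (sc_density k w) = 1 / sqrt (cmod (w\<^sup>2 - 1) * cmod ((of_real k * w)\<^sup>2 - 1))"
proof -
  have c: "cmod (csqrt z) = sqrt (cmod z)" for z
    by (metis norm_ge_zero norm_power power2_csqrt real_sqrt_unique)
  show ?thesis unfolding sc_density_def by (simp add: norm_divide norm_mult c real_sqrt_mult)
qed

text \<open>A majorant on vertical rays, uniform in the base point. Near the singularities only one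
  factor can be small, which gives \<open>t powr (-1/2)\<close>; far up both quadratic factors grow,
  which gives \<open>t powr (-2)\<close>. Both are integrable at their ends.\<close>

definition sc_bound :: "real \<Rightarrow> real \<Rightarrow> real" where
  "sc_bound k t = (if t \<le> 1 then sqrt (2 / (1 - k)) * t powr (-1/2) else 1 / k * t powr (-2))"

lemma cmod_sc_density_le:
  assumes k: "0 < k" "k < 1" and w: "w \<in> closed_quadrant" and t: "t > 0"
  shows "cmod (sc_density k (w + \<i> * of_real t)) \<le> sc_bound k t"
proof -
  define z where "z = w + \<i> * of_real t"
  have Re: "Re z \<ge> 0" and Im: "Im z \<ge> t" using w by (auto simp: z_def closed_quadrant_def)
  define P where "P = cmod (z\<^sup>2 - 1) * cmod ((of_real k * z)\<^sup>2 - 1)"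
  have a1: "cmod (z + 1) \<ge> 1" "cmod (z - 1) \<ge> t" "cmod (z + 1) \<ge> t"
    using Re Im complex_Re_le_cmod[of "z+1"] abs_Im_le_cmod[of "z-1"] abs_Im_le_cmod[of "z+1"] by auto
  have kt: "k * t \<le> k * Im z" "0 \<le> k * Re z" using k Im Re by auto
  have a2: "cmod (of_real k * z + 1) \<ge> 1" "cmod (of_real k * z - 1) \<ge> k * t" "cmod (of_real k * z + 1) \<ge> k * t"
    using kt complex_Re_le_cmod[of "of_real k * z+1"] abs_Im_le_cmod[of "of_real k * z-1"]
      abs_Im_le_cmod[of "of_real k * z+1"] by (auto simp: abs_le_iff)
  have P: "P = (cmod (z - 1) * cmod (of_real k * z - 1)) * (cmod (z + 1) * cmod (of_real k * z + 1))"
  proof -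
    have "v\<^sup>2 - 1 = (v - 1) * (v + 1)" for v :: complex by (simp add: power2_eq_square algebra_simps)
    then show ?thesis by (simp add: P_def norm_mult mult_ac)
  qed
  have "P \<ge> (t * (k * t)) * (t * (k * t))" unfolding P
    using t k by (intro mult_mono a1 a2 mult_nonneg_nonneg) auto
  then have P1: "P \<ge> (k * t\<^sup>2)\<^sup>2" by (simp add: power2_eq_square mult_ac)
  \<comment> \<open>The zeros 1 and \<open>1 / k\<close> are apart: \<open>k * (z - 1)\<close> and
    \<open>k * z - 1\<close> differ by \<open>1 - k\<close>, so one of them has size at least
    \<open>(1 - k) / 2\<close>. The other is bounded below by its height.\<close>
  have "cmod (z - 1) * cmod (of_real k * z - 1) \<ge> (1 - k) / 2 * t"
  proof (cases "cmod (of_real k * z - 1) \<ge> (1 - k) / 2")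
    case True
    show ?thesis using mult_mono[OF a1(2) True] k t by (simp add: mult_ac)
  next
    case False
    have "of_real k * (z - 1) = (of_real k * z - 1) + of_real (1 - k)" by (simp add: algebra_simps)
    then have "cmod (of_real k * (z - 1)) \<ge> (1 - k) - cmod (of_real k * z - 1)"
      using k by (metis norm_diff_ineq norm_of_real abs_of_pos diff_gt_0_iff_gt add.commute)
    then have "k * cmod (z - 1) \<ge> (1 - k) / 2" using False k by (auto simp: norm_mult)
    then have "cmod (z - 1) \<ge> (1 - k) / (2 * k)" using k by (simp add: field_simps)
    then have "cmod (z - 1) * cmod (of_real k * z - 1) \<ge> (1 - k) / (2 * k) * (k * t)"
      using k t by (intro mult_mono a2) auto
    moreover have "(1 - k) / (2 * k) * (k * t) = (1 - k) / 2 * t" using k by simp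
    ultimately show ?thesis by linarith
  qed
  then have "P \<ge> ((1 - k) / 2 * t) * (1 * 1)" unfolding P
  proof (rule mult_mono)
    show "0 \<le> cmod (z - 1) * cmod (of_real k * z - 1)" by simp
    show "1 * 1 \<le> cmod (z + 1) * cmod (of_real k * z + 1)" by (rule mult_mono) (use a1 a2 in auto)
  qed (use t k in auto)
  then have P2: "P \<ge> (1 - k) / 2 * t" by simp
  have Q1: "1 / sqrt P \<le> 1 / (k * t\<^sup>2)"
  proof (rule divide_left_mono)
    show "k * t\<^sup>2 \<le> sqrt P" using P1 by (rule real_le_rsqrt)
    have "0 < k * t\<^sup>2" using k t by simp
    then show "0 < sqrt P * (k * t\<^sup>2)" using \<open>k * t\<^sup>2 \<le> sqrt P\<close> by (metis mult_pos_pos less_le_trans)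
  qed simp
  have Q2: "1 / sqrt P \<le> 1 / sqrt ((1 - k) / 2 * t)"
  proof (rule divide_left_mono)
    show "sqrt ((1 - k) / 2 * t) \<le> sqrt P" using P2 by simp
    have "0 < sqrt ((1 - k) / 2 * t)" using k t by simp
    then show "0 < sqrt P * sqrt ((1 - k) / 2 * t)"
      using \<open>sqrt ((1 - k) / 2 * t) \<le> sqrt P\<close> by (intro mult_pos_pos) linarith+
  qed simp
  have "1 / sqrt P \<le> sc_bound k t"
  proof (cases "t \<le> 1")
    case True
    have "1 / sqrt ((1 - k) / 2 * t) = sqrt (2 / (1 - k)) * t powr (-1/2)"
    proof -
      have "t powr (-1/2) = 1 / sqrt t" using t powr_minus_divide[of t "1/2"] by (simp add: powr_half_sqrt)
      then show ?thesis by (simp add: real_sqrt_mult real_sqrt_divide)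
    qed
    then show ?thesis using Q2 True by (simp add: sc_bound_def)
  next
    case False
    then show ?thesis using Q1 t by (simp add: sc_bound_def powr_minus field_simps)
  qed
  then show ?thesis unfolding cmod_sc_density z_def[symmetric] P_def .
qed

lemma sc_bound_integrable:
  assumes k: "0 < k" "k < 1"
  shows "sc_bound k integrable_on {0<..}"
proof -
  have "(\<lambda>t. t powr (-1/2)) integrable_on {0..1::real}"
    using integrable_on_powr_from_0[of "-1/2" 1] by simp
  then have "(\<lambda>t. sqrt (2 / (1 - k)) * t powr (-1/2)) integrable_on {0..1::real}"
    by (rule integrable_on_mult_right)
  then have 1: "sc_bound k integrable_on {0..1}"
    by (rule integrable_eq) (auto simp: sc_bound_def)
  have "((\<lambda>t. t powr (-2)) has_integral - (1 powr (-2+1)) / (-2+1)) {1::real..}"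
    by (rule has_integral_powr_to_inf) auto
  then have "(\<lambda>t. 1 / k * t powr (-2)) integrable_on {1::real..}"
    by (intro integrable_on_mult_right) (rule has_integral_integrable)
  then have 2: "sc_bound k integrable_on {1..}"
    by (rule integrable_spike_finite[of "{1}", rotated 2]) (auto simp: sc_bound_def)
  have "{0..1} \<inter> {1..} = {1::real}" by auto
  then have "sc_bound k integrable_on {0..1} \<union> {1..}"
    by (intro integrable_Un 1 2) auto
  moreover have "{0..1} \<union> {1..} = {0::real..}" by auto
  ultimately have "sc_bound k integrable_on {0..}" by simp
  then show ?thesis
    by (rule integrable_spike_set) (rule negligible_subset[of "{0::real}"], auto)+
qed

text \<open>Integration runs down a vertical ray from infinity instead of outwards from 0. Dominated
  convergence then gives continuity at all boundary points, the singular ones included, and the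
  limit at infinity.\<close>

definition sc_integral :: "real \<Rightarrow> complex \<Rightarrow> complex" where
  "sc_integral k w = - \<i> * integral {0<..} (\<lambda>t. sc_density k (w + \<i> * of_real t))"

lemma quadrant_shift_regular:
  "w \<in> closed_quadrant \<Longrightarrow> t > 0 \<Longrightarrow> w + \<i> * of_real t \<in> closed_quadrant - {1, of_real (1/k)}"
  by (auto simp: closed_quadrant_def complex_eq_iff)

lemma sc_density_vertical_integrable:
  assumes k: "0 < k" "k < 1" and w: "w \<in> closed_quadrant"
  shows "(\<lambda>t. sc_density k (w + \<i> * of_real t)) integrable_on {0<..}"
proof (rule measurable_bounded_by_integrable_imp_integrable[OF _ sc_bound_integrable[OF k]])
  have "continuous_on {0<..} (\<lambda>t. sc_density k (w + \<i> * of_real t))"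
    by (rule continuous_on_compose2[OF continuous_on_sc_density[OF k(1)]])
       (use quadrant_shift_regular[OF w] in \<open>auto intro!: continuous_intros\<close>)
  then show "(\<lambda>t. sc_density k (w + \<i> * of_real t)) \<in> borel_measurable (lebesgue_on {0<..})"
    by (rule continuous_imp_measurable_on_sets_lebesgue) simp
  show "{0::real<..} \<in> sets lebesgue" by simp
  show "cmod (sc_density k (w + \<i> * complex_of_real x)) \<le> sc_bound k x" if "x \<in> {0<..}" for x
    using cmod_sc_density_le[OF k w] that by simp
qed

lemma sc_integral_limit:
  assumes k: "0 < k" "k < 1" and W: "\<And>n. W n \<in> closed_quadrant"
    and lim: "\<And>t. t > 0 \<Longrightarrow> (\<lambda>n. sc_density k (W n + \<i> * of_real t)) \<longlonglongrightarrow> g t"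
  shows "(\<lambda>n. sc_integral k (W n)) \<longlonglongrightarrow> - \<i> * integral {0<..} g"
  unfolding sc_integral_def
  by (intro tendsto_mult tendsto_const dominated_convergence(2)[OF _ sc_bound_integrable[OF k]]
        sc_density_vertical_integrable k W)
     (use cmod_sc_density_le[OF k W] lim in auto)

lemma continuous_on_sc_integral:
  assumes k: "0 < k" "k < 1"
  shows "continuous_on closed_quadrant (sc_integral k)"
proof (clarsimp simp: continuous_on_sequentially)
  fix x a assume x: "\<forall>n. x n \<in> closed_quadrant" and a: "a \<in> closed_quadrant" and l: "x \<longlonglongrightarrow> a"
  have "(\<lambda>n. sc_integral k (x n)) \<longlonglongrightarrow> - \<i> * integral {0<..} (\<lambda>t. sc_density k (a + \<i> * of_real t))"
  proof (rule sc_integral_limit[OF k])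
    fix t :: real assume t: "t > 0"
    show "(\<lambda>n. sc_density k (x n + \<i> * of_real t)) \<longlonglongrightarrow> sc_density k (a + \<i> * of_real t)"
      by (rule continuous_on_tendsto_compose[OF continuous_on_sc_density[OF k(1)]])
         (use quadrant_shift_regular[OF _ t, of _ k] x a l in \<open>auto intro!: tendsto_intros\<close>)
  qed (use x in auto)
  then show "(sc_integral k \<circ> x) \<longlonglongrightarrow> sc_integral k a"
    by (simp add: sc_integral_def o_def)
qed

lemma sc_density_tendsto_0: "0 < k \<Longrightarrow> (sc_density k \<longlongrightarrow> 0) at_infinity"
proof -
  assume k: "0 < k"
  have sq: "LIM w at_infinity. cmod ((c * w)\<^sup>2 - 1) :> at_top" if "c \<noteq> 0" for c :: complex
  proof (rule filterlim_at_infinity_imp_norm_at_top)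
    have "LIM w at_infinity. c * w :> at_infinity"
      by (rule tendsto_mult_filterlim_at_infinity[OF tendsto_const that filterlim_ident])
    then have "LIM w at_infinity. (c * w)\<^sup>2 :> at_infinity"
      by (rule Limits.filterlim_power_at_infinity) simp
    then show "LIM w at_infinity. (c * w)\<^sup>2 - 1 :> at_infinity"
      using tendsto_add_filterlim_at_infinity'[OF _ tendsto_const, of _ _ "-1"] by fastforce
  qed
  have "((\<lambda>w. 1 / sqrt (cmod (w\<^sup>2 - 1) * cmod ((of_real k * w)\<^sup>2 - 1))) \<longlongrightarrow> 0) at_infinity"
  proof (rule tendsto_divide_0[OF tendsto_const filterlim_at_top_imp_at_infinity])
    show "LIM w at_infinity. sqrt (cmod (w\<^sup>2 - 1) * cmod ((of_real k * w)\<^sup>2 - 1)) :> at_top"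
      using sq[of 1] sq[of "of_real k"] k
      by (intro filterlim_compose[OF sqrt_at_top] filterlim_at_top_mult_at_top) auto
  qed
  then show ?thesis
    by (subst tendsto_norm_zero_iff[symmetric]) (simp add: cmod_sc_density)
qed

lemma sc_integral_at_infinity:
  assumes k: "0 < k" "k < 1" and W: "\<And>n. W n \<in> closed_quadrant"
    and inf: "filterlim W at_infinity sequentially"
  shows "(\<lambda>n. sc_integral k (W n)) \<longlonglongrightarrow> 0"
proof -
  have "(\<lambda>n. sc_integral k (W n)) \<longlonglongrightarrow> - \<i> * integral {0::real<..} (\<lambda>t. 0)"
  proof (rule sc_integral_limit[OF k W])
    fix t :: real
    have "filterlim (\<lambda>n. W n + \<i> * of_real t) at_infinity sequentially"
      using inf tendsto_add_filterlim_at_infinity'[OF inf tendsto_const] by simp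
    then show "(\<lambda>n. sc_density k (W n + \<i> * of_real t)) \<longlonglongrightarrow> 0"
      using filterlim_compose[OF sc_density_tendsto_0[OF k(1)]] by blast
  qed
  then show ?thesis by simp
qed

text \<open>A primitive \<open>G\<close> exists on the convex quadrant. Its increment along a
  vertical ray is given by the integral, and its limit at the upper end is the same for all rays,
  since the density at height \<open>n\<close> is at most \<open>sc_bound k n\<close>. So
  \<open>G\<close> and the integral differ by a constant.\<close>

lemma sc_integral_deriv_interior:
  assumes k: "0 < k" "k < 1" and w: "w \<in> open_quadrant"
  shows "(sc_integral k has_field_derivative sc_density k w) (at w)"
proof -
  obtain G where G: "\<And>w. w \<in> open_quadrant \<Longrightarrow> (G has_field_derivative sc_density k w) (at w within open_quadrant)"
    using holomorphic_convex_primitive'[OF convex_open_quadrant open_open_quadrant holomorphic_sc_density[OF k(1)]] by metis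
  have G': "(G has_field_derivative sc_density k w) (at w)" if "w \<in> open_quadrant" for w
    using G[OF that] at_within_open[OF that open_open_quadrant] by simp
  have sh: "w + \<i> * of_real t \<in> open_quadrant" if "w \<in> open_quadrant" "t \<ge> 0" for w t
    using that by (auto simp: open_quadrant_def)
  have lim: "(\<lambda>n. G (w + \<i> * of_nat n)) \<longlonglongrightarrow> G w - sc_integral k w" if w: "w \<in> open_quadrant" for w
  proof -
    have FTC: "((\<lambda>t. \<i> * sc_density k (w + \<i> * of_real t)) has_integral
            (G (w + \<i> * of_real T) - G (w + \<i> * of_real 0))) {0..T}" if T: "T \<ge> 0" for T
    proof (rule fundamental_theorem_of_calculus[OF T])
      fix t assume t: "t \<in> {0..T}"
      have "((\<lambda>t. w + \<i> * of_real t) has_vector_derivative \<i>) (at t within {0..T})"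
        by (auto intro!: derivative_eq_intros)
      moreover have "(G has_field_derivative sc_density k (w + \<i> * of_real t)) (at (w + \<i> * of_real t))"
        using G'[OF sh[OF w]] t by auto
      ultimately show "((\<lambda>t. G (w + \<i> * of_real t)) has_vector_derivative \<i> * sc_density k (w + \<i> * of_real t)) (at t within {0..T})"
        using field_vector_diff_chain_within[of "\<lambda>t. w + \<i> * of_real t"] has_field_derivative_at_within
        unfolding o_def by blast
    qed
    define F where "F n t = (if t \<in> {0..real n} then sc_density k (w + \<i> * of_real t) else 0)" for n t
    have wq: "w \<in> closed_quadrant" using w open_quadrant_subset by blast
    have sub: "{0..real n} \<inter> {0<..} = {0<..real n}" for n by auto
    have I0: "(\<lambda>t. \<i> * sc_density k (w + \<i> * of_real t)) integrable_on {0..real n}" for n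
      using FTC[of "real n"] by auto
    have I1: "(\<lambda>t. sc_density k (w + \<i> * of_real t)) integrable_on {0..real n}" for n
      using integrable_on_mult_right[OF I0, of "-\<i>" n] by simp
    have s1: "integral {0<..} (F n) = integral {0..real n} (\<lambda>t. sc_density k (w + \<i> * of_real t))"
      and s2: "F n integrable_on {0<..}" for n
    proof -
      have 1: "F n integrable_on {0..}" 
        using integrable_restrict_Int[of "{0..real n}" "\<lambda>t. sc_density k (w + \<i> * of_real t)" "{0..}"] I1[of n]
        by (simp add: F_def[abs_def] Int_absorb2 if_distrib)
      then show "F n integrable_on {0<..}"
        by (rule integrable_spike_set) (rule negligible_subset[of "{0::real}"], auto)+
      have "integral {0<..} (F n) = integral {0..} (F n)"
        by (rule integral_spike_set) (rule negligible_subset[of "{0::real}"], auto)+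
      also have "\<dots> = integral {0..real n} (\<lambda>t. sc_density k (w + \<i> * of_real t))"
        using integral_restrict_Int[of "{0..}" "{0..real n}" "\<lambda>t. sc_density k (w + \<i> * of_real t)"]
        by (simp add: F_def[abs_def] Int_absorb1)
      finally show "integral {0<..} (F n) = integral {0..real n} (\<lambda>t. sc_density k (w + \<i> * of_real t))" .
    qed
    have "(\<lambda>n. integral {0<..} (F n)) \<longlonglongrightarrow> integral {0<..} (\<lambda>t. sc_density k (w + \<i> * of_real t))"
    proof (rule dominated_convergence(2)[OF s2 sc_bound_integrable[OF k]])
      show "cmod (F n x) \<le> sc_bound k x" if "x \<in> {0<..}" for n x
        using cmod_sc_density_le[OF k wq, of x] that k unfolding F_def
        by (auto intro: order_trans[OF norm_ge_zero])
      fix x :: real assume x: "x \<in> {0<..}"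
      have "eventually (\<lambda>n. F n x = sc_density k (w + \<i> * of_real x)) sequentially"
        using eventually_ge_at_top[of "nat \<lceil>x\<rceil>"]
      proof eventually_elim
        case (elim n)
        then have "x \<le> real n" by linarith
        then show ?case using x by (simp add: F_def)
      qed
      then show "(\<lambda>n. F n x) \<longlonglongrightarrow> sc_density k (w + \<i> * of_real x)"
        by (rule tendsto_eventually)
    qed
    then have "(\<lambda>n. G w + \<i> * integral {0<..} (F n)) \<longlonglongrightarrow> G w + \<i> * integral {0<..} (\<lambda>t. sc_density k (w + \<i> * of_real t))"
      by (intro tendsto_intros)
    moreover have "G w + \<i> * integral {0<..} (F n) = G (w + \<i> * of_nat n)" for n
      using integral_unique[OF FTC[of "real n"]] s1[of n] by (simp add: integral_mult_right)
    ultimately show ?thesis by (simp add: sc_integral_def)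
  qed
  have eq: "G w - sc_integral k w = G w' - sc_integral k w'"
    if w: "w \<in> open_quadrant" and w': "w' \<in> open_quadrant" for w w'
  proof -
    have "(\<lambda>n. G (w + \<i> * of_nat n) - G (w' + \<i> * of_nat n)) \<longlonglongrightarrow> 0"
    proof (rule Lim_null_comparison)
      have "((\<lambda>n. sc_bound k (real n) * cmod (w - w'))) \<longlonglongrightarrow> 0"
      proof (rule tendsto_mult_left_zero)
        have "((\<lambda>n. 1 / k * real n powr (-2))) \<longlonglongrightarrow> 0" by real_asymp
        moreover have "eventually (\<lambda>n. 1 / k * real n powr (-2) = sc_bound k (real n)) sequentially"
          using eventually_gt_at_top[of 1] by eventually_elim (auto simp: sc_bound_def)
        ultimately show "(\<lambda>n. sc_bound k (real n)) \<longlonglongrightarrow> 0"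
          by (rule Lim_transform_eventually)
      qed
      then show "(\<lambda>n. sc_bound k (real n) * cmod (w - w')) \<longlonglongrightarrow> 0" .
      show "eventually (\<lambda>n. norm (G (w + \<i> * of_nat n) - G (w' + \<i> * of_nat n)) \<le> sc_bound k (real n) * cmod (w - w')) sequentially"
        using eventually_gt_at_top[of 0]
      proof eventually_elim
        case (elim n)
        let ?S = "(\<lambda>v. v + \<i> * of_nat n) ` open_quadrant"
        have "norm (G (w + \<i> * of_nat n) - G (w' + \<i> * of_nat n))
           \<le> sc_bound k (real n) * norm ((w + \<i> * of_nat n) - (w' + \<i> * of_nat n))"
        proof (rule field_differentiable_bound[where S = ?S and f' = "sc_density k"])
          show "convex ?S" using convex_translation[OF convex_open_quadrant, of "\<i> * of_nat n"]
            by (simp add: add.commute)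
          fix z assume "z \<in> ?S"
          then obtain v where v: "v \<in> open_quadrant" "z = v + \<i> * of_real (real n)" by auto
          then have "z \<in> open_quadrant" using sh[of v "real n"] by auto
          then show "(G has_field_derivative sc_density k z) (at z within ?S)"
            using G' has_field_derivative_at_within by blast
          show "cmod (sc_density k z) \<le> sc_bound k (real n)" unfolding v
            using cmod_sc_density_le[OF k _, of v "real n"] v(1) elim open_quadrant_subset by auto
        qed (use w w' in auto)
        then show ?case by simp
      qed
    qed
    moreover have "(\<lambda>n. G (w + \<i> * of_nat n) - G (w' + \<i> * of_nat n)) \<longlonglongrightarrow>
        (G w - sc_integral k w) - (G w' - sc_integral k w')"
      by (intro tendsto_diff lim w w')
    ultimately show ?thesis using LIMSEQ_unique by fastforce
  qed
  define c where "c = G w - sc_integral k w"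
  have "((\<lambda>v. G v - c) has_field_derivative sc_density k w) (at w)"
    by (auto intro!: derivative_eq_intros G' w)
  then show ?thesis
    by (rule DERIV_cong_ev[THEN iffD1, rotated -1])
       (use eventually_nhds_in_open[OF open_open_quadrant w] eq[OF w] in
         \<open>auto simp: c_def elim!: eventually_mono\<close>)
qed

text \<open>The mean value inequality on the interior, passed to the limit.\<close>

lemma has_field_derivative_closure:
  fixes f g :: "complex \<Rightarrow> complex"
  assumes T: "convex T" "open T" "T \<subseteq> S" "S \<subseteq> closure T"
    and f: "continuous_on S f" and f': "\<And>w. w \<in> T \<Longrightarrow> (f has_field_derivative g w) (at w)"
    and w0: "w0 \<in> S" and g: "continuous (at w0 within S) g"
  shows "(f has_field_derivative g w0) (at w0 within S)"
  unfolding has_field_derivative_def has_derivative_within_alt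
proof (intro conjI allI impI)
  show "bounded_linear ((*) (g w0))" by (rule bounded_linear_mult_right)
  fix e :: real assume e: "e > 0"
  obtain d where d: "d > 0" "\<And>w. w \<in> S \<Longrightarrow> dist w w0 < d \<Longrightarrow> dist (g w) (g w0) < e"
    using g e unfolding continuous_within_eps_delta by metis
  define F where "F w = f w - g w0 * w" for w
  have F: "continuous_on S F" unfolding F_def by (intro continuous_intros f)
  let ?B = "T \<inter> ball w0 d"
  have bound: "norm (F a - F b) \<le> e * norm (a - b)" if "a \<in> ?B" "b \<in> ?B" for a b
  proof (rule field_differentiable_bound[of ?B F "\<lambda>w. g w - g w0"])
    show "convex ?B" using T(1) by (intro convex_Int convex_ball)
    fix z assume z: "z \<in> ?B"
    have "(F has_field_derivative g z - g w0) (at z)"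
      unfolding F_def using z by (auto intro!: derivative_eq_intros f')
    then show "(F has_field_derivative g z - g w0) (at z within ?B)"
      by (rule has_field_derivative_at_within)
    show "norm (g z - g w0) \<le> e"
      using d(2)[of z] z T(3) by (force simp: dist_norm norm_minus_commute)
  qed (use that in auto)
  have cl: "\<exists>a. (\<forall>n. a n \<in> ?B) \<and> a \<longlonglongrightarrow> w" if "w \<in> S" "dist w w0 < d" for w
  proof -
    have "w \<in> ball w0 d \<inter> closure T" using that T(4) by (auto simp: dist_commute)
    then have "w \<in> closure ?B"
      using open_Int_closure_subset[OF open_ball, of w0 d T] by (auto simp: Int_commute)
    then show ?thesis unfolding closure_sequential by auto
  qed
  have "norm (F y - F w0) \<le> e * norm (y - w0)" if y: "y \<in> S" "dist y w0 < d" for y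
  proof -
    obtain a where a: "\<And>n. a n \<in> ?B" "a \<longlonglongrightarrow> y" using cl[OF y] by auto
    obtain b where b: "\<And>n. b n \<in> ?B" "b \<longlonglongrightarrow> w0" using cl[OF w0] d(1) by auto
    have "(\<lambda>n. F (a n)) \<longlonglongrightarrow> F y" "(\<lambda>n. F (b n)) \<longlonglongrightarrow> F w0"
      using continuous_on_tendsto_compose[OF F a(2) y(1)] continuous_on_tendsto_compose[OF F b(2) w0]
        a(1) b(1) T(3) by (auto simp: subset_iff)
    then have "(\<lambda>n. norm (F (a n) - F (b n))) \<longlonglongrightarrow> norm (F y - F w0)"
      by (intro tendsto_intros)
    moreover have "(\<lambda>n. e * norm (a n - b n)) \<longlonglongrightarrow> e * norm (y - w0)"
      by (intro tendsto_intros a b)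
    ultimately show ?thesis
      by (rule LIMSEQ_le) (use bound[OF a(1) b(1)] in auto)
  qed
  then show "\<exists>d>0. \<forall>y\<in>S. norm (y - w0) < d \<longrightarrow> norm (f y - f w0 - g w0 * (y - w0)) \<le> e * norm (y - w0)"
    using d(1) by (auto simp: F_def dist_norm algebra_simps intro!: exI[of _ d])
qed

lemma closed_quadrant_subset_closure: "closed_quadrant \<subseteq> closure open_quadrant"
proof
  fix w assume w: "w \<in> closed_quadrant"
  define a where "a n = w + of_real (inverse (real (Suc n))) * (1 + \<i>)" for n
  have "a \<longlonglongrightarrow> w + of_real 0 * (1 + \<i>)"
    unfolding a_def by (intro tendsto_intros LIMSEQ_inverse_real_of_nat)
  moreover have "a n \<in> open_quadrant" for n
    using w by (auto simp: a_def open_quadrant_def closed_quadrant_def intro!: add_nonneg_pos)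
  ultimately show "w \<in> closure open_quadrant" unfolding closure_sequential by auto
qed

definition sc_map :: "real \<Rightarrow> complex \<Rightarrow> complex" where
  "sc_map k w = sc_integral k w - sc_integral k 0"

section \<open>Derivative and limits of the Schwarz-Christoffel map up to the boundary\<close>

locale sc_modulus =
  fixes k :: real
  assumes k_pos: "0 < k" and k_less_1: "k < 1"
begin

lemma one_less_inv: "1 < 1 / k" using k_pos k_less_1 by simp

lemma continuous_on_sc_map: "continuous_on closed_quadrant (sc_map k)"
  unfolding sc_map_def by (intro continuous_intros continuous_on_sc_integral k_pos k_less_1)

lemma sc_map_0 [simp]: "sc_map k 0 = 0" by (simp add: sc_map_def)

lemma sc_map_deriv_interior: "w \<in> open_quadrant \<Longrightarrow> (sc_map k has_field_derivative sc_density k w) (at w)"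
  unfolding sc_map_def[abs_def]
  by (auto intro!: derivative_eq_intros sc_integral_deriv_interior k_pos k_less_1)

lemma sc_map_deriv:
  assumes "w \<in> closed_quadrant - {1, of_real (1/k)}"
  shows "(sc_map k has_field_derivative sc_density k w) (at w within closed_quadrant)"
proof (rule has_field_derivative_closure[OF convex_open_quadrant open_open_quadrant
      open_quadrant_subset closed_quadrant_subset_closure continuous_on_sc_map sc_map_deriv_interior])
  show "w \<in> closed_quadrant" using assms by auto
  have "continuous (at w within closed_quadrant - {1, of_real (1/k)}) (sc_density k)"
    using continuous_on_sc_density[OF k_pos] assms by (simp add: continuous_on_eq_continuous_within)
  moreover have "at w within closed_quadrant - {1, of_real (1/k)} = at w within closed_quadrant"
    by (rule at_within_nhd[of _ "- {1, of_real (1/k)}"]) (use assms in \<open>auto intro!: open_Compl\<close>)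
  ultimately show "continuous (at w within closed_quadrant) (sc_density k)" by simp
qed

text \<open>\<open>sc_integral\<close> vanishes at infinity, so this is the image of the fourth
  prevertex.\<close>

definition corner :: complex where "corner = - sc_integral k 0"

lemma sc_map_at_infinity:
  assumes "\<And>n. W n \<in> closed_quadrant" "filterlim W at_infinity sequentially"
  shows "(\<lambda>n. sc_map k (W n)) \<longlonglongrightarrow> corner"
  using tendsto_diff[OF sc_integral_at_infinity[OF k_pos k_less_1 assms] tendsto_const, of "sc_integral k 0"]
  by (simp add: sc_map_def corner_def)

lemma sc_map_real_deriv:
  assumes x: "0 < x" "x \<noteq> 1" "x \<noteq> 1 / k"
  shows "((\<lambda>x. sc_map k (of_real x)) has_vector_derivative sc_density k (of_real x)) (at x)"
proof -
  have w: "of_real x \<in> closed_quadrant - {1, of_real (1/k)}"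
    using x by (simp add: closed_quadrant_def del: of_real_divide)
  have "(sc_map k has_field_derivative sc_density k (of_real x)) (at (of_real x) within of_real ` {0..})"
    by (rule has_field_derivative_subset[OF sc_map_deriv[OF w]]) (auto simp: closed_quadrant_def)
  moreover have "(of_real has_vector_derivative (1::complex)) (at x within {0..})"
    by (auto intro!: derivative_eq_intros)
  ultimately have "((sc_map k \<circ> of_real) has_vector_derivative 1 * sc_density k (of_real x)) (at x within {0..})"
    by (intro field_vector_diff_chain_within)
  moreover have "at x within {0..} = at x" using x by (intro at_within_interior) simp
  ultimately show ?thesis by (simp add: o_def)
qed

lemma sc_map_imag_deriv:
  assumes y: "0 < y"
  shows "((\<lambda>y. sc_map k (\<i> * of_real y)) has_vector_derivative \<i> * sc_density k (\<i> * of_real y)) (at y)"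
proof -
  have w: "\<i> * of_real y \<in> closed_quadrant - {1, of_real (1/k)}"
    using y k_pos by (auto simp: closed_quadrant_def complex_eq_iff)
  have "(sc_map k has_field_derivative sc_density k (\<i> * of_real y)) (at (\<i> * of_real y) within (\<lambda>y. \<i> * of_real y) ` {0..})"
    by (rule has_field_derivative_subset[OF sc_map_deriv[OF w]]) (auto simp: closed_quadrant_def)
  moreover have "((\<lambda>y. \<i> * of_real y) has_vector_derivative \<i>) (at y within {0..})"
    by (auto intro!: derivative_eq_intros)
  ultimately have "((sc_map k \<circ> (\<lambda>y. \<i> * of_real y)) has_vector_derivative \<i> * sc_density k (\<i> * of_real y)) (at y within {0..})"
    by (intro field_vector_diff_chain_within)
  moreover have "at y within {0..} = at y" using y by (intro at_within_interior) simp
  ultimately show ?thesis by (simp add: o_def)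
qed

lemma continuous_on_sc_map_compose:
  "continuous_on S h \<Longrightarrow> h ` S \<subseteq> closed_quadrant \<Longrightarrow> continuous_on S (\<lambda>x. sc_map k (h x))"
  by (rule continuous_on_compose2[OF continuous_on_sc_map])

lemma sc_map_real_cont: "0 \<le> a \<Longrightarrow> continuous_on {a..b} (\<lambda>x. sc_map k (of_real x))"
  by (intro continuous_on_sc_map_compose continuous_intros) (auto simp: closed_quadrant_def)

lemma sc_map_imag_cont: "0 \<le> a \<Longrightarrow> continuous_on {a..b} (\<lambda>x. sc_map k (\<i> * of_real x))"
  by (intro continuous_on_sc_map_compose continuous_intros) (auto simp: closed_quadrant_def)

definition rad :: "real \<Rightarrow> real" where "rad x = sqrt \<bar>x\<^sup>2 - 1\<bar> * sqrt \<bar>(k * x)\<^sup>2 - 1\<bar>"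

lemma rad_pos: "0 < x \<Longrightarrow> x \<noteq> 1 \<Longrightarrow> x \<noteq> 1 / k \<Longrightarrow> rad x > 0"
proof -
  assume x: "0 < x" "x \<noteq> 1" "x \<noteq> 1 / k"
  have "k * x \<noteq> 1" "0 < k * x" using x k_pos by (auto simp: field_simps)
  then have "x\<^sup>2 \<noteq> 1" "(k * x)\<^sup>2 \<noteq> 1" using x(1,2) by (auto simp only: power2_eq_1_iff)
  then show "rad x > 0" by (simp add: rad_def)
qed

lemma i_quotients:
  fixes a b :: complex
  shows "- 1 / ((\<i> * a) * (\<i> * b)) = 1 / (a * b)" "- 1 / (a * (\<i> * b)) = \<i> * (1 / (a * b))"
proof -
  have "(\<i> * a) * (\<i> * b) = - (a * b)" by (simp add: mult.assoc mult.left_commute)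
  then show "- 1 / ((\<i> * a) * (\<i> * b)) = 1 / (a * b)" by simp
  have "a * (\<i> * b) = \<i> * (a * b)" by (simp add: mult_ac)
  then have "- 1 / (a * (\<i> * b)) = (- 1 / \<i>) * (1 / (a * b))"
    by (simp only: times_divide_times_eq mult_1_right)
  moreover have "- 1 / \<i> = \<i>" by (simp add: field_simps)
  ultimately show "- 1 / (a * (\<i> * b)) = \<i> * (1 / (a * b))" by simp
qed

text \<open>Passing 1 or \<open>1 / k\<close> multiplies the direction of the density by i: it
  points right, then up, then left. The positive axis is thus bent into three sides of a
  rectangle.\<close>

lemma sc_density_real:
  assumes x: "0 < x"
  shows "x < 1 \<Longrightarrow> sc_density k (of_real x) = of_real (1 / rad x)"
    and "1 < x \<Longrightarrow> x < 1 / k \<Longrightarrow> sc_density k (of_real x) = \<i> * of_real (1 / rad x)"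
    and "1 / k < x \<Longrightarrow> sc_density k (of_real x) = of_real (- 1 / rad x)"
proof -
  have e: "(of_real x :: complex)\<^sup>2 - 1 = of_real (x\<^sup>2 - 1)"
    "(of_real k * of_real x :: complex)\<^sup>2 - 1 = of_real ((k * x)\<^sup>2 - 1)" by simp_all
  have kx: "0 < k * x" using x k_pos by simp
  have neg: "csqrt (of_real y) = \<i> * of_real (sqrt \<bar>y\<bar>)" if "y \<le> 0" for y
    using that by (subst csqrt_of_real_nonpos) auto
  have pos: "csqrt (of_real y) = of_real (sqrt \<bar>y\<bar>)" if "y \<ge> 0" for y
    using that by (subst csqrt_of_real_nonneg) auto
  show "sc_density k (of_real x) = of_real (1 / rad x)" if "x < 1"
  proof -
    have "k * x < 1" using that x k_less_1 k_pos by (smt (verit) mult_less_cancel_right2)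
    then have "x\<^sup>2 - 1 \<le> 0" "(k * x)\<^sup>2 - 1 \<le> 0" using that x kx by (simp_all add: power_le_one)
    then show ?thesis unfolding sc_density_def e rad_def by (simp only: neg i_quotients) simp
  qed
  show "sc_density k (of_real x) = \<i> * of_real (1 / rad x)" if "1 < x" "x < 1 / k"
  proof -
    have "k * x < 1" using that k_pos by (simp add: field_simps)
    then have "x\<^sup>2 - 1 \<ge> 0" "(k * x)\<^sup>2 - 1 \<le> 0" using that x kx by (simp_all add: power_le_one)
    then show ?thesis unfolding sc_density_def e rad_def by (simp only: neg pos i_quotients) simp
  qed
  show "sc_density k (of_real x) = of_real (- 1 / rad x)" if "1 / k < x"
  proof -
    have "k * x > 1" using that k_pos by (simp add: field_simps)
    moreover have "x > 1" using that one_less_inv by linarith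
    ultimately have "x\<^sup>2 - 1 \<ge> 0" "(k * x)\<^sup>2 - 1 \<ge> 0" by simp_all
    then show ?thesis unfolding sc_density_def e rad_def by (simp only: pos) simp
  qed
qed

lemma sc_density_imag:
  "sc_density k (\<i> * of_real y) = of_real (1 / (sqrt (1 + y\<^sup>2) * sqrt (1 + k\<^sup>2 * y\<^sup>2)))"
proof -
  have e: "(\<i> * of_real y :: complex)\<^sup>2 - 1 = of_real (- (1 + y\<^sup>2))"
    "(of_real k * (\<i> * of_real y) :: complex)\<^sup>2 - 1 = of_real (- (1 + k\<^sup>2 * y\<^sup>2))"
    by (simp_all add: power_mult_distrib)
  have neg: "csqrt (of_real (- y)) = \<i> * of_real (sqrt y)" if "y \<ge> 0" for y
    using that by (subst csqrt_of_real_nonpos) auto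
  have "0 \<le> 1 + y\<^sup>2" "0 \<le> 1 + k\<^sup>2 * y\<^sup>2" by auto
  then show ?thesis unfolding sc_density_def e by (simp only: neg i_quotients) simp
qed

end

lemma strictly_increasing_less_limit:
  fixes f :: "real \<Rightarrow> real"
  assumes inc: "\<And>x y. a \<le> x \<Longrightarrow> x < y \<Longrightarrow> f x < f y"
    and lim: "(\<lambda>n. f (a + real n)) \<longlonglongrightarrow> l" and x: "a \<le> x"
  shows "f x < l"
proof -
  have "f x < f (x + 1)" using inc x by simp
  also have "f (x + 1) \<le> l"
  proof (rule tendsto_lowerbound[OF lim])
    show "eventually (\<lambda>n. f (x + 1) \<le> f (a + real n)) sequentially"
      using eventually_ge_at_top[of "nat \<lceil>x + 2 - a\<rceil>"]
    proof eventually_elim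
      case (elim n)
      then have "x + 1 < a + real n" by linarith
      then show ?case using inc[of "x+1" "a + real n"] x by simp
    qed
  qed simp
  finally show ?thesis .
qed

section \<open>Boundary values: the two half-axes trace the sides of a rectangle\<close>

context sc_modulus
begin

definition width :: real where "width = Re (sc_map k 1)"
definition height :: real where "height = Im (sc_map k (of_real (1/k)))"

lemma sc_map_real_axis_deriv:
  assumes "0 < x" "x \<noteq> 1" "x \<noteq> 1 / k"
  shows "DERIV (\<lambda>x. Re (sc_map k (of_real x))) x :> Re (sc_density k (of_real x))"
    and "DERIV (\<lambda>x. Im (sc_map k (of_real x))) x :> Im (sc_density k (of_real x))"
  using has_field_derivative_Re[OF sc_map_real_deriv[OF assms]]
    has_field_derivative_Im[OF sc_map_real_deriv[OF assms]] by simp_all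

lemma sc_map_real_axis_cont:
  assumes "0 \<le> a"
  shows "continuous_on {a..b} (\<lambda>x. Re (sc_map k (of_real x)))"
    "continuous_on {a..b} (\<lambda>x. Im (sc_map k (of_real x)))"
  by (intro continuous_on_Re continuous_on_Im sc_map_real_cont assms)+

lemma side1_Im:
  assumes x: "0 \<le> x" "x \<le> 1"
  shows "Im (sc_map k (of_real x)) = 0"
proof -
  have "DERIV (\<lambda>x. Im (sc_map k (of_real x))) z :> 0" if "0 < z" "z < 1" for z
    using sc_map_real_axis_deriv(2)[of z] sc_density_real(1)[of z] that one_less_inv by simp
  from DERIV_isconst2[OF _ sc_map_real_axis_cont(2) this x] show ?thesis by simp
qed

lemma side1_Re: "0 \<le> x \<Longrightarrow> x < y \<Longrightarrow> y \<le> 1 \<Longrightarrow> Re (sc_map k (of_real x)) < Re (sc_map k (of_real y))"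
proof (rule DERIV_pos_imp_increasing_open[OF _ _ sc_map_real_axis_cont(1)])
  fix z assume "0 \<le> x" "y \<le> 1" and z: "x < z" "z < y"
  then have z': "0 < z" "z < 1" by auto
  then show "\<exists>d. DERIV (\<lambda>x. Re (sc_map k (of_real x))) z :> d \<and> d > 0"
    using sc_map_real_axis_deriv(1)[of z] sc_density_real(1)[of z] rad_pos[of z] one_less_inv
    by (intro exI[of _ "1 / rad z"]) auto
qed auto

lemma side2_Re:
  assumes x: "1 \<le> x" "x \<le> 1 / k"
  shows "Re (sc_map k (of_real x)) = width"
proof -
  have "DERIV (\<lambda>x. Re (sc_map k (of_real x))) z :> 0" if "1 < z" "z < 1 / k" for z
    using sc_map_real_axis_deriv(1)[of z] sc_density_real(2)[of z] that by simp
  from DERIV_isconst2[OF one_less_inv sc_map_real_axis_cont(1) this x] show ?thesis by (simp add: width_def)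
qed

lemma side2_Im: "1 \<le> x \<Longrightarrow> x < y \<Longrightarrow> y \<le> 1 / k \<Longrightarrow> Im (sc_map k (of_real x)) < Im (sc_map k (of_real y))"
proof (rule DERIV_pos_imp_increasing_open[OF _ _ sc_map_real_axis_cont(2)])
  fix z assume "1 \<le> x" "y \<le> 1 / k" and z: "x < z" "z < y"
  then have z': "1 < z" "z < 1 / k" by auto
  then show "\<exists>d. DERIV (\<lambda>x. Im (sc_map k (of_real x))) z :> d \<and> d > 0"
    using sc_map_real_axis_deriv(2)[of z] sc_density_real(2)[of z] rad_pos[of z]
    by (intro exI[of _ "1 / rad z"]) auto
qed auto

lemma side3_Im:
  assumes "1 / k \<le> x" shows "Im (sc_map k (of_real x)) = height"
proof -
  have "DERIV (\<lambda>x. Im (sc_map k (of_real x))) z :> 0" if "1 / k < z" for z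
    using sc_map_real_axis_deriv(2)[of z] sc_density_real(3)[of z] that one_less_inv by simp
  from DERIV_isconst2[OF _ sc_map_real_axis_cont(2) this, of "1/k" "x+1" x] show ?thesis
    using assms k_pos by (simp add: height_def)
qed

lemma side3_Re: "1 / k \<le> x \<Longrightarrow> x < y \<Longrightarrow> Re (sc_map k (of_real x)) > Re (sc_map k (of_real y))"
proof (rule DERIV_neg_imp_decreasing_open[OF _ _ sc_map_real_axis_cont(1)])
  fix z assume "1 / k \<le> x" and z: "x < z" "z < y"
  then have z': "1 / k < z" "0 < z" "1 < z" using one_less_inv by linarith+
  then show "\<exists>d. DERIV (\<lambda>x. Re (sc_map k (of_real x))) z :> d \<and> d < 0"
    using sc_map_real_axis_deriv(1)[of z] sc_density_real(3)[of z] rad_pos[of z]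
    by (intro exI[of _ "- 1 / rad z"]) auto
next
  assume "1 / k \<le> x" then show "0 \<le> x" using one_less_inv by linarith
qed auto

lemma sc_map_imag_axis_cont:
  assumes "0 \<le> a"
  shows "continuous_on {a..b} (\<lambda>x. Re (sc_map k (\<i> * of_real x)))"
    "continuous_on {a..b} (\<lambda>x. Im (sc_map k (\<i> * of_real x)))"
  by (intro continuous_on_Re continuous_on_Im sc_map_imag_cont assms)+

definition imag_speed :: "real \<Rightarrow> real" where
  "imag_speed y = 1 / (sqrt (1 + y\<^sup>2) * sqrt (1 + k\<^sup>2 * y\<^sup>2))"

lemma imag_speed_pos: "imag_speed y > 0"
  unfolding imag_speed_def by (auto intro!: divide_pos_pos mult_pos_pos add_pos_nonneg)

lemma sc_map_imag_axis_deriv: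
  assumes "0 < y"
  shows "DERIV (\<lambda>y. Re (sc_map k (\<i> * of_real y))) y :> 0"
    and "DERIV (\<lambda>y. Im (sc_map k (\<i> * of_real y))) y :> imag_speed y"
  using has_field_derivative_Re[OF sc_map_imag_deriv[OF assms]]
    has_field_derivative_Im[OF sc_map_imag_deriv[OF assms]]
  unfolding sc_density_imag imag_speed_def[symmetric] by simp_all

lemma side4_Re:
  assumes "0 \<le> y" shows "Re (sc_map k (\<i> * of_real y)) = 0"
  using DERIV_isconst2[OF _ sc_map_imag_axis_cont(1) sc_map_imag_axis_deriv(1), of 0 "y+1" y] assms by simp

lemma side4_Im: "0 \<le> x \<Longrightarrow> x < y \<Longrightarrow> Im (sc_map k (\<i> * of_real x)) < Im (sc_map k (\<i> * of_real y))"
  by (rule DERIV_pos_imp_increasing_open[OF _ _ sc_map_imag_axis_cont(2)])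
     (use sc_map_imag_axis_deriv(2) imag_speed_pos in \<open>auto intro: less_le_trans le_less_trans\<close>)

lemma ray_at_infinity:
  fixes c v :: complex assumes "v \<noteq> 0"
  shows "filterlim (\<lambda>n. c + of_nat n * v) at_infinity sequentially"
proof (rule tendsto_add_filterlim_at_infinity[OF tendsto_const])
  show "filterlim (\<lambda>n. of_nat n * v) at_infinity sequentially"
    by (rule tendsto_mult_filterlim_at_infinity[OF tendsto_const assms, THEN filterlim_cong[OF refl refl, THEN iffD1, rotated], of "of_nat"])
       (auto simp: mult.commute intro: tendsto_of_nat)
qed

lemma ray_lim:
  assumes w: "w \<in> closed_quadrant" and v: "v \<in> closed_quadrant" "v \<noteq> 0"
  shows "(\<lambda>n. sc_map k (w + of_nat n * v)) \<longlonglongrightarrow> corner"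
  by (rule sc_map_at_infinity[OF _ ray_at_infinity[OF v(2)]])
     (use w v in \<open>auto simp: closed_quadrant_def\<close>)

text \<open>Two ways to infinity meet in one limit: the imaginary axis keeps the real part 0, the
  real axis beyond \<open>1 / k\<close> keeps the imaginary part \<open>height\<close>. This closes
  the rectangle.\<close>

lemma corner_eq: "corner = Complex 0 height"
proof (rule complex_eqI)
  have "(\<lambda>n. Re (sc_map k (0 + of_nat n * \<i>))) \<longlonglongrightarrow> Re corner"
    by (intro tendsto_Re ray_lim) (auto simp: closed_quadrant_def)
  moreover have "Re (sc_map k (0 + of_nat n * \<i>)) = 0" for n
    using side4_Re[of "real n"] by (simp add: mult.commute)
  ultimately show "Re corner = Re (Complex 0 height)"
    by (simp add: LIMSEQ_const_iff)
  have "(\<lambda>n. Im (sc_map k (of_real (1/k) + of_nat n * 1))) \<longlonglongrightarrow> Im corner"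
    by (intro tendsto_Im ray_lim) (use k_pos in \<open>auto simp: closed_quadrant_def\<close>)
  moreover have "Im (sc_map k (of_real (1/k) + of_nat n * 1)) = height" for n
    using side3_Im[of "1/k + real n"] by simp
  ultimately show "Im corner = Im (Complex 0 height)"
    by (simp add: LIMSEQ_const_iff)
qed

lemma width_pos: "width > 0"
  using side1_Re[of 0 1] by (simp add: width_def)

lemma height_pos: "height > 0"
  using side2_Im[of 1 "1/k"] one_less_inv side1_Im[of 1] by (simp add: height_def)

lemma side3_Re_pos:
  assumes "1 / k \<le> x" shows "0 < Re (sc_map k (of_real x))"
proof -
  have "(\<lambda>n. Re (sc_map k (of_real (1/k) + of_nat n * 1))) \<longlonglongrightarrow> Re corner"
    by (intro tendsto_Re ray_lim) (use k_pos in \<open>auto simp: closed_quadrant_def\<close>)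
  then have "(\<lambda>n. - Re (sc_map k (of_real (1/k + real n)))) \<longlonglongrightarrow> - Re corner"
    by (intro tendsto_minus) simp
  from strictly_increasing_less_limit[OF _ this assms] show ?thesis
    using side3_Re by (simp add: corner_eq)
qed

lemma side4_Im_less:
  assumes "0 \<le> y" shows "Im (sc_map k (\<i> * of_real y)) < height"
proof -
  have "(\<lambda>n. Im (sc_map k (0 + of_nat n * \<i>))) \<longlonglongrightarrow> Im corner"
    by (intro tendsto_Im ray_lim) (auto simp: closed_quadrant_def)
  then have "(\<lambda>n. Im (sc_map k (\<i> * of_real (0 + real n)))) \<longlonglongrightarrow> Im corner"
    by (simp add: mult.commute)
  from strictly_increasing_less_limit[OF _ this assms] show ?thesis
    using side4_Im by (simp add: corner_eq)
qed

lemma side_cases: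
  assumes "0 \<le> x"
  obtains "x \<le> 1" | "1 \<le> x" "x \<le> 1/k" | "1/k \<le> x"
  using assms by linarith

lemma real_Re_le:
  assumes x: "0 \<le> x"
  shows "Re (sc_map k (of_real x)) \<le> width"
  using x
proof (cases rule: side_cases)
  case 1
  with x show ?thesis using side1_Re[of x 1] by (cases "x = 1") (auto simp: width_def)
next
  case 3
  then show ?thesis using side3_Re[of "1/k" x] side2_Re[of "1/k"] one_less_inv by (cases "x = 1/k") auto
qed (use side2_Re in auto)

lemma real_Im_range:
  assumes x: "0 \<le> x"
  shows "0 \<le> Im (sc_map k (of_real x)) \<and> Im (sc_map k (of_real x)) \<le> height"
  using x
proof (cases rule: side_cases)
  case 1
  with x show ?thesis using side1_Im height_pos by auto
next
  case 2
  then show ?thesis using side2_Im[of 1 x] side2_Im[of x "1/k"] side1_Im[of 1] side3_Im[of "1/k"]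
    by (cases "x = 1"; cases "x = 1/k") auto
next
  case 3
  then show ?thesis using side3_Im[of x] height_pos by auto
qed

lemma real_Re_nonneg:
  assumes x: "0 \<le> x"
  shows "0 \<le> Re (sc_map k (of_real x))"
  using x
proof (cases rule: side_cases)
  case 1
  with x show ?thesis using side1_Re[of 0 x] by (cases "x = 0") auto
next
  case 3
  then show ?thesis using side3_Re_pos by (simp add: less_imp_le)
qed (use side2_Re width_pos in auto)

lemma imag_Im_range: "0 \<le> y \<Longrightarrow> 0 \<le> Im (sc_map k (\<i> * of_real y))"
  using side4_Im[of 0 y] by (cases "y = 0") auto

lemma line_deriv:
  assumes "w + of_real t * v \<in> open_quadrant"
  shows "((\<lambda>t. sc_map k (w + of_real t * v)) has_vector_derivative v * sc_density k (w + of_real t * v)) (at t)"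
proof -
  have "((\<lambda>t. w + of_real t * v) has_vector_derivative v) (at t within UNIV)"
    by (auto intro!: derivative_eq_intros)
  from field_vector_diff_chain_within[OF this has_field_derivative_at_within[OF sc_map_deriv_interior[OF assms]]]
  show ?thesis by (simp add: o_def)
qed

text \<open>The horizontal derivative of the imaginary part is the imaginary part of the density,
  which is positive. A vertical step carries a factor i, so the same sign makes the real part fall
  in \<open>interior_Re_decreasing\<close>.\<close>

lemma interior_Im_increasing:
  assumes y: "0 < y" and x: "0 \<le> x" "x < x'"
  shows "Im (sc_map k (of_real x + \<i> * of_real y)) < Im (sc_map k (of_real x' + \<i> * of_real y))"
proof -
  have "Im (sc_map k (\<i> * of_real y + of_real x * 1)) < Im (sc_map k (\<i> * of_real y + of_real x' * 1))"
  proof (rule DERIV_pos_imp_increasing_open[OF x(2)])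
    fix z assume z: "x < z" "z < x'"
    then have oq: "\<i> * of_real y + of_real z * 1 \<in> open_quadrant" using x y by (auto simp: open_quadrant_def)
    show "\<exists>d. DERIV (\<lambda>x. Im (sc_map k (\<i> * of_real y + of_real x * 1))) z :> d \<and> d > 0"
      using has_field_derivative_Im[OF line_deriv[OF oq]] Im_sc_density_pos[OF k_pos oq] by auto
  next
    show "continuous_on {x..x'} (\<lambda>x. Im (sc_map k (\<i> * of_real y + of_real x * 1)))"
      by (intro continuous_on_Im continuous_on_sc_map_compose continuous_intros)
         (use x y in \<open>auto simp: closed_quadrant_def\<close>)
  qed
  then show ?thesis by (simp add: add.commute)
qed

lemma interior_Re_decreasing:
  assumes x: "0 < x" and y: "0 \<le> y" "y < y'"
  shows "Re (sc_map k (of_real x + \<i> * of_real y)) > Re (sc_map k (of_real x + \<i> * of_real y'))"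
proof -
  have "Re (sc_map k (of_real x + of_real y * \<i>)) > Re (sc_map k (of_real x + of_real y' * \<i>))"
  proof (rule DERIV_neg_imp_decreasing_open[OF y(2)])
    fix z assume z: "y < z" "z < y'"
    then have oq: "of_real x + of_real z * \<i> \<in> open_quadrant" using x y by (auto simp: open_quadrant_def)
    show "\<exists>d. DERIV (\<lambda>y. Re (sc_map k (of_real x + of_real y * \<i>))) z :> d \<and> d < 0"
      using has_field_derivative_Re[OF line_deriv[OF oq]] Im_sc_density_pos[OF k_pos oq]
      by (intro exI[of _ "Re (\<i> * sc_density k (of_real x + of_real z * \<i>))"]) auto
  next
    show "continuous_on {y..y'} (\<lambda>y. Re (sc_map k (of_real x + of_real y * \<i>)))"
      by (intro continuous_on_Re continuous_on_sc_map_compose continuous_intros)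
         (use x y in \<open>auto simp: closed_quadrant_def\<close>)
  qed
  then show ?thesis by (simp add: mult.commute)
qed

text \<open>Each of the four bounds compares the point with the end of a line through it: the
  imaginary axis on the left, the real axis below, and the limit \<open>corner\<close> to the right
  and upwards.\<close>

lemma sc_map_interior_box:
  assumes w: "w \<in> open_quadrant"
  shows "sc_map k w \<in> box 0 (Complex width height)"
proof -
  define x y where "x = Re w" and "y = Im w"
  have xy: "0 < x" "0 < y" using w by (auto simp: x_def y_def open_quadrant_def)
  have w_eq: "w = of_real x + \<i> * of_real y" by (simp add: x_def y_def complex_eq_iff)
  have "Im (sc_map k w) > 0" 
    using interior_Im_increasing[of y 0 x] imag_Im_range[of y] xy by (simp add: w_eq)
  moreover have "Im (sc_map k w) < height"
  proof -
    have "(\<lambda>n. Im (sc_map k (\<i> * of_real y + of_nat n * 1))) \<longlonglongrightarrow> Im corner"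
      by (intro tendsto_Im ray_lim) (use xy in \<open>auto simp: closed_quadrant_def\<close>)
    then have "(\<lambda>n. Im (sc_map k (of_real (0 + real n) + \<i> * of_real y))) \<longlonglongrightarrow> Im corner"
      by (simp add: add.commute)
    from strictly_increasing_less_limit[OF _ this, of x] show ?thesis
      using interior_Im_increasing[OF xy(2)] xy by (simp add: corner_eq w_eq)
  qed
  moreover have "Re (sc_map k w) < width"
    using interior_Re_decreasing[of x 0 y] real_Re_le[of x] xy by (simp add: w_eq)
  moreover have "Re (sc_map k w) > 0"
  proof -
    have "(\<lambda>n. Re (sc_map k (of_real x + of_nat n * \<i>))) \<longlonglongrightarrow> Re corner"
      by (intro tendsto_Re ray_lim) (use xy in \<open>auto simp: closed_quadrant_def\<close>)
    then have "(\<lambda>n. - Re (sc_map k (of_real x + \<i> * of_real (0 + real n)))) \<longlonglongrightarrow> - Re corner"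
      by (intro tendsto_minus) (simp add: mult.commute)
    from strictly_increasing_less_limit[OF _ this, of y] show ?thesis
      using interior_Re_decreasing[OF xy(1)] xy by (simp add: corner_eq w_eq)
  qed
  ultimately show ?thesis by (simp add: in_box_complex_iff)
qed

lemma quadrant_cases:
  assumes "w \<in> closed_quadrant"
  obtains (interior) "w \<in> open_quadrant"
  | (real) x where "0 \<le> x" "w = of_real x"
  | (imag) y where "0 < y" "w = \<i> * of_real y"
proof (cases "Im w = 0")
  case True then show ?thesis using real[of "Re w"] assms by (auto simp: closed_quadrant_def complex_eq_iff)
next
  case False
  then have i: "Im w > 0" using assms by (auto simp: closed_quadrant_def)
  show ?thesis
  proof (cases "Re w = 0")
    case True then show ?thesis using imag[of "Im w"] i by (auto simp: complex_eq_iff)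
  next
    case False then show ?thesis using interior i assms by (auto simp: closed_quadrant_def open_quadrant_def)
  qed
qed

lemma sc_map_in_cbox:
  assumes "w \<in> closed_quadrant"
  shows "sc_map k w \<in> cbox 0 (Complex width height) - {corner}"
  using assms
proof (cases rule: quadrant_cases)
  case interior
  then show ?thesis using sc_map_interior_box[OF interior]
    by (auto simp: in_box_complex_iff in_cbox_complex_iff corner_eq)
next
  case (real x)
  have "sc_map k (of_real x) \<noteq> corner"
  proof
    assume e: "sc_map k (of_real x) = corner"
    from real(1) show False
    proof (cases rule: side_cases)
      case 1 then show False using e real(1) side1_Im[of x] height_pos by (simp add: corner_eq)
    next
      case 2 then show False using e side2_Re[of x] width_pos by (simp add: corner_eq)
    next
      case 3 then show False using e side3_Re_pos[of x] by (simp add: corner_eq)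
    qed
  qed
  then show ?thesis using real real_Re_le real_Re_nonneg real_Im_range by (auto simp: in_cbox_complex_iff)
next
  case (imag y)
  have "sc_map k (\<i> * of_real y) \<noteq> corner"
    using side4_Im_less[of y] imag(1) by (auto simp: corner_eq)
  then show ?thesis using imag side4_Re[of y] imag_Im_range[of y] side4_Im_less[of y] width_pos
    by (auto simp: in_cbox_complex_iff)
qed

lemma sc_map_frontier:
  assumes "w \<in> closed_quadrant" "w \<notin> open_quadrant"
  shows "sc_map k w \<notin> box 0 (Complex width height)"
  using assms(1)
proof (cases rule: quadrant_cases)
  case (real x)
  from real(1) show ?thesis
  proof (cases rule: side_cases)
    case 1 then show ?thesis using real side1_Im[of x] by (simp add: in_box_complex_iff)
  next
    case 2 then show ?thesis using real side2_Re[of x] by (simp add: in_box_complex_iff)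
  next
    case 3 then show ?thesis using real side3_Im[of x] by (simp add: in_box_complex_iff)
  qed
next
  case (imag y) then show ?thesis using side4_Re[of y] by (simp add: in_box_complex_iff)
qed (use assms in auto)

end

section \<open>Injectivity, image and side lengths\<close>

context sc_modulus
begin

text \<open>The Noshiro-Warschawski argument: along a segment with direction \<open>v\<close> the
  quotient of the increment by \<open>v\<close> has positive imaginary part, so it is not 0. It
  needs the open segment to lie in the open quadrant; two points on the same axis are separated by
  the monotonicity on the sides instead.\<close>

lemma inj_on_sc_map: "inj_on (sc_map k) closed_quadrant"
proof (rule inj_onI, rule ccontr)
  fix a b assume a: "a \<in> closed_quadrant" and b: "b \<in> closed_quadrant"
    and eq: "sc_map k a = sc_map k b" and ne: "a \<noteq> b"
  consider (real) "Im a = 0" "Im b = 0" | (imag) "Re a = 0" "Re b = 0"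
    | (seg) "\<not> (Re a = 0 \<and> Re b = 0)" "\<not> (Im a = 0 \<and> Im b = 0)"
    by blast
  then show False
  proof cases
    case real
    have *: False if xy: "0 \<le> x" "x < y" and eq: "sc_map k (of_real x) = sc_map k (of_real y)" for x y
    proof -
      consider "y \<le> 1" | "1/k \<le> x" | "1 \<le> x" "y \<le> 1/k" | "x < 1" "1 < y" | "1 \<le> x" "x < 1/k" "1/k < y"
        using xy by linarith
      then show False
      proof cases
        case 1 then show False using side1_Re[OF xy] eq by simp
      next
        case 2 then show False using side3_Re[OF _ xy(2)] eq by simp
      next
        case 3 then show False using side2_Im[OF _ xy(2)] eq by simp
      next
        case 4
        show False
        proof (cases "y \<le> 1 / k")
          case True
          then show False using side2_Im[of 1 y] side1_Im[of 1] side1_Im[of x] eq xy(1) 4 by simp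
        next
          case False
          then show False using side3_Im[of y] height_pos side1_Im[of x] eq xy(1) 4 by simp
        qed
      next
        case 5
        then show False using side3_Re[of "1/k" y] side2_Re[of "1/k"] side2_Re[of x] eq one_less_inv by simp
      qed
    qed
    have "a = of_real (Re a)" "b = of_real (Re b)" using real by (auto simp: complex_eq_iff)
    then show False
      using *[of "Re a" "Re b"] *[of "Re b" "Re a"] eq ne a b
      by (cases "Re a" "Re b" rule: linorder_cases) (auto simp: closed_quadrant_def)
  next
    case imag
    have "a = \<i> * of_real (Im a)" "b = \<i> * of_real (Im b)" using imag by (auto simp: complex_eq_iff)
    then show False
      using side4_Im[of "Im a" "Im b"] side4_Im[of "Im b" "Im a"] eq ne a b
      by (cases "Im a" "Im b" rule: linorder_cases) (auto simp: closed_quadrant_def)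
  next
    case seg': seg
    have seg: "Re a > 0 \<or> Re b > 0" "Im a > 0 \<or> Im b > 0"
      using seg' a b by (auto simp: closed_quadrant_def less_le)
    define v where "v = b - a"
    have v: "v \<noteq> 0" using ne by (simp add: v_def)
    have pt: "a + of_real t * v = of_real (1 - t) * a + of_real t * b" for t :: real
      by (simp add: v_def algebra_simps)
    have oq: "a + of_real t * v \<in> open_quadrant" if t: "0 < t" "t < 1" for t
    proof -
      have "(1 - t) * p + t * q > 0" if "p > 0 \<or> q > 0" "p \<ge> 0" "q \<ge> 0" for p q
        using that t by (cases "p > 0") (auto intro: add_pos_nonneg add_nonneg_pos)
      then show ?thesis using seg a b unfolding pt open_quadrant_def closed_quadrant_def by simp
    qed
    have cq: "a + of_real t * v \<in> closed_quadrant" if t: "0 \<le> t" "t \<le> 1" for t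
      using a b t unfolding pt closed_quadrant_def by (auto intro!: add_nonneg_nonneg mult_nonneg_nonneg)
    have "Im (sc_map k (a + of_real 0 * v) / v) < Im (sc_map k (a + of_real 1 * v) / v)"
    proof (rule DERIV_pos_imp_increasing_open[where f = "\<lambda>t. Im (sc_map k (a + of_real t * v) / v)"])
      fix t :: real assume t: "0 < t" "t < 1"
      have "((\<lambda>t. sc_map k (a + of_real t * v) / v) has_vector_derivative
          (v * sc_density k (a + of_real t * v)) / v) (at t)"
        by (rule has_vector_derivative_divide[OF line_deriv[OF oq[OF t]]])
      from has_field_derivative_Im[OF this]
      show "\<exists>d. DERIV (\<lambda>t. Im (sc_map k (a + of_real t * v) / v)) t :> d \<and> d > 0"
        using Im_sc_density_pos[OF k_pos oq[OF t]] v by auto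
    next
      show "continuous_on {0..1} (\<lambda>t. Im (sc_map k (a + of_real t * v) / v))"
        by (intro continuous_on_Im continuous_on_divide continuous_on_sc_map_compose continuous_intros)
           (use v cq in auto)
    qed simp
    then show False using eq by (simp add: v_def)
  qed
qed

lemma sc_map_far:
  assumes e: "e > 0"
  shows "\<exists>R. \<forall>w\<in>closed_quadrant. cmod w \<ge> R \<longrightarrow> dist (sc_map k w) corner < e"
proof (rule ccontr)
  assume "\<not> ?thesis"
  then have "\<forall>n::nat. \<exists>w. w \<in> closed_quadrant \<and> cmod w \<ge> real n \<and> \<not> dist (sc_map k w) corner < e"
    by blast
  then obtain W where W: "\<And>n::nat. W n \<in> closed_quadrant" "\<And>n. cmod (W n) \<ge> real n"
    "\<And>n. \<not> dist (sc_map k (W n)) corner < e" by metis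
  have "filterlim (\<lambda>n. cmod (W n)) at_top sequentially"
    by (rule filterlim_at_top_mono[OF filterlim_real_sequentially]) (use W in auto)
  then have "filterlim W at_infinity sequentially"
    by (rule filterlim_norm_at_top_imp_at_infinity)
  from tendstoD[OF sc_map_at_infinity[OF W(1) this] e] W(3) show False by auto
qed

text \<open>Properness away from \<open>corner\<close>: if the values converge to another point, the
  arguments stay bounded by \<open>sc_map_far\<close>, and a convergent subsequence supplies the
  preimage.\<close>

lemma sc_map_limit_point:
  assumes w: "\<And>n. w n \<in> closed_quadrant" and lim: "(\<lambda>n. sc_map k (w n)) \<longlonglongrightarrow> z" and z: "z \<noteq> corner"
  obtains v where "v \<in> closed_quadrant" "sc_map k v = z"
proof -
  obtain R where R: "\<And>w. w \<in> closed_quadrant \<Longrightarrow> cmod w \<ge> R \<Longrightarrow> dist (sc_map k w) corner < dist z corner / 2"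
    using sc_map_far[of "dist z corner / 2"] z by auto
  have "eventually (\<lambda>n. dist (sc_map k (w n)) z < dist z corner / 2) sequentially"
    using tendstoD[OF lim, of "dist z corner / 2"] z by simp
  then obtain N where N: "\<And>n. n \<ge> N \<Longrightarrow> dist (sc_map k (w n)) z < dist z corner / 2"
    by (auto simp: eventually_sequentially)
  have "cmod (w (n + N)) < R" for n
  proof (rule ccontr)
    assume "\<not> cmod (w (n + N)) < R"
    then have "dist (sc_map k (w (n + N))) corner < dist z corner / 2" using R w by simp
    moreover have "dist (sc_map k (w (n + N))) z < dist z corner / 2" using N by simp
    ultimately show False using dist_triangle[of z corner "sc_map k (w (n + N))"]
      by (simp add: dist_commute)
  qed
  then have "bounded (range (\<lambda>n. w (n + N)))"
    unfolding bounded_iff by (auto intro!: exI[of _ R] less_imp_le)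
  then obtain l r where lr: "strict_mono r" "((\<lambda>n. w (n + N)) \<circ> r) \<longlonglongrightarrow> l"
    using bounded_imp_convergent_subsequence by blast
  have l: "l \<in> closed_quadrant"
    by (rule closed_sequentially[OF closed_closed_quadrant _ lr(2)]) (use w in auto)
  have "(\<lambda>n. sc_map k (w (r n + N))) \<longlonglongrightarrow> sc_map k l"
    using continuous_on_tendsto_compose[OF continuous_on_sc_map lr(2) l] w by (simp add: o_def)
  moreover have "(\<lambda>n. sc_map k (w (r n + N))) \<longlonglongrightarrow> z"
    using LIMSEQ_subseq_LIMSEQ[OF LIMSEQ_ignore_initial_segment[OF lim, of N] lr(1)] by (simp add: o_def)
  ultimately have "sc_map k l = z" by (rule LIMSEQ_unique)
  with l that show thesis by blast
qed

abbreviation "rect \<equiv> Complex width height"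

lemma rect_box_nonempty: "box 0 rect \<noteq> {}"
proof -
  have "Complex (width / 2) (height / 2) \<in> box 0 rect"
    using width_pos height_pos by (simp add: in_box_complex_iff)
  then show ?thesis by blast
qed

lemma sc_map_holomorphic: "sc_map k holomorphic_on open_quadrant"
  unfolding holomorphic_on_open[OF open_open_quadrant] using sc_map_deriv_interior by blast

text \<open>The image is open by injectivity and holomorphy. It is closed relative to the box by
  properness, because boundary points of the quadrant have no image inside the box. The box is
  connected.\<close>

lemma sc_map_open_image: "sc_map k ` open_quadrant = box 0 rect"
proof (rule connected_clopen[THEN iffD1, rule_format, THEN disjE])
  show "connected (box 0 rect)" by (simp add: convex_connected)
  have op: "open (sc_map k ` open_quadrant)"
    by (rule open_mapping_thm3[OF sc_map_holomorphic open_open_quadrant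
          inj_on_subset[OF inj_on_sc_map open_quadrant_subset]])
  have sub: "sc_map k ` open_quadrant \<subseteq> box 0 rect" using sc_map_interior_box by auto
  have "openin (top_of_set (box 0 rect)) (sc_map k ` open_quadrant)"
    by (rule open_subset[OF sub op])
  moreover have "closedin (top_of_set (box 0 rect)) (sc_map k ` open_quadrant)"
    unfolding closedin_limpt
  proof (intro conjI sub allI impI, elim conjE)
    fix l assume "l islimpt sc_map k ` open_quadrant" and l: "l \<in> box 0 rect"
    then obtain x where x: "\<forall>n. x n \<in> sc_map k ` open_quadrant" "x \<longlonglongrightarrow> l"
      unfolding islimpt_sequential by blast
    obtain w where w: "\<And>n. w n \<in> open_quadrant" "\<And>n. x n = sc_map k (w n)"
      using x(1) unfolding image_iff by metis
    have "l \<noteq> corner" using l by (auto simp: corner_eq in_box_complex_iff)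
    moreover have "x = (\<lambda>n. sc_map k (w n))" using w(2) by (rule ext)
    ultimately obtain v where v: "v \<in> closed_quadrant" "sc_map k v = l"
      using sc_map_limit_point[of w l] w(1) x(2) open_quadrant_subset by (metis subset_iff)
    then show "l \<in> sc_map k ` open_quadrant"
      using sc_map_frontier[of v] l by blast
  qed
  ultimately show "openin (top_of_set (box 0 rect)) (sc_map k ` open_quadrant) \<and>
    closedin (top_of_set (box 0 rect)) (sc_map k ` open_quadrant)" ..
  have "1 + \<i> \<in> open_quadrant" by (simp add: open_quadrant_def)
  then show "sc_map k ` open_quadrant = {} \<Longrightarrow> ?thesis" by blast
qed

lemma sc_map_image: "sc_map k ` closed_quadrant = cbox 0 rect - {corner}"
proof
  show "sc_map k ` closed_quadrant \<subseteq> cbox 0 rect - {corner}"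
    by (intro image_subsetI sc_map_in_cbox)
  show "cbox 0 rect - {corner} \<subseteq> sc_map k ` closed_quadrant"
  proof
    fix z assume z: "z \<in> cbox 0 rect - {corner}"
    then have "z \<in> closure (sc_map k ` open_quadrant)"
      using closure_box[OF rect_box_nonempty] by (simp add: sc_map_open_image)
    then obtain x where x: "\<And>n. x n \<in> sc_map k ` open_quadrant" "x \<longlonglongrightarrow> z"
      unfolding closure_sequential by blast
    obtain w where w: "\<And>n. w n \<in> open_quadrant" "\<And>n. x n = sc_map k (w n)"
      using x(1) unfolding image_iff by metis
    have "x = (\<lambda>n. sc_map k (w n))" using w(2) by (rule ext)
    then obtain v where "v \<in> closed_quadrant" "sc_map k v = z"
      using sc_map_limit_point[of w z] w(1) x(2) open_quadrant_subset z by (metis subset_iff DiffE singletonI)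
    then show "z \<in> sc_map k ` closed_quadrant" by blast
  qed
qed

lemma width_eq: "width = elliptic_K k"
proof -
  have "((\<lambda>x. 1 / rad x) has_integral (Re (sc_map k (of_real 1)) - Re (sc_map k (of_real 0)))) {0..1}"
  proof (rule fundamental_theorem_of_calculus_interior[OF _ sc_map_real_axis_cont(1)])
    fix x :: real assume x: "x \<in> {0<..<1}"
    then have "DERIV (\<lambda>x. Re (sc_map k (of_real x))) x :> 1 / rad x"
      using sc_map_real_axis_deriv(1)[of x] sc_density_real(1)[of x] one_less_inv by auto
    then show "((\<lambda>x. Re (sc_map k (of_real x))) has_vector_derivative 1 / rad x) (at x)"
      by (simp add: has_real_derivative_iff_has_vector_derivative)
  qed auto
  moreover have "1 / rad x = 1 / (sqrt (1 - x\<^sup>2) * sqrt (1 - k\<^sup>2 * x\<^sup>2))" if "x \<in> {0..1}" for x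
  proof -
    have "x\<^sup>2 \<le> 1" "(k * x)\<^sup>2 \<le> 1" using that k_pos k_less_1
      by (auto intro!: power_le_one mult_le_one)
    then show ?thesis by (simp add: rad_def power_mult_distrib)
  qed
  ultimately have "((\<lambda>x. 1 / (sqrt (1 - x\<^sup>2) * sqrt (1 - k\<^sup>2 * x\<^sup>2))) has_integral width) {0..1}"
    using has_integral_eq[of "{0..1}" "\<lambda>x. 1 / rad x"] by (simp add: width_def)
  then show ?thesis unfolding elliptic_K_def by (simp add: integral_unique)
qed

lemma imag_Im_lim: "((\<lambda>y. Im (sc_map k (\<i> * of_real y))) \<longlongrightarrow> height) at_top"
proof (rule tendstoI)
  fix e :: real assume "e > 0"
  then obtain R where R: "\<And>w. w \<in> closed_quadrant \<Longrightarrow> cmod w \<ge> R \<Longrightarrow> dist (sc_map k w) corner < e"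
    using sc_map_far by blast
  show "eventually (\<lambda>y. dist (Im (sc_map k (\<i> * of_real y))) height < e) at_top"
    using eventually_ge_at_top[of "max 0 R"]
  proof eventually_elim
    case (elim y)
    then have "dist (sc_map k (\<i> * of_real y)) corner < e"
      by (intro R) (auto simp: closed_quadrant_def norm_mult)
    then show ?case
      using abs_Im_le_cmod[of "sc_map k (\<i> * of_real y) - corner"] by (simp add: dist_norm corner_eq)
  qed
qed

text \<open>The height is read off along the imaginary axis, where
  \<open>y = x / sqrt (1 - x^2)\<close> turns the speed into the integrand of the complementary
  integral. The end \<open>x = 1\<close> corresponds to infinity, so the primitive \<open>G\<close>
  is completed there by its limit.\<close>

lemma height_eq: "height = elliptic_K (sqrt (1 - k\<^sup>2))"
proof -
  define y where "y x = x / sqrt (1 - x\<^sup>2)" for x :: real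
  define G where "G x = (if x < 1 then Im (sc_map k (\<i> * of_real (y x))) else height)" for x
  define g where "g x = 1 / (sqrt (1 - x\<^sup>2) * sqrt (1 - (sqrt (1 - k\<^sup>2))\<^sup>2 * x\<^sup>2))" for x
  have k2: "k\<^sup>2 < 1" "k\<^sup>2 \<le> 1" using k_pos k_less_1 by (auto simp: power_less_one_iff power_le_one)
  have y_lim: "filterlim y at_top (at_left 1)" unfolding y_def by real_asymp
  have pos: "1 - x\<^sup>2 > 0" if "0 \<le> x" "x < 1" for x :: real
    using that by (simp add: power_less_one_iff)
  have "(g has_integral (G 1 - G 0)) {0..1}"
  proof (rule fundamental_theorem_of_calculus_interior)
    show "continuous_on {0..1} G"
      unfolding continuous_on_def
    proof
      fix x :: real assume x: "x \<in> {0..1}"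
      show "(G \<longlongrightarrow> G x) (at x within {0..1})"
      proof (cases "x = 1")
        case True
        have "((\<lambda>x. Im (sc_map k (\<i> * of_real (y x)))) \<longlongrightarrow> height) (at_left 1)"
          by (rule filterlim_compose[OF imag_Im_lim y_lim])
        then have "(G \<longlongrightarrow> height) (at_left 1)"
          by (rule Lim_transform_eventually)
             (auto simp: G_def eventually_at_left_field intro!: exI[of _ 0])
        then show ?thesis using True by (simp add: G_def at_within_Icc_at_left)
      next
        case False
        then have x1: "0 \<le> x" "x < 1" using x by auto
        have "continuous_on {0..<1} y" unfolding y_def
          by (intro continuous_intros) (use pos in force)
        then have "continuous_on {0..<1} (\<lambda>x. Im (sc_map k (\<i> * of_real (y x))))"
          by (intro continuous_on_Im continuous_on_sc_map_compose continuous_intros)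
             (auto simp: closed_quadrant_def y_def power_le_one intro!: divide_nonneg_nonneg)
        then have "continuous_on {0..<1} G" by (rule continuous_on_eq) (auto simp: G_def)
        then have "(G \<longlongrightarrow> G x) (at x within {0..<1})" using x1 by (simp add: continuous_on_def)
        moreover have "at x within {0..<1} = at x within {0..1}"
          by (rule at_within_nhd[of _ "{..<1}"]) (use x1 in auto)
        ultimately show ?thesis by simp
      qed
    qed
    fix x :: real assume "x \<in> {0<..<1}"
    then have x: "0 < x" "x < 1" by auto
    define s where "s = sqrt (1 - x\<^sup>2)"
    have s: "s > 0" "s\<^sup>2 = 1 - x\<^sup>2" using pos[of x] x by (auto simp: s_def)
    have yx: "y x > 0" using x s by (simp add: y_def s_def[symmetric])
    have dy: "DERIV y x :> 1 / s^3"
    proof -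
      have "DERIV (\<lambda>x. sqrt (1 - x\<^sup>2)) x :> inverse (sqrt (1 - x\<^sup>2)) / 2 * (- 2 * x)"
        using pos[of x] x by (auto intro!: derivative_eq_intros)
      then have "DERIV y x :> (1 * s - x * (inverse s / 2 * (- 2 * x))) / (s * s)"
        unfolding y_def s_def using s(1) by (intro DERIV_divide DERIV_ident) (auto simp: s_def)
      moreover have "(1 * s - x * (inverse s / 2 * (- 2 * x))) / (s * s) = (s\<^sup>2 + x\<^sup>2) / s^3"
        using s(1) by (simp add: field_simps power2_eq_square power3_eq_cube)
      ultimately show ?thesis using s(2) by simp
    qed
    have "DERIV (\<lambda>x. Im (sc_map k (\<i> * of_real (y x)))) x :> imag_speed (y x) * (1 / s^3)"
      by (rule DERIV_chain2[OF sc_map_imag_axis_deriv(2)[OF yx] dy])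
    moreover have "imag_speed (y x) * (1 / s^3) = g x"
    proof -
      have "1 + (y x)\<^sup>2 = 1 / s\<^sup>2" 
        using s by (simp add: y_def s_def[symmetric] power_divide field_simps)
      then have 1: "sqrt (1 + (y x)\<^sup>2) = 1 / s" using s(1) by (simp add: real_sqrt_divide)
      have "1 + k\<^sup>2 * (y x)\<^sup>2 = (1 - (1 - k\<^sup>2) * x\<^sup>2) / s\<^sup>2"
        using s by (simp add: y_def s_def[symmetric] power_divide field_simps)
      then have 2: "sqrt (1 + k\<^sup>2 * (y x)\<^sup>2) = sqrt (1 - (1 - k\<^sup>2) * x\<^sup>2) / s"
        using s(1) by (simp add: real_sqrt_divide)
      show ?thesis unfolding imag_speed_def g_def 1 2 s_def[symmetric]
        using s(1) k2 by (simp add: power3_eq_cube)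
    qed
    ultimately have "DERIV (\<lambda>x. Im (sc_map k (\<i> * of_real (y x)))) x :> g x" by simp
    then have "DERIV G x :> g x"
      by (rule has_field_derivative_transform_within_open[of _ _ _ "{..<1}"]) (use x in \<open>auto simp: G_def\<close>)
    then show "(G has_vector_derivative g x) (at x)"
      by (simp add: has_real_derivative_iff_has_vector_derivative)
  qed simp
  then show ?thesis unfolding elliptic_K_def g_def by (simp add: integral_unique G_def y_def)
qed

end

section \<open>Conformal maps onto rectangles\<close>

text \<open>The square is a Moebius-invariant cross-ratio, normalised so that the points 0, 1,
  \<open>1 / k^2\<close>, infinity give \<open>k^2\<close>; after a square root these are the
  prevertices of \<open>sc_map k\<close>.\<close>

definition ellipse_modulus :: "real \<Rightarrow> real \<Rightarrow> real \<Rightarrow> real \<Rightarrow> real" where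
  "ellipse_modulus A B C D = sqrt ((B - A) * (D - C) / ((C - A) * (D - B)))"

lemma ellipse_modulus_bounds:
  assumes "A < B" "B < C" "C < D"
  shows "0 < ellipse_modulus A B C D" "ellipse_modulus A B C D < 1"
proof -
  have "(C - A) * (D - B) - (B - A) * (D - C) = (C - B) * (D - A)" by (simp add: algebra_simps)
  moreover have "(C - B) * (D - A) > 0" "(B - A) * (D - C) > 0" "(C - A) * (D - B) > 0"
    using assms by (auto intro!: mult_pos_pos)
  ultimately show "0 < ellipse_modulus A B C D" "ellipse_modulus A B C D < 1"
    by (simp_all add: ellipse_modulus_def)
qed

text \<open>\<open>quad_moebius A B C D\<close> sends \<open>A, B, D\<close> to \<open>0, 1, \<infinity>\<close>.\<close>

definition quad_moebius :: "real \<Rightarrow> real \<Rightarrow> real \<Rightarrow> real \<Rightarrow> complex \<Rightarrow> complex" where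
  "quad_moebius A B C D z =
     of_real ((D - B) / (B - A)) * (z - of_real A) / (of_real D - z)"

lemma bij_betw_delete: "bij_betw f X Y \<Longrightarrow> x \<in> X \<Longrightarrow> bij_betw f (X - {x}) (Y - {f x})"
  by (auto simp: bij_betw_def inj_on_def)

lemma bij_betw_csqrt_upper:
  "bij_betw csqrt {z. Im z > 0} open_quadrant"
  "bij_betw csqrt {z. Im z \<ge> 0} closed_quadrant"
proof -
  have sq: "csqrt (w\<^sup>2) = w" if "w \<in> closed_quadrant" for w
    using that by (intro csqrt_square) (auto simp: closed_quadrant_def)
  have [simp]: "csqrt z * csqrt z = z" for z by (metis power2_csqrt power2_eq_square)
  have cq: "csqrt z \<in> closed_quadrant" if "Im z \<ge> 0" for z
  proof -
    have "cmod z - Re z \<ge> 0" "cmod z + Re z \<ge> 0"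
      using complex_Re_le_cmod[of z] abs_Re_le_cmod[of z] by linarith+
    then show ?thesis using csqrt_upper_half_plane[OF that] by (simp add: closed_quadrant_def)
  qed
  show "bij_betw csqrt {z. Im z > 0} open_quadrant"
  proof (rule bij_betw_byWitness[where f' = "\<lambda>w. w\<^sup>2"])
    show "\<forall>w\<in>open_quadrant. csqrt (w\<^sup>2) = w" using sq open_quadrant_subset by blast
    show "csqrt ` {z. Im z > 0} \<subseteq> open_quadrant"
      using csqrt_Re_Im_pos by (simp add: open_quadrant_def image_subset_iff)
    show "(\<lambda>w. w\<^sup>2) ` open_quadrant \<subseteq> {z. Im z > 0}"
      using open_quadrant_square by (simp add: image_subset_iff)
  qed simp
  show "bij_betw csqrt {z. Im z \<ge> 0} closed_quadrant"
    by (rule bij_betw_byWitness[where f' = "\<lambda>w. w\<^sup>2"])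
       (use sq cq in \<open>auto simp: closed_quadrant_def power2_eq_square\<close>)
qed

section \<open>The explicit rectangle map of a given quadrilateral\<close>

locale quadrilateral =
  fixes A B C D :: real
  assumes AB: "A < B" and BC: "B < C" and CD: "C < D"
begin

definition "c = (D - B) / (B - A)"

lemma c_pos: "c > 0" using AB BC CD by (simp add: c_def)

abbreviation "M \<equiv> quad_moebius A B C D"

lemma M_def': "M z = of_real c * (z - of_real A) / (of_real D - z)"
  by (simp add: quad_moebius_def c_def)

lemma Im_M: "Im (M z) = c * (D - A) * Im z / (cmod (of_real D - z))\<^sup>2"
  unfolding M_def' by (simp add: Im_divide cmod_power2 algebra_simps)

text \<open>The inverse of \<open>M\<close>. The point \<open>- of_real c\<close> is the value of
  \<open>M\<close> at infinity, hence exceptional in the target just as \<open>D\<close> is in the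
  source.\<close>

definition "M' w = (of_real c * of_real A + w * of_real D) / (of_real c + w)" for w :: complex

lemma M'_M: "z \<noteq> of_real D \<Longrightarrow> M' (M z) = z"
proof -
  assume z: "z \<noteq> of_real D"
  then have nz: "of_real D - z \<noteq> 0" by simp
  have DA: "(of_real D - of_real A :: complex) \<noteq> 0" using AB BC CD by simp
  have cn: "(of_real c :: complex) \<noteq> 0" using c_pos by simp
  have e1: "of_real c + M z = of_real c * (of_real D - of_real A) / (of_real D - z)"
    unfolding M_def' using nz by (simp add: field_simps)
  have e2: "of_real c * of_real A + M z * of_real D = z * (of_real c * (of_real D - of_real A)) / (of_real D - z)"
    unfolding M_def' using nz by (simp add: field_simps)
  show ?thesis unfolding M'_def e1 e2 using nz DA cn by simp
qed

lemma M_M': "w \<noteq> - of_real c \<Longrightarrow> M (M' w) = w"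
proof -
  assume w: "w \<noteq> - of_real c"
  then have nz: "of_real c + w \<noteq> 0" by (simp add: eq_neg_iff_add_eq_0 add.commute)
  have DA: "(of_real D - of_real A :: complex) \<noteq> 0" using AB BC CD by simp
  have cn: "(of_real c :: complex) \<noteq> 0" using c_pos by simp
  have e1: "of_real D - M' w = of_real c * (of_real D - of_real A) / (of_real c + w)"
    unfolding M'_def using nz by (simp add: field_simps)
  have e2: "of_real c * (M' w - of_real A) = w * (of_real c * (of_real D - of_real A)) / (of_real c + w)"
    unfolding M'_def using nz by (simp add: field_simps)
  show ?thesis unfolding M_def' e1 e2 using nz DA cn by simp
qed

lemma Im_M': "Im (M' w) = c * (D - A) * Im w / (cmod (of_real c + w))\<^sup>2"
  unfolding M'_def by (simp add: Im_divide cmod_power2 algebra_simps)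

lemma factor_pos: "c * (D - A) > 0" using c_pos AB BC CD by simp

lemma M_neq: "z \<noteq> of_real D \<Longrightarrow> M z \<noteq> - of_real c"
proof
  assume z: "z \<noteq> of_real D" and e: "M z = - of_real c"
  then have "of_real c * (z - of_real A) = - of_real c * (of_real D - z)"
    unfolding M_def' by (simp add: field_simps)
  then have "of_real c * (of_real D - of_real A) = (0 :: complex)" by (simp add: algebra_simps)
  then show False using c_pos AB BC CD by simp
qed

lemma M'_neq: "w \<noteq> - of_real c \<Longrightarrow> M' w \<noteq> of_real D"
proof
  assume w: "w \<noteq> - of_real c" and e: "M' w = of_real D"
  then have "of_real c + w \<noteq> 0" by (simp add: eq_neg_iff_add_eq_0 add.commute)
  then have "of_real c * of_real A + w * of_real D = of_real D * (of_real c + w)"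
    using e unfolding M'_def by (simp add: field_simps)
  then have "of_real c * of_real A = (of_real c * of_real D :: complex)" by (simp add: algebra_simps)
  then show False using c_pos AB BC CD by simp
qed

lemma bij_M_open: "bij_betw M {z. Im z > 0} {z. Im z > 0}"
proof (rule bij_betw_byWitness[where f' = M'])
  have "z \<noteq> of_real D" "z \<noteq> - of_real c" if "Im z > 0" for z using that by auto
  then show "\<forall>z\<in>{z. Im z > 0}. M' (M z) = z" "\<forall>w\<in>{z. Im z > 0}. M (M' w) = w"
    using M'_M M_M' by auto
  show "M ` {z. Im z > 0} \<subseteq> {z. Im z > 0}" 
    using factor_pos by (auto simp: Im_M intro!: divide_pos_pos mult_pos_pos[of "c * (D - A)"])
  show "M' ` {z. Im z > 0} \<subseteq> {z. Im z > 0}"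
    using factor_pos by (auto simp: Im_M' complex_eq_iff intro!: divide_pos_pos mult_pos_pos[of "c * (D - A)"])
qed

lemma bij_M_closed: "bij_betw M ({z. Im z \<ge> 0} - {of_real D}) ({z. Im z \<ge> 0} - {- of_real c})"
proof (rule bij_betw_byWitness[where f' = M'])
  show "\<forall>z\<in>{z. Im z \<ge> 0} - {of_real D}. M' (M z) = z" "\<forall>w\<in>{z. Im z \<ge> 0} - {- of_real c}. M (M' w) = w"
    using M'_M M_M' by auto
  show "M ` ({z. Im z \<ge> 0} - {of_real D}) \<subseteq> {z. Im z \<ge> 0} - {- of_real c}"
    using factor_pos M_neq by (auto simp: Im_M)
  show "M' ` ({z. Im z \<ge> 0} - {- of_real c}) \<subseteq> {z. Im z \<ge> 0} - {of_real D}"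
    using factor_pos M'_neq by (auto simp: Im_M')
qed

definition "k = ellipse_modulus A B C D"

sublocale sc_modulus k
  unfolding k_def by unfold_locales (rule ellipse_modulus_bounds[OF AB BC CD])+

definition "a = height / width"

text \<open>At \<open>D\<close> the Moebius map has its pole, so the composition is completed there
  by its limit. Division by \<open>width\<close> gives the base length 1.\<close>

definition psi :: "complex \<Rightarrow> complex" where
  "psi z = (if z = of_real D then corner else sc_map k (csqrt (M z))) / of_real width"

lemma a_pos: "a > 0" using width_pos height_pos by (simp add: a_def)

lemma scale_bij:
  "bij_betw (\<lambda>z. z / of_real width) (box 0 rect) (box 0 (Complex 1 a))"
  "bij_betw (\<lambda>z. z / of_real width) (cbox 0 rect) (cbox 0 (Complex 1 a))"
proof -
  have w: "width \<noteq> 0" using width_pos by simp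
  have 1: "z / of_real width \<in> box 0 (Complex 1 a) \<longleftrightarrow> z \<in> box 0 rect" for z
    using width_pos by (simp add: in_box_complex_iff a_def divide_less_cancel zero_less_divide_iff divide_less_eq)
  have 2: "z / of_real width \<in> cbox 0 (Complex 1 a) \<longleftrightarrow> z \<in> cbox 0 rect" for z
    using width_pos by (simp add: in_cbox_complex_iff a_def divide_le_cancel zero_le_divide_iff divide_le_eq)
  have bij: "bij_betw (\<lambda>z. z / of_real width) S T" if "\<And>z. z / of_real width \<in> T \<longleftrightarrow> z \<in> S" for S T :: "complex set"
  proof (rule bij_betw_byWitness[where f' = "\<lambda>z. z * of_real width"])
    have "(z * of_real width) / of_real width = z" for z :: complex using w by simp
    then show "(\<lambda>z. z * of_real width) ` T \<subseteq> S" using that by (metis image_subsetI)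
  qed (use w that in auto)
  show "bij_betw (\<lambda>z. z / of_real width) (box 0 rect) (box 0 (Complex 1 a))"
    "bij_betw (\<lambda>z. z / of_real width) (cbox 0 rect) (cbox 0 (Complex 1 a))"
    by (rule bij[OF 1], rule bij[OF 2])
qed

lemma M_cont: "continuous_on ({z. Im z \<ge> 0} - {of_real D}) M"
proof -
  have "continuous_on ({z. Im z \<ge> 0} - {of_real D}) (\<lambda>z. of_real c * (z - of_real A) / (of_real D - z))"
    by (intro continuous_intros) auto
  then show ?thesis by (rule continuous_on_eq) (simp add: M_def')
qed

lemma csqrt_M_cont: "continuous_on ({z. Im z \<ge> 0} - {of_real D}) (\<lambda>z. csqrt (M z))"
  by (rule continuous_on_compose2[OF continuous_on_csqrt_upper M_cont])
     (use bij_betwE[OF bij_M_closed] in blast)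

lemma closed_image: "z \<in> {z. Im z \<ge> 0} - {of_real D} \<Longrightarrow> csqrt (M z) \<in> closed_quadrant"
proof -
  assume z: "z \<in> {z. Im z \<ge> 0} - {of_real D}"
  have "M z \<in> {z. Im z \<ge> 0}" using bij_betwE[OF bij_M_closed, rule_format, OF z] by (rule DiffD1)
  then show ?thesis by (rule bij_betwE[OF bij_betw_csqrt_upper(2), rule_format])
qed

lemma psi_holomorphic: "psi holomorphic_on {z. Im z > 0}"
proof -
  have "(\<lambda>z. sc_map k (csqrt (M z)) / of_real width) holomorphic_on {z. Im z > 0}"
  proof (intro holomorphic_intros)
    have M: "M holomorphic_on {z. Im z > 0}" unfolding M_def' by (intro holomorphic_intros) auto
    have up: "Im (M z) > 0" if "Im z > 0" for z
      using bij_betw_imp_surj_on[OF bij_M_open] that by blast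
    have "(csqrt \<circ> M) holomorphic_on {z. Im z > 0}"
      by (rule holomorphic_on_compose_gen[OF M, of csqrt "{z. Im z > 0}"])
         (use up in \<open>auto intro!: holomorphic_intros simp: complex_nonpos_Reals_iff\<close>)
    then have "(sc_map k \<circ> (csqrt \<circ> M)) holomorphic_on {z. Im z > 0}"
      by (rule holomorphic_on_compose_gen[OF _ sc_map_holomorphic])
         (use up csqrt_Re_Im_pos in \<open>auto simp: open_quadrant_def\<close>)
    then show "(\<lambda>z. sc_map k (csqrt (M z))) holomorphic_on {z. Im z > 0}" by (simp add: o_def)
  qed (use width_pos in auto)
  then show ?thesis by (rule holomorphic_transform) (auto simp: psi_def)
qed

lemma psi_bij_open: "bij_betw psi {z. Im z > 0} (box 0 (Complex 1 a))"
proof -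
  have "bij_betw (sc_map k) open_quadrant (box 0 rect)"
    using inj_on_subset[OF inj_on_sc_map open_quadrant_subset] sc_map_open_image by (simp add: bij_betw_def)
  from bij_betw_trans[OF bij_betw_trans[OF bij_betw_trans[OF bij_M_open bij_betw_csqrt_upper(1)] this] scale_bij(1)]
  show ?thesis by (rule bij_betw_cong[THEN iffD1, rotated]) (auto simp: psi_def)
qed

text \<open>The boundary point taken at infinity, which serves as \<open>p\<close> in
  \<open>rectangle_map\<close>.\<close>

definition "missing = sc_map k (csqrt (- of_real c)) / of_real width"

lemma psi_bij_closed: "bij_betw psi {z. Im z \<ge> 0} (cbox 0 (Complex 1 a) - {missing})"
proof -
  let ?H = "{z. Im z \<ge> 0}" and ?m = "csqrt (- of_real c)"
  have mQ: "?m \<in> closed_quadrant" using bij_betw_imp_surj_on[OF bij_betw_csqrt_upper(2)] by force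
  have mH: "- of_real c \<in> ?H" by simp
  have 1: "bij_betw csqrt (?H - {- of_real c}) (closed_quadrant - {?m})"
    using bij_betw_delete[OF bij_betw_csqrt_upper(2) mH] .
  have 2: "bij_betw (sc_map k) closed_quadrant (cbox 0 rect - {corner})"
    using inj_on_sc_map sc_map_image by (simp add: bij_betw_def)
  have 4: "bij_betw (sc_map k) (closed_quadrant - {?m}) (cbox 0 rect - {corner} - {sc_map k ?m})"
    using bij_betw_delete[OF 2 mQ] .
  have 5: "bij_betw (\<lambda>z. z / of_real width) (cbox 0 rect - {corner} - {sc_map k ?m})
      (cbox 0 (Complex 1 a) - {corner / of_real width} - {missing})"
  proof -
    have cc: "corner \<in> cbox 0 rect" using height_pos width_pos by (simp add: corner_eq in_cbox_complex_iff)
    have sm: "sc_map k ?m \<in> cbox 0 rect - {corner}" using sc_map_in_cbox[OF mQ] .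
    show ?thesis unfolding missing_def
      using bij_betw_delete[OF bij_betw_delete[OF scale_bij(2) cc] sm] .
  qed
  have 3: "bij_betw psi (?H - {of_real D}) (cbox 0 (Complex 1 a) - {corner / of_real width} - {missing})"
    using bij_betw_trans[OF bij_betw_trans[OF bij_betw_trans[OF bij_M_closed 1] 4] 5]
    by (rule bij_betw_cong[THEN iffD1, rotated]) (auto simp: psi_def)
  have pD: "psi (of_real D) = corner / of_real width" by (simp add: psi_def)
  have ne: "corner / of_real width \<noteq> missing"
    using sc_map_in_cbox[OF mQ] width_pos by (auto simp: missing_def)
  have inn: "corner / of_real width \<in> cbox 0 (Complex 1 a)"
    using height_pos width_pos by (simp add: corner_eq in_cbox_complex_iff a_def)
  have "bij_betw psi (?H - {of_real D} \<union> {of_real D})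
      (cbox 0 (Complex 1 a) - {corner / of_real width} - {missing} \<union> {psi (of_real D)})"
    using 3 by (intro notIn_Un_bij_betw3[THEN iffD1]) (auto simp: pD)
  moreover have "?H - {of_real D} \<union> {of_real D} = ?H" by auto
  moreover have "cbox 0 (Complex 1 a) - {corner / of_real width} - {missing} \<union> {psi (of_real D)} = cbox 0 (Complex 1 a) - {missing}"
    using ne inn by (auto simp: pD)
  ultimately show ?thesis by simp
qed

lemma psi_continuous: "continuous_on {z. Im z \<ge> 0} psi"
  unfolding continuous_on_def
proof
  fix z assume z: "z \<in> {z. Im z \<ge> (0::real)}"
  let ?H = "{z. Im z \<ge> 0}"
  show "(psi \<longlongrightarrow> psi z) (at z within ?H)"
  proof (cases "z = of_real D")
    case False
    have "continuous_on (?H - {of_real D}) (\<lambda>z. sc_map k (csqrt (M z)) / of_real width)"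
      by (intro continuous_on_divide continuous_on_sc_map_compose csqrt_M_cont continuous_intros)
         (use closed_image width_pos in auto)
    then have "continuous_on (?H - {of_real D}) psi" by (rule continuous_on_eq) (auto simp: psi_def)
    then have "(psi \<longlongrightarrow> psi z) (at z within ?H - {of_real D})"
      using z False by (simp add: continuous_on_def)
    moreover have "at z within ?H - {of_real D} = at z within ?H"
      by (rule at_within_nhd[of _ "- {of_real D}"]) (use False in auto)
    ultimately show ?thesis by simp
  next
    case True
    have "((sc_map k \<circ> (\<lambda>z. csqrt (M z))) \<longlongrightarrow> corner) (at (of_real D) within ?H)"
    proof (rule tendstoI)
      fix e :: real assume "e > 0"
      then obtain R where R: "\<And>w. w \<in> closed_quadrant \<Longrightarrow> cmod w \<ge> R \<Longrightarrow> dist (sc_map k w) corner < e"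
        using sc_map_far by blast
      have "filterlim M at_infinity (at (of_real D))"
      proof -
        have "filterlim (\<lambda>z. of_real D - z) (at 0) (at (of_real D :: complex))"
          by (auto simp: filterlim_at eventually_at_filter intro!: tendsto_eq_intros)
        then show ?thesis unfolding M_def'
          using c_pos AB BC CD
          by (intro filterlim_divide_at_infinity[where c = "of_real c * (of_real D - of_real A)"])
             (auto intro!: tendsto_eq_intros)
      qed
      then have "filterlim M at_infinity (at (of_real D) within ?H)"
        by (rule filterlim_mono) (auto simp: at_le)
      then have "filterlim (\<lambda>z. cmod (M z)) at_top (at (of_real D) within ?H)"
        by (rule filterlim_at_infinity_imp_norm_at_top)
      then have "eventually (\<lambda>z. cmod (M z) \<ge> R\<^sup>2) (at (of_real D) within ?H)"
        by (simp add: filterlim_at_top)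
      moreover have "eventually (\<lambda>z. z \<in> ?H \<and> z \<noteq> of_real D) (at (of_real D) within ?H)"
        by (simp add: eventually_at_filter)
      ultimately show "eventually (\<lambda>z. dist ((sc_map k \<circ> (\<lambda>z. csqrt (M z))) z) corner < e) (at (of_real D) within ?H)"
      proof eventually_elim
        case (elim z)
        have "(cmod (csqrt (M z)))\<^sup>2 = cmod (M z)" by (simp flip: norm_power)
        then have "R\<^sup>2 \<le> (cmod (csqrt (M z)))\<^sup>2" using elim by simp
        then have "R \<le> cmod (csqrt (M z))" by (rule power2_le_imp_le) simp
        then show ?case using R closed_image elim by simp
      qed
    qed
    then have "((\<lambda>z. sc_map k (csqrt (M z)) / of_real width) \<longlongrightarrow> corner / of_real width) (at (of_real D) within ?H)"
      using width_pos by (intro tendsto_divide) (auto simp: o_def)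
    then have "(psi \<longlongrightarrow> corner / of_real width) (at (of_real D) within ?H)"
      by (rule Lim_transform_eventually) (auto simp: eventually_at_filter psi_def)
    then show ?thesis using True by (simp add: psi_def)
  qed
qed

lemma psi_at_infinity: "(psi \<longlongrightarrow> missing) (inf at_infinity (principal {z. Im z \<ge> 0}))"
proof -
  let ?F = "inf at_infinity (principal {z. Im z \<ge> (0::real)})"
  have M_lim: "(M \<longlongrightarrow> - of_real c) at_infinity"
  proof -
    have "filterlim (\<lambda>z. of_real D - z) at_infinity (at_infinity :: complex filter)"
      using tendsto_add_filterlim_at_infinity[OF tendsto_const
          tendsto_mult_filterlim_at_infinity[OF tendsto_const _ filterlim_ident], of "-1" "of_real D"] by simp
    then have "((\<lambda>z. of_real c * (of_real D - of_real A) / (of_real D - z) :: complex) \<longlongrightarrow> 0) at_infinity"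
      by (rule tendsto_divide_0[OF tendsto_const])
    then have "((\<lambda>z. of_real c * (of_real D - of_real A) / (of_real D - z) - of_real c :: complex) \<longlongrightarrow> 0 - of_real c) at_infinity"
      by (intro tendsto_intros)
    then have "((\<lambda>z. of_real c * (of_real D - of_real A) / (of_real D - z) - of_real c :: complex) \<longlongrightarrow> - of_real c) at_infinity"
      by simp
    then show ?thesis
    proof (rule Lim_transform_eventually)
      show "eventually (\<lambda>z. of_real c * (of_real D - of_real A) / (of_real D - z) - of_real c = M z) at_infinity"
        unfolding eventually_at_infinity
      proof (intro exI allI impI)
        fix z :: complex assume "\<bar>D\<bar> + 1 \<le> norm z"
        then have "z \<noteq> of_real D" by (auto simp del: norm_le_zero_iff)
        then show "of_real c * (of_real D - of_real A) / (of_real D - z) - of_real c = M z"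
          unfolding M_def' by (simp add: field_simps)
      qed
    qed
  qed
  have M_lim': "(M \<longlongrightarrow> - of_real c) ?F" using M_lim by (rule tendsto_mono[rotated]) simp
  have ev: "eventually (\<lambda>z. z \<in> {z. Im z \<ge> 0} - {of_real D}) ?F"
  proof -
    have "eventually (\<lambda>z::complex. z \<noteq> of_real D) at_infinity"
      unfolding eventually_at_infinity by (rule exI[of _ "\<bar>D\<bar> + 1"]) auto
    then show ?thesis by (simp add: eventually_inf_principal eventually_mono)
  qed
  have "((\<lambda>z. csqrt (M z)) \<longlongrightarrow> csqrt (- of_real c)) ?F"
  proof (rule continuous_on_tendsto_compose[OF continuous_on_csqrt_upper M_lim'])
    show "eventually (\<lambda>z. M z \<in> {z. Im z \<ge> 0}) ?F"
      by (rule eventually_mono[OF ev]) (use bij_betwE[OF bij_M_closed] in blast)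
  qed simp
  then have "((\<lambda>z. sc_map k (csqrt (M z))) \<longlongrightarrow> sc_map k (csqrt (- of_real c))) ?F"
    by (rule continuous_on_tendsto_compose[OF continuous_on_sc_map])
       (use eventually_mono[OF ev closed_image] bij_betwE[OF bij_betw_csqrt_upper(2)] in simp_all)
  then have "((\<lambda>z. sc_map k (csqrt (M z)) / of_real width) \<longlongrightarrow> missing) ?F"
    unfolding missing_def using width_pos by (intro tendsto_divide) auto
  then show ?thesis
    by (rule Lim_transform_eventually) (rule eventually_mono[OF ev], simp add: psi_def)
qed

lemma missing_in: "missing \<in> cbox 0 (Complex 1 a)"
proof -
  have "csqrt (- of_real c) \<in> closed_quadrant" using bij_betw_imp_surj_on[OF bij_betw_csqrt_upper(2)] by force
  from sc_map_in_cbox[OF this] scale_bij(2) show ?thesis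
    unfolding missing_def bij_betw_def by blast
qed

lemma M_real:
  assumes "x \<noteq> D" shows "M (of_real x) = of_real (c * (x - A) / (D - x))"
  unfolding M_def' by simp

lemma csqrt_real: "y \<ge> 0 \<Longrightarrow> csqrt (of_real y) = of_real (sqrt y)"
  by (rule of_real_sqrt[symmetric])

text \<open>This identity dictates the choice of \<open>k\<close>: the third vertex must reach the
  prevertex \<open>1 / k\<close> after the square root.\<close>

lemma M_C: "c * (C - A) / (D - C) = (1 / k)\<^sup>2"
proof -
  have "(B - A) * (D - C) / ((C - A) * (D - B)) \<ge> 0" using AB BC CD by simp
  then have "k\<^sup>2 = (B - A) * (D - C) / ((C - A) * (D - B))" unfolding k_def ellipse_modulus_def by simp
  then show ?thesis using AB BC CD by (simp add: c_def power_divide)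
qed

lemma psi_A: "psi (of_real A) = 0"
proof -
  have "M (of_real A) = 0" by (simp add: M_def')
  moreover have "A \<noteq> D" using AB BC CD by linarith
  ultimately show ?thesis by (simp add: psi_def)
qed

lemma psi_B: "psi (of_real B) = 1"
proof -
  have "M (of_real B) = 1" using AB BC CD M_real[of B] by (simp add: c_def)
  moreover have "sc_map k 1 = of_real width"
    using side1_Im[of 1] by (simp add: complex_eq_iff width_def)
  ultimately show ?thesis using AB BC CD width_pos by (simp add: psi_def)
qed

lemma psi_C: "psi (of_real C) = Complex 1 a"
proof -
  have "M (of_real C) = of_real ((1 / k)\<^sup>2)" using CD M_real[of C] M_C by simp
  then have "csqrt (M (of_real C)) = of_real (1 / k)" using k_pos
    by (simp only: csqrt_real zero_le_power2 real_sqrt_abs) simp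
  moreover have "sc_map k (of_real (1 / k)) = rect"
    using side2_Re[of "1/k"] one_less_inv by (simp add: complex_eq_iff height_def)
  ultimately have "psi (of_real C) = rect / of_real width" using CD by (simp add: psi_def del: of_real_divide)
  then show ?thesis using width_pos by (simp add: complex_eq_iff a_def)
qed

lemma psi_D: "psi (of_real D) = Complex 0 a"
proof -
  have "psi (of_real D) = corner / of_real width" by (simp add: psi_def)
  then show ?thesis unfolding a_def corner_eq by (intro complex_eqI) (simp_all only: Re_divide_of_real Im_divide_of_real complex.sel div_0)
qed

lemma psi_base: "psi ` of_real ` {A<..<B} = of_real ` {0<..<1}"
proof (rule subset_antisym)
  have val: "\<exists>y\<in>{0<..<1}. psi (of_real x) = of_real y" if x: "x \<in> {A<..<B}" for x
  proof -
    define m where "m = c * (x - A) / (D - x)"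
    have xx: "A < x" "x < B" "x < D" using x BC CD by auto
    have m: "0 < m" unfolding m_def using xx c_pos by (intro divide_pos_pos mult_pos_pos) auto
    have "m < 1"
    proof -
      have "(D - B) * (x - A) < (B - A) * (D - x)" 
      proof -
        have "(B - A) * (D - x) - (D - B) * (x - A) = (D - A) * (B - x)" by (simp add: algebra_simps)
        moreover have "(D - A) * (B - x) > 0" using xx by simp
        ultimately show ?thesis by linarith
      qed
      moreover have "m = (D - B) * (x - A) / ((B - A) * (D - x))" by (simp add: m_def c_def)
      ultimately show ?thesis using xx AB by simp
    qed
    then have s: "0 < sqrt m" "sqrt m < 1" using m by auto
    have "csqrt (M (of_real x)) = of_real (sqrt m)"
      using M_real[of x] xx csqrt_real[of m] m by (simp add: m_def)
    moreover have "sc_map k (of_real (sqrt m)) = of_real (Re (sc_map k (of_real (sqrt m))))"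
      using side1_Im[of "sqrt m"] s by (simp add: complex_eq_iff)
    ultimately have "psi (of_real x) = of_real (Re (sc_map k (of_real (sqrt m))) / width)"
      using xx by (simp add: psi_def)
    moreover have "Re (sc_map k (of_real (sqrt m))) / width \<in> {0<..<1}"
      using side1_Re[of 0 "sqrt m"] side1_Re[of "sqrt m" 1] s width_pos by (simp add: width_def)
    ultimately show ?thesis by blast
  qed
  then show "psi ` of_real ` {A<..<B} \<subseteq> of_real ` {0<..<1}" by blast
  show "of_real ` {0<..<1} \<subseteq> psi ` of_real ` {A<..<B}"
  proof (rule image_subsetI)
    fix y :: real assume y: "y \<in> {0<..<1}"
    have "continuous_on {A..B} (\<lambda>x. Re (psi (of_real x)))"
      by (intro continuous_on_Re continuous_on_compose2[OF psi_continuous] continuous_intros) auto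
    then obtain x where x: "A \<le> x" "x \<le> B" "Re (psi (of_real x)) = y"
      using IVT'[of "\<lambda>x. Re (psi (of_real x))" A y B] y AB psi_A psi_B by auto
    then have "x \<in> {A<..<B}" using y psi_A psi_B by (cases "x = A"; cases "x = B") auto
    moreover from val[OF this] x(3) have "psi (of_real x) = of_real y" by auto
    ultimately show "of_real y \<in> psi ` of_real ` {A<..<B}" by (metis image_eqI)
  qed
qed

lemma rectangle_map_psi: "rectangle_map A B C D a psi"
  unfolding rectangle_map_def
  by (intro conjI exI[of _ missing] psi_holomorphic psi_bij_open psi_continuous psi_bij_closed
      missing_in psi_at_infinity psi_A psi_B psi_C psi_D psi_base)

end

section \<open>Uniqueness of the rectangle\<close>

text \<open>An arbitrary competitor. The definition of \<open>rectangle_map\<close> prescribes its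
  values at the vertices and its base; on which sides the other boundary arcs land has to be
  derived.\<close>

locale rectangle_uniformization = quadrilateral +
  fixes h :: real and f :: "complex \<Rightarrow> complex"
  assumes h_pos: "h > 0" and f: "rectangle_map A B C D h f"
begin

lemma f_props:
  shows f_hol: "f holomorphic_on {z. Im z > 0}"
    and f_bij: "bij_betw f {z. Im z > 0} (box 0 (Complex 1 h))"
    and f_cont: "continuous_on {z. Im z \<ge> 0} f"
    and f_A: "f (of_real A) = 0" and f_B: "f (of_real B) = 1"
    and f_C: "f (of_real C) = Complex 1 h" and f_D: "f (of_real D) = Complex 0 h"
    and f_base: "f ` of_real ` {A<..<B} = of_real ` {0<..<1}"
  using f unfolding rectangle_map_def by - (elim conjE, assumption)+

lemma f_lim: "\<exists>p. bij_betw f {z. Im z \<ge> 0} (cbox 0 (Complex 1 h) - {p}) \<and>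
          (f \<longlongrightarrow> p) (inf at_infinity (principal {z. Im z \<ge> 0}))"
  using f unfolding rectangle_map_def by (elim conjE) blast

lemma f_inj: "inj_on f {z. Im z \<ge> 0}"
  using f_lim bij_betw_imp_inj_on by blast

lemma f_cbox: "Im z \<ge> 0 \<Longrightarrow> f z \<in> cbox 0 (Complex 1 h)"
proof -
  assume z: "Im z \<ge> 0"
  obtain p where "bij_betw f {z. Im z \<ge> 0} (cbox 0 (Complex 1 h) - {p})" using f_lim by blast
  from bij_betwE[OF this] z show ?thesis by simp
qed

lemma f_real_eq: "f (of_real x) = f (of_real y) \<longleftrightarrow> x = y"
  using inj_onD[OF f_inj, of "of_real x" "of_real y"] by auto

lemma f_real_not_box: "f (of_real x) \<notin> box 0 (Complex 1 h)"
proof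
  assume "f (of_real x) \<in> box 0 (Complex 1 h)"
  then obtain z where z: "Im z > 0" "f z = f (of_real x)"
    using bij_betw_imp_surj_on[OF f_bij] by (metis (mono_tags, lifting) imageE mem_Collect_eq)
  then have "z = of_real x" using inj_onD[OF f_inj z(2)] by simp
  then show False using z(1) by simp
qed

definition side :: "nat \<Rightarrow> complex set" where
  "side i = (if i = 0 then {z. Im z = 0} else if i = 1 then {z. Re z = 1}
     else if i = 2 then {z. Im z = h} else {z. Re z = 0})"

lemma closed_side: "closed (side i)"
  unfolding side_def by (auto intro!: closed_Collect_eq continuous_intros)

lemma f_real_cont: "continuous_on S (\<lambda>x. f (of_real x))"
  by (rule continuous_on_compose2[OF f_cont]) (auto intro!: continuous_intros)

lemma real_in_side: "\<exists>i<4. f (of_real x) \<in> side i"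
proof -
  have "f (of_real x) \<in> side 0 \<or> f (of_real x) \<in> side 1 \<or> f (of_real x) \<in> side 2 \<or> f (of_real x) \<in> side 3"
    using f_cbox[of "of_real x"] f_real_not_box[of x]
    by (auto simp: side_def in_box_complex_iff in_cbox_complex_iff)
  then show ?thesis
  proof (elim disjE)
    show ?thesis if "f (of_real x) \<in> side 0" using that by (intro exI[of _ 0]) simp
    show ?thesis if "f (of_real x) \<in> side 1" using that by (intro exI[of _ 1]) simp
    show ?thesis if "f (of_real x) \<in> side 2" using that by (intro exI[of _ 2]) simp
    show ?thesis if "f (of_real x) \<in> side 3" using that by (intro exI[of _ 3]) simp
  qed
qed

lemma two_sides_vertex:
  assumes "z \<in> side i" "z \<in> side j" "i < 4" "j < 4" "i \<noteq> j" 
  shows "z \<in> {0, 1, Complex 1 h, Complex 0 h}"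
proof -
  have "i = 0 \<or> i = 1 \<or> i = 2 \<or> i = 3" "j = 0 \<or> j = 1 \<or> j = 2 \<or> j = 3"
    using assms(3,4) by linarith+
  then show ?thesis using assms h_pos by (elim disjE) (simp_all add: side_def complex_eq_iff)
qed

text \<open>Boundary points go to the union of four closed sides. Two sides meet at most in
  vertices, and by injectivity these are taken only at \<open>A\<close>, \<open>B\<close>,
  \<open>C\<close>, \<open>D\<close>. On \<open>I\<close> the sides are therefore disjoint closed
  sets, and a connected image meets only one of them.\<close>

lemma interval_in_side:
  assumes I: "connected I" "I \<inter> {A, B, C, D} = {}"
  shows "\<exists>i<4. (\<lambda>x. f (of_real x)) ` I \<subseteq> side i"
proof (cases "I = {}")
  case True then show ?thesis by (intro exI[of _ 0]) auto
next
  case False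
  then obtain x where x: "x \<in> I" by auto
  obtain i where i: "i < 4" "f (of_real x) \<in> side i" using real_in_side by blast
  let ?S = "(\<lambda>x. f (of_real x)) ` I"
  have conn: "connected ?S" by (rule connected_continuous_image[OF f_real_cont I(1)])
  define T where "T = (\<Union>j\<in>{0..<4} - {i}. side j)"
  have T: "closed T" unfolding T_def by (intro closed_UN) (auto simp: closed_side)
  have cov: "?S \<subseteq> side i \<union> T" using real_in_side i by (fastforce simp: T_def)
  have disj: "side i \<inter> T \<inter> ?S = {}"
  proof (rule ccontr)
    assume "side i \<inter> T \<inter> ?S \<noteq> {}"
    then obtain y j where y: "y \<in> I" "f (of_real y) \<in> side i" and "j \<in> {0..<4} - {i}" "f (of_real y) \<in> side j"
      unfolding T_def by fast
    then have "f (of_real y) \<in> {f (of_real A), f (of_real B), f (of_real C), f (of_real D)}"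
      using two_sides_vertex[of "f (of_real y)" i j] i by (simp add: f_A f_B f_C f_D)
    then have "y \<in> {A, B, C, D}" by (simp add: f_real_eq)
    then show False using y(1) I(2) by blast
  qed
  have "T \<inter> ?S = {}"
    using conn closed_side[of i] T cov disj i x unfolding connected_closed by blast
  then show ?thesis using cov i by blast
qed

lemma limit_in_side:
  assumes "(\<lambda>x. f (of_real x)) ` I \<subseteq> side i" "x \<in> closure I"
  shows "f (of_real x) \<in> side i"
proof -
  have "(\<lambda>x. f (of_real x)) ` closure I \<subseteq> side i"
    by (rule image_closure_subset[OF f_real_cont closed_side assms(1)])
  then show ?thesis using assms(2) by blast
qed

lemma side_AB: "A \<le> x \<Longrightarrow> x \<le> B \<Longrightarrow> Im (f (of_real x)) = 0"
proof -
  assume x: "A \<le> x" "x \<le> B"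
  consider "x = A" | "x = B" | "A < x" "x < B" using x by linarith
  then show ?thesis
  proof cases
    case 3
    then have "x \<in> {A<..<B}" by simp
    then have "f (of_real x) \<in> f ` of_real ` {A<..<B}" by (intro imageI)
    then show ?thesis unfolding f_base by (elim imageE) simp
  qed (simp_all add: f_A f_B)
qed

lemma side_BC:
  assumes x: "B \<le> x" "x \<le> C" shows "Re (f (of_real x)) = 1"
proof -
  have disj: "{B<..<C} \<inter> {A, B, C, D} = {}" using AB BC CD by auto
  obtain i where i: "i < 4" "(\<lambda>x. f (of_real x)) ` {B<..<C} \<subseteq> side i"
    using interval_in_side[OF connected_Ioo disj] by blast
  have lim: "f (of_real x) \<in> side i" if "B \<le> x" "x \<le> C" for x
    using limit_in_side[OF i(2)] that BC by simp
  have l: "1 \<in> side i" "Complex 1 h \<in> side i" using lim[of B] lim[of C] BC by (simp_all add: f_B f_C)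
  have "i \<noteq> 0" by (rule notI) (use l h_pos in \<open>simp add: side_def\<close>)
  moreover have "i \<noteq> 2" by (rule notI) (use l h_pos in \<open>simp add: side_def\<close>)
  moreover have "i \<noteq> 3" by (rule notI) (use l h_pos in \<open>simp add: side_def\<close>)
  ultimately have "i = 1" using i(1) by linarith
  then show ?thesis using lim[OF x] by (simp add: side_def)
qed

lemma side_CD:
  assumes x: "C \<le> x" "x \<le> D" shows "Im (f (of_real x)) = h"
proof -
  have disj: "{C<..<D} \<inter> {A, B, C, D} = {}" using AB BC CD by auto
  obtain i where i: "i < 4" "(\<lambda>x. f (of_real x)) ` {C<..<D} \<subseteq> side i"
    using interval_in_side[OF connected_Ioo disj] by blast
  have lim: "f (of_real x) \<in> side i" if "C \<le> x" "x \<le> D" for x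
    using limit_in_side[OF i(2)] that CD by simp
  have l: "Complex 1 h \<in> side i" "Complex 0 h \<in> side i" using lim[of C] lim[of D] CD by (simp_all add: f_C f_D)
  have "i \<noteq> 0" by (rule notI) (use l h_pos in \<open>simp add: side_def\<close>)
  moreover have "i \<noteq> 1" by (rule notI) (use l h_pos in \<open>simp add: side_def\<close>)
  moreover have "i \<noteq> 3" by (rule notI) (use l h_pos in \<open>simp add: side_def\<close>)
  ultimately have "i = 2" using i(1) by linarith
  then show ?thesis using lim[OF x] by (simp add: side_def)
qed

text \<open>One known endpoint, the vertex at \<open>D\<close>, leaves both the left and the top
  side possible. The top side is already filled by the image of \<open>[C, D]\<close>, so
  injectivity excludes it. In \<open>side_A\<close> the base plays that part.\<close>

lemma side_D:
  assumes x: "D \<le> x" shows "Re (f (of_real x)) = 0"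
proof -
  have disj: "{D<..} \<inter> {A, B, C, D} = {}" using AB BC CD by auto
  obtain i where i: "i < 4" "(\<lambda>x. f (of_real x)) ` {D<..} \<subseteq> side i"
    using interval_in_side[OF connected_Ioi disj] by blast
  have lim: "f (of_real x) \<in> side i" if "D \<le> x" for x
    using limit_in_side[OF i(2)] that by simp
  have l: "Complex 0 h \<in> side i" using lim[of D] by (simp add: f_D)
  have "i \<noteq> 0" by (rule notI) (use l h_pos in \<open>simp add: side_def\<close>)
  moreover have "i \<noteq> 1" by (rule notI) (use l h_pos in \<open>simp add: side_def\<close>)
  moreover have "i \<noteq> 2"
  proof
    assume "i = 2"
    define y where "y = f (of_real (D + 1))"
    have y: "Im y = h" "0 \<le> Re y" "Re y \<le> 1"
      using lim[of "D+1"] \<open>i = 2\<close> f_cbox[of "of_real (D+1)"] by (auto simp: y_def side_def in_cbox_complex_iff)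
    have "continuous_on {C..D} (\<lambda>x. Re (f (of_real x)))" by (intro continuous_on_Re f_real_cont)
    then obtain t where t: "C \<le> t" "t \<le> D" "Re (f (of_real t)) = Re y"
      using IVT2'[of "\<lambda>x. Re (f (of_real x))" D "Re y" C] y CD by (auto simp: f_C f_D)
    then have "f (of_real t) = f (of_real (D + 1))"
      using side_CD[OF t(1,2)] y by (simp add: complex_eq_iff y_def)
    then have "t = D + 1" by (simp only: f_real_eq)
    then show False using t by simp
  qed
  ultimately show ?thesis using lim[OF x] by (simp add: side_def)
qed

lemma side_A:
  assumes x: "x \<le> A" shows "Re (f (of_real x)) = 0"
proof -
  have disj: "{..<A} \<inter> {A, B, C, D} = {}" using AB BC CD by auto
  obtain i where i: "i < 4" "(\<lambda>x. f (of_real x)) ` {..<A} \<subseteq> side i"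
    using interval_in_side[OF connected_Iio disj] by blast
  have lim: "f (of_real x) \<in> side i" if "x \<le> A" for x
    using limit_in_side[OF i(2)] that by simp
  have l: "0 \<in> side i" using lim[of A] by (simp add: f_A)
  have "i \<noteq> 2" by (rule notI) (use l h_pos in \<open>simp add: side_def\<close>)
  moreover have "i \<noteq> 1" by (rule notI) (use l h_pos in \<open>simp add: side_def\<close>)
  moreover have "i \<noteq> 0"
  proof
    assume "i = 0"
    define y where "y = f (of_real (A - 1))"
    have y: "Im y = 0" "0 \<le> Re y" "Re y \<le> 1"
      using lim[of "A-1"] \<open>i = 0\<close> f_cbox[of "of_real (A-1)"] by (auto simp: y_def side_def in_cbox_complex_iff)
    have "continuous_on {A..B} (\<lambda>x. Re (f (of_real x)))" by (intro continuous_on_Re f_real_cont)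
    then obtain t where t: "A \<le> t" "t \<le> B" "Re (f (of_real t)) = Re y"
      using IVT'[of "\<lambda>x. Re (f (of_real x))" A "Re y" B] y AB by (auto simp: f_A f_B)
    then have "f (of_real t) = f (of_real (A - 1))"
      using side_AB[OF t(1,2)] y by (simp add: complex_eq_iff y_def)
    then have "t = A - 1" by (simp only: f_real_eq)
    then show False using t by simp
  qed
  ultimately show ?thesis using lim[OF x] by (simp add: side_def)
qed

end

text \<open>A Liouville principle. Since \<open>exp (- i * G)\<close> has modulus
  \<open>exp (Im G)\<close>, the maximum principle on large half-discs, applied to \<open>F\<close>
  and \<open>- F\<close>, forces \<open>Im F = 0\<close>: on the axis it vanishes by assumption, on
  the arc it is small by the limit at infinity. A holomorphic map with real values is not open,
  hence constant.\<close>

lemma holomorphic_real_boundary_constant: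
  fixes F :: "complex \<Rightarrow> complex"
  assumes hol: "F holomorphic_on {z. Im z > 0}" and cont: "continuous_on {z. Im z \<ge> 0} F"
    and real: "\<And>x. Im (F (of_real x)) = 0"
    and lim: "(F \<longlongrightarrow> l) (inf at_infinity (principal {z. Im z \<ge> 0}))"
    and xy: "Im x \<ge> 0" "Im y \<ge> 0"
  shows "F x = F y"
proof -
  let ?H = "{z. Im z > 0}" and ?C = "{z. Im z \<ge> 0}"
  have "filterlim (\<lambda>n. of_nat n :: complex) (inf at_infinity (principal ?C)) sequentially"
    by (simp add: filterlim_inf filterlim_principal tendsto_of_nat)
  from tendsto_Im[OF filterlim_compose[OF lim this]] have "Im l = 0"
    using real[of "real _"] by (simp add: LIMSEQ_const_iff)
  have bound: "Im (G z0) \<le> e"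
    if e: "e > 0" and z0: "Im z0 > 0" and G: "G = F \<or> G = (\<lambda>z. - F z)" for e z0 and G :: "complex \<Rightarrow> complex"
  proof -
    have "((\<lambda>z. Im (F z)) \<longlongrightarrow> 0) (inf at_infinity (principal ?C))"
      using tendsto_Im[OF lim] \<open>Im l = 0\<close> by simp
    from tendstoD[OF this e] have "eventually (\<lambda>z. z \<in> ?C \<longrightarrow> \<bar>Im (F z)\<bar> < e) at_infinity"
      by (simp add: eventually_inf_principal dist_norm)
    then obtain R0 where R0: "\<And>z. cmod z \<ge> R0 \<Longrightarrow> Im z \<ge> 0 \<Longrightarrow> \<bar>Im (F z)\<bar> < e"
      unfolding eventually_at_infinity by auto
    define R where "R = max R0 (cmod z0 + 1)"
    define S where "S = ball 0 R \<inter> ?H"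
    have opS: "open S" unfolding S_def by (intro open_Int open_ball open_halfspace_Im_gt)
    have clS: "closure S \<subseteq> cball 0 R \<inter> ?C"
      by (rule closure_minimal) (auto simp: S_def intro!: closed_Int closed_halfspace_Im_ge)
    have Gh: "G holomorphic_on ?H" and Gc: "continuous_on ?C G"
      using G hol cont by (auto intro!: holomorphic_intros continuous_intros)
    have "norm (exp (- \<i> * G z0)) \<le> exp e"
    proof (rule maximum_modulus_frontier[where S = S and f = "\<lambda>z. exp (- \<i> * G z)"])
      show "(\<lambda>z. exp (- \<i> * G z)) holomorphic_on interior S"
        unfolding interior_open[OF opS] using Gh
        by (intro holomorphic_intros) (auto simp: S_def elim!: holomorphic_on_subset)
      show "continuous_on (closure S) (\<lambda>z. exp (- \<i> * G z))"
        using continuous_on_subset[OF Gc, of "closure S"] clS by (intro continuous_intros) auto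
      show "bounded S" unfolding S_def by (intro bounded_Int disjI1 bounded_ball)
      show "z0 \<in> S" using z0 by (simp add: S_def R_def)
      fix z assume "z \<in> frontier S"
      then have z: "z \<in> closure S" "z \<notin> S" using interior_open[OF opS] by (auto simp: frontier_def)
      then have zc: "cmod z \<le> R" "Im z \<ge> 0" using clS by auto
      have "\<bar>Im (F z)\<bar> \<le> e"
      proof (cases "Im z = 0")
        case True
        then have "z = of_real (Re z)" by (simp add: complex_eq_iff)
        then have "Im (F z) = 0" using real by metis
        then show ?thesis using e by simp
      next
        case False
        then have "cmod z \<ge> R" using z(2) zc by (auto simp: S_def)
        then show ?thesis using R0[of z] zc by (simp add: R_def)
      qed
      then show "norm (exp (- \<i> * G z)) \<le> exp e" using G by auto
    qed
    then show ?thesis by simp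
  qed
  have Im0: "Im (F z) = 0" if z: "Im z > 0" for z
  proof -
    have "Im (F z) \<le> 0"
      by (rule field_le_epsilon) (use bound[OF _ z, of _ F] in simp)
    moreover have "- Im (F z) \<le> 0"
      by (rule field_le_epsilon) (use bound[OF _ z, of _ "\<lambda>z. - F z"] in simp)
    ultimately show ?thesis by simp
  qed
  have "F constant_on ?H"
  proof (rule ccontr)
    assume "\<not> F constant_on ?H"
    then have op: "open (F ` ?H)"
      using open_mapping_thm[OF hol open_halfspace_Im_gt
          convex_connected[OF convex_halfspace_Im_gt] open_halfspace_Im_gt order_refl] by blast
    have "F \<i> \<in> F ` ?H" by simp
    then obtain r where r: "r > 0" "ball (F \<i>) r \<subseteq> F ` ?H" using openE[OF op] by metis
    have "F \<i> + \<i> * of_real (r / 2) \<in> ball (F \<i>) r" using r(1) by (simp add: dist_norm norm_mult)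
    then obtain w where "Im w > 0" "F w = F \<i> + \<i> * of_real (r / 2)" using r(2) by fastforce
    then show False using Im0[of w] Im0[of \<i>] r(1) by simp
  qed
  then obtain k where k: "\<And>z. Im z > 0 \<Longrightarrow> F z = k" by (auto simp: constant_on_def)
  have "F z = k" if "Im z \<ge> 0" for z
  proof -
    have "(\<lambda>n. z + \<i> * of_real (inverse (real (Suc n)))) \<longlonglongrightarrow> z + \<i> * of_real 0"
      by (intro tendsto_intros LIMSEQ_inverse_real_of_nat)
    then have "(\<lambda>n. F (z + \<i> * of_real (inverse (real (Suc n))))) \<longlonglongrightarrow> F z"
      by (intro continuous_on_tendsto_compose[OF cont]) (use that in auto)
    moreover have "F (z + \<i> * of_real (inverse (real (Suc n)))) = k" for n
      using that by (intro k) (simp add: add_nonneg_pos)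
    ultimately show ?thesis by (simp add: LIMSEQ_const_iff)
  qed
  then show ?thesis using xy by simp
qed

text \<open>If the heights \<open>a\<close> and \<open>b\<close> differed, \<open>cosh (\<pi> (\<psi> - \<phi>) / (b - a))\<close> would be real on the whole
  boundary, hence constant; but it takes the values \<open>1\<close> and \<open>-1\<close> at two of the corners.\<close>

lemma rectangle_map_unique:
  assumes "A < B" "B < C" "C < D" "a > 0" "b > 0"
    and "rectangle_map A B C D a \<phi>" "rectangle_map A B C D b \<psi>"
  shows "a = b"
proof (rule ccontr)
  assume ne: "a \<noteq> b"
  interpret f: rectangle_uniformization A B C D a \<phi> using assms by unfold_locales auto
  interpret g: rectangle_uniformization A B C D b \<psi> using assms by unfold_locales auto
  define c where "c = b - a"
  have c: "c \<noteq> 0" using ne by (simp add: c_def)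
  define w where "w z = of_real pi * (\<psi> z - \<phi> z) / of_real c" for z
  define F where "F z = exp (w z) + exp (- w z)" for z
  obtain p q where pq: "(\<phi> \<longlongrightarrow> p) (inf at_infinity (principal {z. Im z \<ge> 0}))"
    "(\<psi> \<longlongrightarrow> q) (inf at_infinity (principal {z. Im z \<ge> 0}))"
    using f.f_lim g.f_lim by blast
  let ?l = "exp (of_real pi * (q - p) / of_real c) + exp (- (of_real pi * (q - p) / of_real c))"
  have "F (of_real A) = F (of_real D)"
  proof (rule holomorphic_real_boundary_constant[where F = F and l = ?l])
    show "F holomorphic_on {z. Im z > 0}"
      unfolding F_def w_def using f.f_hol g.f_hol c by (intro holomorphic_intros) auto
    show "continuous_on {z. Im z \<ge> 0} F"
      unfolding F_def w_def using f.f_cont g.f_cont c by (intro continuous_intros) auto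
    show "(F \<longlongrightarrow> ?l) (inf at_infinity (principal {z. Im z \<ge> 0}))"
      unfolding F_def w_def using pq c by (intro tendsto_intros) auto
    fix x :: real
    \<comment> \<open>\<open>F\<close> is twice \<open>cosh w\<close>. On the vertical sides both
      maps have the same real part, so \<open>Re (w z) = 0\<close>; on the horizontal sides
      \<open>Im (w z)\<close> is 0 at the bottom and \<open>pi\<close> at the top. One factor of
      this product vanishes in each case.\<close>
    have ImF: "Im (F z) = (exp (Re (w z)) - exp (- Re (w z))) * sin (Im (w z))" for z
      unfolding F_def by (simp add: Im_exp algebra_simps)
    have wRe: "Re (w z) = pi * (Re (\<psi> z) - Re (\<phi> z)) / c" and wIm: "Im (w z) = pi * (Im (\<psi> z) - Im (\<phi> z)) / c" for z
      unfolding w_def by simp_all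
    consider "x \<le> A" | "A \<le> x" "x \<le> B" | "B \<le> x" "x \<le> C" | "C \<le> x" "x \<le> D" | "D \<le> x" by linarith
    then show "Im (F (of_real x)) = 0"
    proof cases
      case 1 then show ?thesis unfolding ImF wRe using f.side_A g.side_A by simp
    next
      case 2 then show ?thesis unfolding ImF wIm using f.side_AB g.side_AB by simp
    next
      case 3 then show ?thesis unfolding ImF wRe using f.side_BC g.side_BC by simp
    next
      case 4
      then have "Im (w (of_real x)) = pi" unfolding wIm using f.side_CD g.side_CD c by (simp add: c_def)
      then show ?thesis unfolding ImF by simp
    next
      case 5 then show ?thesis unfolding ImF wRe using f.side_D g.side_D by simp
    qed
  qed auto
  moreover have "F (of_real A) = 2" by (simp add: F_def w_def f.f_A g.f_A)
  moreover have "F (of_real D) = - 2"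
  proof -
    have "\<psi> (of_real D) - \<phi> (of_real D) = \<i> * of_real c" by (simp add: f.f_D g.f_D c_def complex_eq_iff)
    then have "w (of_real D) = \<i> * of_real pi" using c by (simp add: w_def)
    then show ?thesis by (simp add: F_def exp_minus)
  qed
  ultimately show False by simp
qed

theorem quad_modulus_eq:
  assumes "A < B" "B < C" "C < D"
  shows "quad_modulus A B C D =
    elliptic_K (sqrt (1 - (ellipse_modulus A B C D)\<^sup>2)) / elliptic_K (ellipse_modulus A B C D)"
proof -
  interpret quadrilateral A B C D using assms by unfold_locales
  have "quad_modulus A B C D = a"
    unfolding quad_modulus_def
    by (rule the_equality) (use a_pos rectangle_map_psi rectangle_map_unique[OF assms] in blast)+
  then show ?thesis using width_eq height_eq by (simp add: a_def k_def)
qed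

section \<open>Estimates for elliptic integrals\<close>

definition ell :: "real \<Rightarrow> real \<Rightarrow> real" where
  "ell r x = 1 / (sqrt (1 - x\<^sup>2) * sqrt (1 - r\<^sup>2 * x\<^sup>2))"

lemma elliptic_K_alt: "elliptic_K r = integral {0..1} (ell r)"
  by (simp add: elliptic_K_def ell_def[abs_def])

lemma arcsin_integral: "((\<lambda>x. 1 / sqrt (1 - x\<^sup>2)) has_integral pi / 2) {0..1::real}"
proof -
  have "((\<lambda>x. 1 / sqrt (1 - x\<^sup>2)) has_integral (arcsin 1 - arcsin 0)) {0..1::real}"
  proof (rule fundamental_theorem_of_calculus_interior)
    show "continuous_on {0..1::real} arcsin"
      by (rule continuous_on_subset[OF continuous_on_arcsin']) auto
    fix x :: real assume "x \<in> {0<..<1}"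
    then show "(arcsin has_vector_derivative 1 / sqrt (1 - x\<^sup>2)) (at x)"
      using DERIV_arcsin[of x] by (simp add: has_real_derivative_iff_has_vector_derivative inverse_eq_divide)
  qed simp
  then show ?thesis by simp
qed

lemma one_minus_rx:
  fixes r x :: real
  assumes "0 \<le> r" "r < 1" "0 \<le> x" "x \<le> 1"
  shows "1 - r\<^sup>2 \<le> 1 - r\<^sup>2 * x\<^sup>2" "1 - r\<^sup>2 * x\<^sup>2 \<le> 1" "0 < 1 - r\<^sup>2"
proof -
  have "x\<^sup>2 \<le> 1" using assms by (simp add: power_le_one)
  then show "1 - r\<^sup>2 \<le> 1 - r\<^sup>2 * x\<^sup>2" by (simp add: mult_left_le)
  show "1 - r\<^sup>2 * x\<^sup>2 \<le> 1" by simp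
  show "0 < 1 - r\<^sup>2" using assms by (simp add: power_less_one_iff)
qed

lemma ell_bounds:
  assumes r: "0 \<le> r" "r < 1" and x: "0 \<le> x" "x \<le> 1"
  shows "1 / sqrt (1 - x\<^sup>2) \<le> ell r x" "ell r x \<le> 1 / sqrt (1 - r\<^sup>2) * (1 / sqrt (1 - x\<^sup>2))"
proof -
  note b = one_minus_rx[OF r x]
  have u: "1 / sqrt (1 - x\<^sup>2) \<ge> 0" using x by (simp add: power_le_one)
  have s: "0 < sqrt (1 - r\<^sup>2)" "sqrt (1 - r\<^sup>2) \<le> sqrt (1 - r\<^sup>2 * x\<^sup>2)" "sqrt (1 - r\<^sup>2 * x\<^sup>2) \<le> 1" using b by auto
  have e: "ell r x = 1 / sqrt (1 - r\<^sup>2 * x\<^sup>2) * (1 / sqrt (1 - x\<^sup>2))" by (simp add: ell_def mult.commute)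
  have "1 \<le> 1 / sqrt (1 - r\<^sup>2 * x\<^sup>2)" using s by (simp add: le_divide_eq)
  from mult_right_mono[OF this u] show "1 / sqrt (1 - x\<^sup>2) \<le> ell r x" unfolding e by simp
  have "1 / sqrt (1 - r\<^sup>2 * x\<^sup>2) \<le> 1 / sqrt (1 - r\<^sup>2)" using s by (intro divide_left_mono) auto
  from mult_right_mono[OF this u] show "ell r x \<le> 1 / sqrt (1 - r\<^sup>2) * (1 / sqrt (1 - x\<^sup>2))" unfolding e .
qed

lemma ell_nonneg: "0 \<le> r \<Longrightarrow> r < 1 \<Longrightarrow> 0 \<le> x \<Longrightarrow> x \<le> 1 \<Longrightarrow> 0 \<le> ell r x"
  by (rule order_trans[OF _ ell_bounds(1)]) (auto simp: power_le_one)

lemma ell_continuous: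
  assumes r: "0 \<le> r" "r < 1" shows "continuous_on {0..<1} (ell r)"
proof -
  have "1 - x\<^sup>2 > 0" "1 - r\<^sup>2 * x\<^sup>2 > 0" if "x \<in> {0..<1}" for x
    using one_minus_rx[OF r, of x] that by (auto simp: power_less_one_iff)
  then show ?thesis unfolding ell_def[abs_def]
    by (intro continuous_intros) (auto simp: less_imp_neq[symmetric])
qed

lemma ell_integrable:
  assumes r: "0 \<le> r" "r < 1" shows "ell r integrable_on {0..1}"
proof -
  have "ell r integrable_on {0..<1}"
  proof (rule measurable_bounded_by_integrable_imp_integrable)
    show "ell r \<in> borel_measurable (lebesgue_on {0..<1})"
      by (rule continuous_imp_measurable_on_sets_lebesgue[OF ell_continuous[OF r]]) simp
    have "(\<lambda>x. 1 / sqrt (1 - r\<^sup>2) * (1 / sqrt (1 - x\<^sup>2))) integrable_on {0..1}"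
      using arcsin_integral by (intro integrable_on_mult_right) (rule has_integral_integrable)
    then show "(\<lambda>x. 1 / sqrt (1 - r\<^sup>2) * (1 / sqrt (1 - x\<^sup>2))) integrable_on {0..<1}"
      by (rule integrable_spike_set) (rule negligible_subset[of "{1::real}"], auto)+
    fix x :: real assume "x \<in> {0..<1}"
    then show "norm (ell r x) \<le> 1 / sqrt (1 - r\<^sup>2) * (1 / sqrt (1 - x\<^sup>2))"
      using ell_bounds(2)[OF r, of x] ell_nonneg[OF r, of x] by simp
  qed simp
  then show ?thesis
    by (rule integrable_spike_set) (rule negligible_subset[of "{1::real}"], auto)+
qed

lemma elliptic_K_ge: "0 \<le> r \<Longrightarrow> r < 1 \<Longrightarrow> pi / 2 \<le> elliptic_K r"
  unfolding elliptic_K_alt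
  by (rule has_integral_le[OF arcsin_integral integrable_integral[OF ell_integrable]])
     (use ell_bounds(1) in auto)

lemma elliptic_K_pos: "0 \<le> r \<Longrightarrow> r < 1 \<Longrightarrow> 0 < elliptic_K r"
  using elliptic_K_ge[of r] pi_gt_zero by linarith

lemma elliptic_K_le:
  assumes r: "0 \<le> r" "r < 1" shows "elliptic_K r \<le> pi / 2 / sqrt (1 - r\<^sup>2)"
proof -
  have "((\<lambda>x. 1 / sqrt (1 - r\<^sup>2) * (1 / sqrt (1 - x\<^sup>2))) has_integral 1 / sqrt (1 - r\<^sup>2) * (pi / 2)) {0..1}"
    by (rule has_integral_mult_right[OF arcsin_integral])
  from has_integral_le[OF integrable_integral[OF ell_integrable[OF r]] this]
  show ?thesis unfolding elliptic_K_alt using ell_bounds(2)[OF r] by simp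
qed

text \<open>Continuity makes \<open>modulus_of\<close> surjective by the intermediate value theorem,
  which gives \<open>grotzsch_mu_inv\<close> its meaning.\<close>

lemma continuous_on_elliptic_K:
  assumes R: "0 \<le> R" "R < 1" shows "continuous_on {0..R} elliptic_K"
proof (clarsimp simp: continuous_on_sequentially)
  fix x a assume x: "\<forall>n. 0 \<le> x n \<and> x n \<le> R" and a: "0 \<le> a" "a \<le> R" and l: "x \<longlonglongrightarrow> a"
  have "(\<lambda>n. integral {0..1} (ell (x n))) \<longlonglongrightarrow> integral {0..1} (ell a)"
  proof (rule dominated_convergence(2))
    show "ell (x n) integrable_on {0..1}" for n
      using x R by (intro ell_integrable) (auto intro: le_less_trans)
    show "(\<lambda>t. 1 / sqrt (1 - R\<^sup>2) * (1 / sqrt (1 - t\<^sup>2))) integrable_on {0..1}"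
      using arcsin_integral by (intro integrable_on_mult_right) (rule has_integral_integrable)
  next
    fix n and t :: real assume t: "t \<in> {0..1}"
    have xn: "0 \<le> x n" "x n < 1" "x n \<le> R" using x R by (auto intro: le_less_trans)
    have sq: "sqrt (1 - R\<^sup>2) \<le> sqrt (1 - (x n)\<^sup>2)" using xn by (simp add: power_mono)
    have s: "0 < sqrt (1 - R\<^sup>2)" using R by (simp add: power_less_one_iff)
    have "ell (x n) t \<le> 1 / sqrt (1 - (x n)\<^sup>2) * (1 / sqrt (1 - t\<^sup>2))"
      using ell_bounds(2)[OF xn(1,2)] t by simp
    also have "\<dots> \<le> 1 / sqrt (1 - R\<^sup>2) * (1 / sqrt (1 - t\<^sup>2))"
    proof (rule mult_right_mono)
      show "1 / sqrt (1 - (x n)\<^sup>2) \<le> 1 / sqrt (1 - R\<^sup>2)"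
        using sq s by (intro divide_left_mono mult_pos_pos) linarith+
      show "0 \<le> 1 / sqrt (1 - t\<^sup>2)" using t by (simp add: power_le_one)
    qed
    finally show "norm (ell (x n) t) \<le> 1 / sqrt (1 - R\<^sup>2) * (1 / sqrt (1 - t\<^sup>2))"
      using ell_nonneg[OF xn(1,2), of t] t by simp
  next
    fix t :: real assume t: "t \<in> {0..1}"
    show "(\<lambda>n. ell (x n) t) \<longlonglongrightarrow> ell a t"
    proof (cases "t = 1")
      case True then show ?thesis by (simp add: ell_def)
    next
      case False
      then have "0 < 1 - t\<^sup>2" using t by (simp add: power_less_one_iff)
      moreover have "0 < 1 - a\<^sup>2 * t\<^sup>2" using one_minus_rx[of a t] a R t by auto
      ultimately show ?thesis unfolding ell_def
        by (intro tendsto_intros l) auto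
    qed
  qed
  then show "(elliptic_K \<circ> x) \<longlonglongrightarrow> elliptic_K a" by (simp add: o_def elliptic_K_alt)
qed

lemma isCont_elliptic_K:
  assumes x: "0 < x" "x < 1" shows "isCont elliptic_K x"
proof -
  have "x \<in> interior {0..(x + 1) / 2}" using x by (simp add: interior_atLeastAtMost_real)
  moreover have "continuous_on {0..(x + 1) / 2} elliptic_K" using x by (intro continuous_on_elliptic_K) auto
  ultimately show ?thesis by (rule continuous_on_interior[rotated])
qed

text \<open>The sum of two equal elementary integrals: half of it is
  \<open>artanh (1 / sqrt (1 + k))\<close> and also \<open>arsinh (1 / sqrt k)\<close>.\<close>

definition log_bound :: "real \<Rightarrow> real" where
  "log_bound k = ln ((1 + sqrt (1 + k))\<^sup>2 / k)"

text \<open>The elliptic integral is split where the two factors \<open>1 - x\<^sup>2 + k\<^sup>2 x\<^sup>2 \<approx> 1 - x\<^sup>2\<close> (left) and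
  \<open>1 \<approx> x\<^sup>2\<close> (right) are off by the same ratio \<open>1 + k\<close>; both comparison integrals are elementary.\<close>

lemma elliptic_K_complementary:
  assumes k: "0 < k" "k < 1"
  shows "elliptic_K (sqrt (1 - k\<^sup>2)) \<le> log_bound k"
    and "log_bound k / sqrt (1 + k) \<le> elliptic_K (sqrt (1 - k\<^sup>2))"
proof -
  define r where "r = sqrt (1 - k\<^sup>2)"
  define s where "s = sqrt (1 + k)"
  define x0 where "x0 = 1 / s"
  have k2: "0 < k\<^sup>2" "k\<^sup>2 < 1" using k by (simp_all add: power_less_one_iff)
  have r: "0 \<le> r" "r < 1" "r\<^sup>2 = 1 - k\<^sup>2" using k2 by (auto simp: r_def)
  have s: "s > 1" "s\<^sup>2 = 1 + k" using k by (auto simp: s_def)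
  have x0: "0 < x0" "x0 < 1" using s by (auto simp: x0_def)
  have x0sq: "x0\<^sup>2 = 1 / (1 + k)" using s by (simp add: x0_def power_divide)
  have rx: "1 - r\<^sup>2 * x\<^sup>2 = 1 - x\<^sup>2 + k\<^sup>2 * x\<^sup>2" for x unfolding r(3) by (simp add: algebra_simps)
  define L where "L = log_bound k"
  have L1: "(1 / (1 + k)) \<le> 1" using k by simp
  have L: "L / 2 = artanh x0"
  proof -
    have "(1 + x0) / (1 - x0) = (s + 1) / (s - 1)" using s by (simp add: x0_def field_simps)
    also have "\<dots> = (s + 1)\<^sup>2 / ((s - 1) * (s + 1))" using s by (simp add: power2_eq_square)
    also have "(s - 1) * (s + 1) = k" using s by (simp add: algebra_simps power2_eq_square)
    finally show ?thesis by (simp add: artanh_def L_def log_bound_def s_def add.commute)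
  qed
  have L': "L / 2 = arsinh (1 / sqrt k)"
  proof -
    have "1 / sqrt k + sqrt ((1 / sqrt k)\<^sup>2 + 1) = (1 + s) / sqrt k"
    proof -
      have "(1 / sqrt k)\<^sup>2 + 1 = (1 + k) / k" using k by (simp add: power_divide field_simps)
      then have "sqrt ((1 / sqrt k)\<^sup>2 + 1) = s / sqrt k" by (simp only: real_sqrt_divide s_def)
      then show ?thesis by (simp add: add_divide_distrib)
    qed
    moreover have "(1 + s)\<^sup>2 / k = ((1 + s) / sqrt k)\<^sup>2" using k by (simp add: power_divide)
    moreover have "(1 + s) / sqrt k > 0" using k s by simp
    ultimately show ?thesis
      by (simp add: arsinh_real_def L_def log_bound_def s_def[symmetric] ln_realpow)
  qed
  have I1: "((\<lambda>x. 1 / (1 - x\<^sup>2)) has_integral L / 2) {0..x0}"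
  proof -
    have "((\<lambda>x. 1 / (1 - x\<^sup>2)) has_integral (artanh x0 - artanh 0)) {0..x0}"
    proof (rule fundamental_theorem_of_calculus)
      fix x assume "x \<in> {0..x0}"
      then have "\<bar>x\<bar> < 1" using x0 by auto
      from artanh_real_has_field_derivative[OF this]
      show "(artanh has_vector_derivative 1 / (1 - x\<^sup>2)) (at x within {0..x0})"
        by (simp add: has_real_derivative_iff_has_vector_derivative)
    qed (use x0 in simp)
    then show ?thesis using L by simp
  qed
  define g where "g x = 1 / (x * sqrt (1 - x\<^sup>2) * sqrt (1 - r\<^sup>2 * x\<^sup>2))" for x
  \<comment> \<open>The substitution that integrates \<open>g\<close>: the derivative of
    \<open>- arsinh (u x)\<close> is \<open>g x\<close>, and \<open>u\<close> vanishes at 1.\<close>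
  define u where "u x = sqrt (1 - x\<^sup>2) / (k * x)" for x
  have I2: "(g has_integral L / 2) {x0..1}"
  proof -
    have "(g has_integral (- arsinh (u 1) - (- arsinh (u x0)))) {x0..1}"
    proof (rule fundamental_theorem_of_calculus_interior)
      show "continuous_on {x0..1} (\<lambda>x. - arsinh (u x))"
        unfolding u_def using x0 k by (intro continuous_intros) auto
      fix x assume "x \<in> {x0<..<1}"
      then have x: "0 < x" "x < 1" using x0 by auto
      define w where "w = sqrt (1 - x\<^sup>2)"
      have w: "w > 0" "w\<^sup>2 = 1 - x\<^sup>2" using x by (auto simp: w_def power_less_one_iff power_le_one)
      have v0: "1 - r\<^sup>2 * x\<^sup>2 > 0" using one_minus_rx[OF r(1,2), of x] x by auto
      define v where "v = sqrt (1 - r\<^sup>2 * x\<^sup>2)"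
      have v: "v > 0" "v\<^sup>2 = 1 - x\<^sup>2 + k\<^sup>2 * x\<^sup>2" using v0 by (auto simp: v_def rx)
      have du: "DERIV u x :> - 1 / (k * x\<^sup>2 * w)"
      proof -
        have "DERIV (\<lambda>x. sqrt (1 - x\<^sup>2)) x :> - x / w"
        proof -
          have "x\<^sup>2 < 1" using x by (simp add: power_less_one_iff)
          then show ?thesis unfolding w_def by (auto intro!: derivative_eq_intros simp: field_simps)
        qed
        then have "DERIV u x :> ((- x / w) * (k * x) - w * k) / ((k * x) * (k * x))"
          unfolding u_def w_def using x k
          by (intro DERIV_divide) (auto intro!: derivative_eq_intros)
        moreover have "((- x / w) * (k * x) - w * k) / ((k * x) * (k * x)) = - (x\<^sup>2 + w\<^sup>2) / (k * x\<^sup>2 * w)"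
          using x k w(1) by (simp add: field_simps power2_eq_square)
        ultimately show ?thesis using w(2) by simp
      qed
      have "(u x)\<^sup>2 + 1 = (v / (k * x))\<^sup>2"
        using x k w v by (simp add: u_def w_def[symmetric] power_divide power_mult_distrib field_simps)
      then have su: "sqrt ((u x)\<^sup>2 + 1) = v / (k * x)" using x k v(1) by simp
      have "DERIV (\<lambda>x. - arsinh (u x)) x :> - (1 / sqrt ((u x)\<^sup>2 + 1) * (- 1 / (k * x\<^sup>2 * w)))"
        by (intro DERIV_minus DERIV_chain2[OF arsinh_real_has_field_derivative du])
      moreover have "- (1 / sqrt ((u x)\<^sup>2 + 1) * (- 1 / (k * x\<^sup>2 * w))) = g x"
        unfolding su g_def w_def[symmetric] v_def[symmetric] using x k w(1) v(1)
        by (simp add: power2_eq_square)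
      ultimately show "((\<lambda>x. - arsinh (u x)) has_vector_derivative g x) (at x)"
        by (simp add: has_real_derivative_iff_has_vector_derivative)
    qed (use x0 in simp)
    moreover have "u x0 = 1 / sqrt k"
    proof -
      have "1 - x0\<^sup>2 = k * x0\<^sup>2" unfolding x0sq using k by (simp add: field_simps)
      then have "sqrt (1 - x0\<^sup>2) = sqrt k * x0" using x0 by (simp add: real_sqrt_mult)
      then have "u x0 = sqrt k / k" using x0 by (simp add: u_def)
      also have "\<dots> = 1 / sqrt k" using k by (simp add: frac_eq_eq)
      finally show ?thesis .
    qed
    ultimately show ?thesis using L' by (simp add: u_def)
  qed
  have split: "integral {0..1} (ell r) = integral {0..x0} (ell r) + integral {x0..1} (ell r)"
    using Henstock_Kurzweil_Integration.integral_combine[of 0 x0 1 "ell r"] ell_integrable[OF r(1,2)] x0 by simp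
  have int1: "ell r integrable_on {0..x0}" and int2: "ell r integrable_on {x0..1}"
    using integrable_on_subinterval[OF ell_integrable[OF r(1,2)]] x0 by auto
  have b1: "ell r x \<le> 1 / (1 - x\<^sup>2) \<and> 1 / s * (1 / (1 - x\<^sup>2)) \<le> ell r x" if "x \<in> {0..x0}" for x
  proof -
    have x: "0 \<le> x" "x < 1" "x \<le> x0" using that x0 by auto
    have p: "1 - x\<^sup>2 > 0" using x by (simp add: power_less_one_iff)
    have "x\<^sup>2 \<le> 1 / (1 + k)" using power_mono[OF x(3,1), of 2] x0sq by simp
    then have "x\<^sup>2 * (1 + k) \<le> 1" using k by (simp add: field_simps)
    then have "k * x\<^sup>2 \<le> 1 - x\<^sup>2" by (simp add: algebra_simps)
    from mult_left_mono[OF this, of k] have "k\<^sup>2 * x\<^sup>2 \<le> k * (1 - x\<^sup>2)" using k by (simp add: power2_eq_square mult.assoc)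
    then have "1 - r\<^sup>2 * x\<^sup>2 \<le> (1 + k) * (1 - x\<^sup>2)" unfolding rx by (simp add: algebra_simps)
    then have "sqrt (1 - r\<^sup>2 * x\<^sup>2) \<le> s * sqrt (1 - x\<^sup>2)"
      unfolding s_def real_sqrt_mult[symmetric] by (rule real_sqrt_le_mono)
    then have "sqrt (1 - x\<^sup>2) * sqrt (1 - r\<^sup>2 * x\<^sup>2) \<le> sqrt (1 - x\<^sup>2) * (s * sqrt (1 - x\<^sup>2))"
      by (rule mult_left_mono) (use p in simp)
    moreover have q: "sqrt (1 - x\<^sup>2) * sqrt (1 - x\<^sup>2) = 1 - x\<^sup>2" using p by simp
    ultimately have up: "sqrt (1 - x\<^sup>2) * sqrt (1 - r\<^sup>2 * x\<^sup>2) \<le> s * (1 - x\<^sup>2)"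
      by (simp only: mult.left_commute)
    have "sqrt (1 - x\<^sup>2) \<le> sqrt (1 - r\<^sup>2 * x\<^sup>2)" unfolding rx by simp
    then have "sqrt (1 - x\<^sup>2) * sqrt (1 - x\<^sup>2) \<le> sqrt (1 - x\<^sup>2) * sqrt (1 - r\<^sup>2 * x\<^sup>2)"
      by (rule mult_left_mono) (use p in simp)
    then have lo: "1 - x\<^sup>2 \<le> sqrt (1 - x\<^sup>2) * sqrt (1 - r\<^sup>2 * x\<^sup>2)" unfolding q .
    have pp: "0 < sqrt (1 - x\<^sup>2) * sqrt (1 - r\<^sup>2 * x\<^sup>2)" using lo p by linarith
    have "ell r x \<le> 1 / (1 - x\<^sup>2)" unfolding ell_def
      by (rule divide_left_mono[OF lo]) (use pp p in auto)
    moreover have "1 / (s * (1 - x\<^sup>2)) \<le> ell r x" unfolding ell_def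
      by (rule divide_left_mono[OF up]) (use pp p s(1) in \<open>auto intro!: mult_pos_pos\<close>)
    ultimately show ?thesis by simp
  qed
  have b2: "ell r x \<le> g x \<and> 1 / s * g x \<le> ell r x" if "x \<in> {x0..1}" for x
  proof -
    have x: "0 < x" "x \<le> 1" "x0 \<le> x" using that x0 by auto
    have e: "ell r x = x * g x" using x by (simp add: ell_def g_def)
    have "g x \<ge> 0" using ell_nonneg[OF r(1,2), of x] x unfolding e by (simp add: zero_le_mult_iff)
    then have "x * g x \<le> 1 * g x" "x0 * g x \<le> x * g x" using x by (intro mult_right_mono; simp)+
    then show ?thesis unfolding e x0_def by simp
  qed
  have "integral {0..x0} (ell r) \<le> L / 2"
    by (rule has_integral_le[OF integrable_integral[OF int1] I1]) (use b1 in auto)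
  moreover have "integral {x0..1} (ell r) \<le> L / 2"
    by (rule has_integral_le[OF integrable_integral[OF int2] I2]) (use b2 in auto)
  ultimately show "elliptic_K (sqrt (1 - k\<^sup>2)) \<le> log_bound k"
    unfolding elliptic_K_alt using split by (simp add: L_def r_def)
  have "1 / s * (L / 2) \<le> integral {0..x0} (ell r)"
    by (rule has_integral_le[OF has_integral_mult_right[OF I1] integrable_integral[OF int1]]) (use b1 in auto)
  moreover have "1 / s * (L / 2) \<le> integral {x0..1} (ell r)"
    by (rule has_integral_le[OF has_integral_mult_right[OF I2] integrable_integral[OF int2]]) (use b2 in auto)
  moreover have "1 / s * (L / 2) + 1 / s * (L / 2) = L / s" by simp
  ultimately show "log_bound k / sqrt (1 + k) \<le> elliptic_K (sqrt (1 - k\<^sup>2))"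
    unfolding elliptic_K_alt using split by (simp add: L_def r_def s_def)
qed

section \<open>The modulus as a function of \<open>k\<close>, its inverse, and the size of
  \<open>K1\<close>\<close>

definition modulus_of :: "real \<Rightarrow> real" where
  "modulus_of k = elliptic_K (sqrt (1 - k\<^sup>2)) / elliptic_K k"

lemma complementary_bounds:
  fixes k :: real
  assumes "0 < k" "k < 1" shows "0 < sqrt (1 - k\<^sup>2)" "sqrt (1 - k\<^sup>2) < 1"
  using assms by (auto simp: power_less_one_iff)

lemma modulus_of_pos: "0 < k \<Longrightarrow> k < 1 \<Longrightarrow> 0 < modulus_of k"
  using elliptic_K_pos[of k] elliptic_K_pos[of "sqrt (1 - k\<^sup>2)"] complementary_bounds[of k]
  by (simp add: modulus_of_def)

lemma modulus_of_le:
  assumes k: "0 < k" "k < 1" shows "modulus_of k \<le> 2 / pi * log_bound k"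
proof -
  have "modulus_of k \<le> elliptic_K (sqrt (1 - k\<^sup>2)) / (pi / 2)"
    unfolding modulus_of_def using elliptic_K_ge[of k] elliptic_K_pos[of k]
      elliptic_K_pos[of "sqrt (1 - k\<^sup>2)"] complementary_bounds[OF k] k
    by (intro divide_left_mono) auto
  also have "\<dots> \<le> log_bound k / (pi / 2)"
    using elliptic_K_complementary(1)[OF k] by (intro divide_right_mono) auto
  finally show ?thesis by (simp add: mult.commute)
qed

text \<open>The factor \<open>sqrt (1 - k^2)\<close> from \<open>elliptic_K_le\<close> is paid for
  by the 4 in \<open>ln (4 / k) <= log_bound k\<close>: from
  \<open>k * ln (1 / k) <= 1 - k <= (1 - k) * ln 4\<close> still follows
  \<open>ln (1 / k) <= (1 - k) * ln (4 / k)\<close>.\<close>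

lemma modulus_of_ge:
  assumes k: "0 < k" "k < 1" shows "2 / pi * ln (1 / k) \<le> modulus_of k"
proof -
  have k1: "0 < 1 - k" using k by simp
  have Kp: "elliptic_K k > 0" using elliptic_K_pos k by simp
  have k2: "0 < 1 - k\<^sup>2" using k by (simp add: power_less_one_iff)
  have lb: "ln (4 / k) \<le> log_bound k"
  proof -
    have "2 \<le> 1 + sqrt (1 + k)" using k by simp
    from power_mono[OF this, of 2] have "4 \<le> (1 + sqrt (1 + k))\<^sup>2" by simp
    then have "4 / k \<le> (1 + sqrt (1 + k))\<^sup>2 / k" using k by (intro divide_right_mono) auto
    then show ?thesis unfolding log_bound_def by (intro ln_mono) (use k in auto)
  qed
  have "k * ln (1 / k) \<le> 1 - k"
  proof -
    have "k * ln (1 / k) \<le> k * (1 / k - 1)" using k by (intro mult_left_mono ln_le_minus_one) auto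
    also have "\<dots> = 1 - k" using k by (simp add: right_diff_distrib)
    finally show ?thesis .
  qed
  moreover have "1 \<le> ln (4::real)"
  proof -
    have "exp 1 \<le> (4::real)" using exp_le by simp
    then show ?thesis by (simp add: ln_ge_iff)
  qed
  then have "(1 - k) * 1 \<le> (1 - k) * ln 4" using k by (intro mult_left_mono) auto
  moreover have "ln (4 / k) = ln 4 + ln (1 / k)" using k by (simp add: ln_div)
  ultimately have "ln (1 / k) \<le> (1 - k) * ln (4 / k)" by (simp add: algebra_simps)
  also have "\<dots> \<le> (1 - k) * log_bound k" using lb k by (intro mult_left_mono) auto
  also have "\<dots> \<le> sqrt (1 - k) * log_bound k"
  proof (rule mult_right_mono)
    have "(1 - k)\<^sup>2 \<le> 1 - k" using k by (simp add: power2_eq_square mult_left_le_one_le)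
    then show "1 - k \<le> sqrt (1 - k)" by (rule real_le_rsqrt)
    have "0 \<le> ln (4 / k)" using k by (intro ln_ge_zero) simp
    then show "0 \<le> log_bound k" using lb by linarith
  qed
  also have "sqrt (1 - k) = sqrt (1 - k\<^sup>2) / sqrt (1 + k)"
  proof -
    have "1 - k\<^sup>2 = (1 - k) * (1 + k)" by (simp add: algebra_simps power2_eq_square)
    then show ?thesis using k by (simp add: real_sqrt_mult)
  qed
  finally have *: "ln (1 / k) \<le> sqrt (1 - k\<^sup>2) * (log_bound k / sqrt (1 + k))" by simp
  have "2 / pi * ln (1 / k) * elliptic_K k \<le> 2 / pi * ln (1 / k) * (pi / 2 / sqrt (1 - k\<^sup>2))"
    using elliptic_K_le[of k] k by (intro mult_left_mono mult_nonneg_nonneg) (auto intro!: ln_ge_zero)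
  also have "\<dots> = ln (1 / k) / sqrt (1 - k\<^sup>2)" by simp
  also have "\<dots> \<le> log_bound k / sqrt (1 + k)"
    using * k2 by (simp add: divide_le_eq mult.commute)
  also have "\<dots> \<le> elliptic_K (sqrt (1 - k\<^sup>2))" by (rule elliptic_K_complementary(2)[OF k])
  finally show ?thesis unfolding modulus_of_def using Kp by (simp add: le_divide_eq)
qed

lemma grotzsch_mu_eq: "grotzsch_mu r = modulus_of r / 4"
  by (simp add: grotzsch_mu_def modulus_of_def)

lemma modulus_of_complement:
  assumes "0 < k" "k < 1" shows "modulus_of (sqrt (1 - k\<^sup>2)) = 1 / modulus_of k"
proof -
  have "k\<^sup>2 \<le> 1" using assms by (simp add: power_le_one)
  then show ?thesis using assms by (simp add: modulus_of_def)
qed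

lemma continuous_on_modulus_of: "continuous_on {0<..<1} modulus_of"
proof (rule continuous_at_imp_continuous_on, rule ballI)
  fix k :: real assume k: "k \<in> {0<..<1}"
  have "isCont (\<lambda>k. elliptic_K (sqrt (1 - k\<^sup>2))) k"
    using k complementary_bounds[of k]
    by (intro isCont_o2[OF _ isCont_elliptic_K] continuous_intros) auto
  moreover have "isCont elliptic_K k" using isCont_elliptic_K k by auto
  ultimately show "isCont modulus_of k"
    unfolding modulus_of_def[abs_def] using elliptic_K_pos[of k] k by (intro continuous_intros) auto
qed

text \<open>\<open>modulus_of_ge\<close> gives large values near 0, and
  \<open>modulus_of_complement\<close> turns them into small values near 1. Connectedness fills the
  gap.\<close>

lemma modulus_of_surj:
  assumes m: "m > 0" obtains k where "0 < k" "k < 1" "modulus_of k = m"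
proof -
  define k1 where "k1 = exp (- (pi / 2 * m))"
  have k1: "0 < k1" "k1 < 1" using m by (auto simp: k1_def)
  have l1: "ln (1 / k1) = pi / 2 * m" by (simp add: k1_def ln_div)
  have "2 / pi * ln (1 / k1) = m" unfolding l1 by simp
  then have a: "m \<le> modulus_of k1" using modulus_of_ge[OF k1] by metis
  define q where "q = exp (- (pi / 2 * (1 / m)))"
  have q: "0 < q" "q < 1" using m by (auto simp: q_def)
  have l2: "ln (1 / q) = pi / 2 * (1 / m)" by (simp add: q_def ln_div)
  have "2 / pi * ln (1 / q) = 1 / m" unfolding l2 by simp
  then have b0: "1 / m \<le> modulus_of q" using modulus_of_ge[OF q] by metis
  have b: "modulus_of (sqrt (1 - q\<^sup>2)) \<le> m"
    unfolding modulus_of_complement[OF q] using b0 m modulus_of_pos[OF q] by (simp add: field_simps)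
  have "connected (modulus_of ` {0<..<1})"
    by (intro connected_continuous_image continuous_on_modulus_of) simp
  moreover have "modulus_of k1 \<in> modulus_of ` {0<..<1}" "modulus_of (sqrt (1 - q\<^sup>2)) \<in> modulus_of ` {0<..<1}"
    using k1 complementary_bounds[OF q] by auto
  ultimately have "m \<in> modulus_of ` {0<..<1}" using connectedD_interval a b by blast
  then show thesis using that by auto
qed

text \<open>Surjectivity of \<open>modulus_of\<close> puts \<open>m\<close> into the range of
  \<open>grotzsch_mu\<close>; with that, \<open>inv_into\<close> returns a genuine preimage rather
  than an arbitrary value.\<close>

lemma grotzsch_mu_inv:
  assumes m: "m > 0"
  shows "0 < grotzsch_mu_inv m" "grotzsch_mu_inv m < 1" "modulus_of (grotzsch_mu_inv m) = 4 * m"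
proof -
  obtain k where "0 < k" "k < 1" "modulus_of k = 4 * m" using modulus_of_surj[of "4 * m"] m by auto
  then have "m \<in> grotzsch_mu ` {0<..<1}" by (intro image_eqI[of _ _ k]) (auto simp: grotzsch_mu_eq)
  from inv_into_into[OF this] f_inv_into_f[OF this]
  show "0 < grotzsch_mu_inv m" "grotzsch_mu_inv m < 1" "modulus_of (grotzsch_mu_inv m) = 4 * m"
    by (simp_all add: grotzsch_mu_inv_def grotzsch_mu_eq)
qed

lemma log_bound_le:
  assumes k: "49 / 100 \<le> k" "k < 1" shows "log_bound k \<le> 232 / 100"
proof -
  have "(10.15::real) \<le> (1 + 0.0725 + 0.0725\<^sup>2 / 2) ^ 32" by (simp add: power2_eq_square eval_nat_numeral)
  also have "\<dots> \<le> exp 0.0725 ^ 32" by (rule power_mono[OF exp_lower_Taylor_quadratic]) auto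
  also have "\<dots> = exp 2.32" by (simp flip: exp_of_nat_mult)
  finally have e: "10.15 \<le> exp (2.32::real)" .
  \<comment> \<open>The claim \<open>(1 + sqrt (1 + k))^2 <= 10.15 * k\<close> with the root
    isolated. The number 10.15 lies between the value of the quotient at \<open>k = 0.49\<close>,
    about 10.06, and \<open>exp 2.32\<close>, about 10.18. The difference of the squares is
    \<open>k * (83.7225 * k - 40.6)\<close>.\<close>
  have "(2 * sqrt (1 + k))\<^sup>2 \<le> (9.15 * k - 2)\<^sup>2"
  proof -
    have "0 \<le> k * (83.7225 * k - 40.6)" using k by (intro mult_nonneg_nonneg) auto
    then show ?thesis using k by (simp add: power2_eq_square algebra_simps)
  qed
  then have "2 * sqrt (1 + k) \<le> 9.15 * k - 2" by (rule power2_le_imp_le) (use k in auto)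
  then have "(1 + sqrt (1 + k))\<^sup>2 \<le> 10.15 * k" using k by (simp add: power2_sum)
  also have "\<dots> \<le> exp 2.32 * k" using e k by (intro mult_right_mono) auto
  finally have "(1 + sqrt (1 + k))\<^sup>2 / k \<le> exp 2.32" using k by (simp add: divide_le_eq)
  then have "log_bound k \<le> ln (exp 2.32)" unfolding log_bound_def
    using k by (intro ln_mono) (auto intro!: divide_pos_pos zero_less_power add_pos_nonneg)
  then show ?thesis by simp
qed

text \<open>Machin's formula with the cubic Taylor bound at \<open>1/5\<close> and the linear one at
  \<open>1/239\<close> gives slightly more than 3.1405.\<close>

lemma pi_ge_314: "314 / 100 \<le> pi"
proof -
  have lower: "x - x ^ 3 / 3 \<le> arctan x" and upper: "arctan x \<le> x" if "0 \<le> x" for x :: real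
  proof -
    have "arctan 0 - (0 - 0 ^ 3 / 3) \<le> arctan x - (x - x ^ 3 / 3)"
    proof (rule DERIV_nonneg_imp_nondecreasing[OF that])
      fix y :: real
      have "DERIV (\<lambda>x. arctan x - (x - x ^ 3 / 3)) y :> inverse (1 + y\<^sup>2) - (1 - y\<^sup>2)"
        by (auto intro!: derivative_eq_intros)
      moreover have "(1 - y\<^sup>2) * (1 + y\<^sup>2) \<le> 1" by (simp add: algebra_simps)
      then have "1 - y\<^sup>2 \<le> inverse (1 + y\<^sup>2)"
        by (simp add: inverse_eq_divide le_divide_eq add_pos_nonneg)
      ultimately show "\<exists>d. DERIV (\<lambda>x. arctan x - (x - x ^ 3 / 3)) y :> d \<and> 0 \<le> d"
        by (intro exI conjI) auto
    qed
    then show "x - x ^ 3 / 3 \<le> arctan x" by simp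
    have "0 - arctan 0 \<le> x - arctan x"
    proof (rule DERIV_nonneg_imp_nondecreasing[OF that])
      fix y :: real
      have "DERIV (\<lambda>x. x - arctan x) y :> 1 - inverse (1 + y\<^sup>2)" by (auto intro!: derivative_eq_intros)
      moreover have "inverse (1 + y\<^sup>2) \<le> 1" by (simp add: inverse_le_1_iff)
      ultimately show "\<exists>d. DERIV (\<lambda>x. x - arctan x) y :> d \<and> 0 \<le> d" by (intro exI conjI) auto
    qed
    then show "arctan x \<le> x" by simp
  qed
  have "1 / 5 - 1 / 375 \<le> arctan (1 / 5)" using lower[of "1/5"] by (simp add: power3_eq_cube)
  moreover have "arctan (1 / 239) \<le> 1 / 239" by (rule upper) simp
  ultimately show ?thesis using machin by linarith
qed

lemma ln_5_3_le: "ln (5 / 3 :: real) \<le> 512 / 1000"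
proof -
  have "(5 / 3 :: real) \<le> (1 + 0.064 + 0.064\<^sup>2 / 2) ^ 8" by (simp add: power2_eq_square eval_nat_numeral)
  also have "\<dots> \<le> exp 0.064 ^ 8" by (rule power_mono[OF exp_lower_Taylor_quadratic]) auto
  also have "\<dots> = exp (512 / 1000)" by (simp flip: exp_of_nat_mult)
  finally have "ln (5 / 3 :: real) \<le> ln (exp (512 / 1000))" by (intro ln_mono) auto
  then show ?thesis by simp
qed

text \<open>An interval whose neighbours are at least \<open>0.965\<close> times as long has \<open>\<pi> / \<chi> \<le> 4.64\<close>. The
  exponent 45 below is the number of steps, per unit of \<open>B + 1\<close>, needed to cover the circle.\<close>

definition step_factor :: "real \<Rightarrow> real" where "step_factor Q = exp (464 / 100 * Q ^ 6)"

text \<open>The complementary parameter \<open>p\<close> has modulus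
  \<open>2 * pi * Q^6 / ln (5/3)\<close>, so \<open>modulus_of_le\<close> makes it as small as
  \<open>6 * exp (- z)\<close>; the power \<open>-6\<close> of \<open>p^2\<close> then turns into
  \<open>exp (12 * z) / 6^12\<close>. The exponent \<open>12 * z\<close> is at least
  \<open>231 * Q^6\<close>. Of this, \<open>22 * Q^6\<close> absorbs \<open>6^12 / 2\<close>, and
  the remaining 209 exceeds \<open>45 * 4.64 = 208.8\<close>.\<close>

lemma qs_K1_ge:
  assumes Q: "Q \<ge> 1" shows "step_factor Q ^ 45 \<le> qs_K1 Q"
proof -
  define lg where "lg = ln (5 / 3 :: real)"
  have lg: "0 < lg" "lg \<le> 0.512" using ln_5_3_le by (auto simp: lg_def)
  define m where "m = 1 / (8 * pi) * Q powi (-6) * lg"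
  have Q6: "Q powi (-6) = 1 / Q ^ 6" using Q by (simp add: power_int_minus inverse_eq_divide)
  have Q1: "Q ^ 6 \<ge> 1" using Q by (simp add: one_le_power)
  have m: "m > 0" unfolding m_def Q6 using Q lg by simp
  define r where "r = grotzsch_mu_inv m"
  have r: "0 < r" "r < 1" "modulus_of r = 4 * m" using grotzsch_mu_inv[OF m] by (auto simp: r_def)
  define p where "p = sqrt (1 - r\<^sup>2)"
  have p: "0 < p" "p < 1" using complementary_bounds[OF r(1,2)] by (auto simp: p_def)
  have p2: "p\<^sup>2 = 1 - r\<^sup>2" using r by (simp add: p_def power_le_one)
  define z where "z = pi\<^sup>2 * Q ^ 6 / lg"
  have "1 / (4 * m) \<le> 2 / pi * log_bound p"
    using modulus_of_le[OF p] modulus_of_complement[OF r(1,2)] r(3) by (simp add: p_def)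
  moreover have "pi / 2 * (1 / (4 * m)) = z"
    unfolding m_def Q6 z_def using Q lg by (simp add: power2_eq_square)
  ultimately have "z \<le> log_bound p"
    using mult_left_mono[of "1 / (4 * m)" "2 / pi * log_bound p" "pi / 2"] by simp
  also have "\<dots> \<le> ln (6 / p)"
  proof -
    have "(sqrt (1 + p))\<^sup>2 \<le> (1.42)\<^sup>2" using p by (simp add: power2_eq_square)
    then have "sqrt (1 + p) \<le> 1.42" by (rule power2_le_imp_le) simp
    then have "(1 + sqrt (1 + p))\<^sup>2 \<le> 2.42\<^sup>2" using p by (intro power_mono) auto
    then have "(1 + sqrt (1 + p))\<^sup>2 / p \<le> 6 / p" using p by (intro divide_right_mono) (auto simp: power2_eq_square)
    then show ?thesis unfolding log_bound_def
      using p by (intro ln_mono) (auto intro!: divide_pos_pos zero_less_power add_pos_nonneg)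
  qed
  finally have "exp z \<le> 6 / p" using p by (simp add: ln_ge_iff)
  then have "exp z / 6 \<le> 1 / p" by simp
  then have "(exp z / 6) ^ 12 \<le> (1 / p) ^ 12" by (intro power_mono) auto
  also have "(1 / p) ^ 12 = (1 - r\<^sup>2) powi (-6)"
  proof -
    have "p ^ 12 = (p\<^sup>2) ^ 6" by (simp flip: power_mult)
    then show ?thesis unfolding p2 by (simp add: power_int_minus inverse_eq_divide power_divide)
  qed
  also have "2 * (1 - r\<^sup>2) powi (-6) = qs_K1 Q"
    unfolding qs_K1_def r_def m_def lg_def ..
  finally have K1: "2 * (exp z / 6) ^ 12 \<le> qs_K1 Q" by simp
  \<comment> \<open>Tight: \<open>12 * 3.14^2\<close> is about 118.32, and
    \<open>231 * 0.512\<close> is about 118.27.\<close>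
  have z: "231 * Q ^ 6 \<le> 12 * z"
  proof -
    have "(314 / 100)\<^sup>2 \<le> pi\<^sup>2" by (rule power_mono[OF pi_ge_314]) simp
    then have "231 * lg \<le> 12 * pi\<^sup>2" using lg by (simp add: power2_eq_square)
    then have "231 \<le> 12 * pi\<^sup>2 / lg" using lg by (simp add: le_divide_eq)
    from mult_right_mono[OF this, of "Q ^ 6"] Q1 show ?thesis by (simp add: z_def)
  qed
  have "(2.7 :: real) \<le> (1 + 1/8 + (1/8)\<^sup>2 / 2) ^ 8" by (simp add: power2_eq_square eval_nat_numeral)
  also have "\<dots> \<le> exp (1/8) ^ 8" by (rule power_mono[OF exp_lower_Taylor_quadratic]) auto
  also have "\<dots> = exp 1" by (simp flip: exp_of_nat_mult)
  finally have "(2.7 :: real) ^ 22 \<le> exp 1 ^ 22" by (rule power_mono) simp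
  then have "(6 ^ 12 / 2 :: real) \<le> exp 1 ^ 22" by (rule order_trans[rotated]) (simp add: power_divide)
  also have "exp 1 ^ 22 = exp (22 :: real)" by (simp flip: exp_of_nat_mult)
  also have "\<dots> \<le> exp (22 * Q ^ 6)" using Q1 by simp
  finally have e22: "6 ^ 12 / 2 \<le> exp (22 * Q ^ 6)" .
  have "step_factor Q ^ 45 = exp (208.8 * Q ^ 6)"
    unfolding step_factor_def by (simp flip: exp_of_nat_mult)
  also have "\<dots> \<le> exp (209 * Q ^ 6)" using Q1 by simp
  also have "\<dots> = exp (231 * Q ^ 6) / exp (22 * Q ^ 6)" by (simp flip: exp_diff)
  also have "\<dots> \<le> exp (231 * Q ^ 6) / (6 ^ 12 / 2)"
    using e22 by (intro divide_left_mono) auto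
  also have "\<dots> \<le> exp (12 * z) / (6 ^ 12 / 2)"
    using z by (intro divide_right_mono) auto
  also have "\<dots> = 2 * (exp z / 6) ^ 12"
    by (simp add: power_divide flip: exp_of_nat_mult)
  also note K1
  finally show ?thesis .
qed

section \<open>Continued fractions and rotation orbits\<close>

text \<open>Every \<open>N \<ge> 20\<close> is of the form \<open>5 a + 6 b\<close>, which is what the six-colouring of the orbit needs.\<close>

definition rotation_scale :: "real \<Rightarrow> nat \<Rightarrow> real \<Rightarrow> real \<Rightarrow> bool" where
  "rotation_scale \<rho> N s g \<longleftrightarrow> 20 \<le> N \<and> 0 < s \<and> 5 * s < 1 \<and> s \<le> g \<and> g \<le> 2 * s \<and>
     (\<forall>j p. 0 < j \<longrightarrow> j < N \<longrightarrow> s \<le> \<bar>real j * \<rho> - of_int p\<bar>) \<and>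
     (\<forall>y. \<exists>j l. j < N \<and> y \<le> real j * \<rho> + of_int l \<and> real j * \<rho> + of_int l \<le> y + g)"

text \<open>The \<open>x n\<close> are the tails of the expansion,
  \<open>x n = 1 / (a n + x (n + 1))\<close>. The locale is instantiated twice: with the Gauss map
  for an arbitrary irrational, and with the limits of the tails of a given expansion.\<close>

locale cfrac_data =
  fixes \<rho> :: real and a :: "nat \<Rightarrow> nat" and x :: "nat \<Rightarrow> real" and z :: int
  assumes x_pos: "n \<ge> 1 \<Longrightarrow> 0 < x n" and x_less: "n \<ge> 1 \<Longrightarrow> x n < 1"
    and a_pos: "n \<ge> 1 \<Longrightarrow> a n \<ge> 1"
    and step: "n \<ge> 1 \<Longrightarrow> x n * (real (a n) + x (Suc n)) = 1"
    and rho: "\<rho> = x 1 + of_int z"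
begin

text \<open>By \<open>theta\<close> this product of tails is the distance between
  \<open>Q n * x 1\<close> and \<open>P n\<close>.\<close>

definition dist_seq :: "nat \<Rightarrow> real" where "dist_seq n = (\<Prod>i\<in>{1..n}. x i)"

lemma dist_0 [simp]: "dist_seq 0 = 1" by (simp add: dist_seq_def)

lemma dist_Suc: "dist_seq (Suc n) = dist_seq n * x (Suc n)" by (simp add: dist_seq_def)

lemma dist_pos: "0 < dist_seq n" unfolding dist_seq_def by (intro prod_pos) (auto simp: x_pos)

lemma dist_decreasing: "dist_seq (Suc n) < dist_seq n"
  using dist_pos[of n] x_less[of "Suc n"] by (simp add: dist_Suc)

lemma dist_rec: "dist_seq n = real (a (Suc n)) * dist_seq (Suc n) + dist_seq (Suc (Suc n))"
proof -
  have "real (a (Suc n)) * dist_seq (Suc n) + dist_seq (Suc (Suc n))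
      = dist_seq n * (x (Suc n) * (real (a (Suc n)) + x (Suc (Suc n))))"
    by (simp add: dist_Suc algebra_simps)
  then show ?thesis using step[of "Suc n"] by simp
qed

lemma dist_half: "2 * dist_seq (Suc (Suc n)) \<le> dist_seq n"
proof -
  have "1 * dist_seq (Suc n) \<le> real (a (Suc n)) * dist_seq (Suc n)"
    using a_pos[of "Suc n"] dist_pos[of "Suc n"] by (intro mult_right_mono) auto
  then show ?thesis using dist_rec[of n] dist_decreasing[of "Suc n"] by linarith
qed

lemma dist_antimono: "m \<le> n \<Longrightarrow> dist_seq n \<le> dist_seq m"
  by (rule lift_Suc_antimono_le[of dist_seq]) (use dist_decreasing in \<open>auto intro: less_imp_le\<close>)

lemma dist_tendsto_0: "dist_seq \<longlonglongrightarrow> 0"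
proof (rule LIMSEQ_I)
  fix r :: real assume r: "0 < r"
  have pow: "dist_seq (2 * n) \<le> (1 / 2) ^ n" for n
  proof (induction n)
    case (Suc n)
    have "dist_seq (2 * Suc n) \<le> dist_seq (2 * n) / 2" using dist_half[of "2 * n"] by simp
    then show ?case using Suc by simp
  qed simp
  obtain n where n: "(1 / 2) ^ n < r" using real_arch_pow_inv[OF r, of "1/2"] by auto
  have "norm (dist_seq m - 0) < r" if "m \<ge> 2 * n" for m
    using dist_antimono[OF that] pow[of n] n dist_pos[of m] by simp
  then show "\<exists>no. \<forall>m\<ge>no. norm (dist_seq m - 0) < r" by blast
qed

text \<open>The continuants, shifted by one: index 0 is the formal pair \<open>1 / 0\<close>, index
  1 the convergent \<open>0 / 1\<close>, index 2 the convergent \<open>1 / a 1\<close>.\<close>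

fun Q P :: "nat \<Rightarrow> int" where
  "Q 0 = 0" | "Q (Suc 0) = 1" | "Q (Suc (Suc n)) = int (a (Suc n)) * Q (Suc n) + Q n"
| "P 0 = 1" | "P (Suc 0) = 0" | "P (Suc (Suc n)) = int (a (Suc n)) * P (Suc n) + P n"

lemma theta: "of_int (Q n) * x 1 - of_int (P n) = (- 1) ^ Suc n * dist_seq n
    \<and> of_int (Q (Suc n)) * x 1 - of_int (P (Suc n)) = (- 1) ^ n * dist_seq (Suc n)"
proof (induction n)
  case 0 then show ?case by (simp add: dist_Suc)
next
  case (Suc n)
  have "of_int (Q (Suc (Suc n))) * x 1 - of_int (P (Suc (Suc n)))
     = real (a (Suc n)) * (of_int (Q (Suc n)) * x 1 - of_int (P (Suc n))) + (of_int (Q n) * x 1 - of_int (P n))"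
    by (simp add: algebra_simps)
  also have "\<dots> = (- 1) ^ Suc n * (dist_seq n - real (a (Suc n)) * dist_seq (Suc n))"
    using Suc by (simp add: algebra_simps)
  also have "dist_seq n - real (a (Suc n)) * dist_seq (Suc n) = dist_seq (Suc (Suc n))"
    using dist_rec[of n] by simp
  finally show ?case using Suc by simp
qed

lemma det: "Q (Suc n) * P n - Q n * P (Suc n) = (- 1) ^ n"
proof (induction n)
  case (Suc n)
  have "Q (Suc (Suc n)) * P (Suc n) - Q (Suc n) * P (Suc (Suc n)) = - (Q (Suc n) * P n - Q n * P (Suc n))"
    by (simp add: algebra_simps)
  then show ?case using Suc by simp
qed simp

lemma Q_pos: "n \<ge> 1 \<Longrightarrow> Q n \<ge> 1 \<and> Q (Suc n) \<ge> Q n"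
proof (induction n rule: nat_induct_at_least)
  case base
  then show ?case using a_pos[of 1] by simp
next
  case (Suc n)
  have "1 * Q (Suc n) \<le> int (a (Suc n)) * Q (Suc n)"
    using a_pos[of "Suc n"] Suc by (intro mult_right_mono) auto
  then have "Q (Suc n) \<le> int (a (Suc n)) * Q (Suc n) + Q n" using Suc by linarith
  then show ?case using Suc by simp
qed

lemma Q_nonneg: "Q n \<ge> 0"
  using Q_pos[of n] by (cases n) auto

text \<open>The total length of the dynamical partition of the circle: \<open>Q (Suc n)\<close> arcs
  of length \<open>dist_seq n\<close> and \<open>Q n\<close> arcs of length
  \<open>dist_seq (Suc n)\<close>.\<close>

lemma measure_identity: "of_int (Q (Suc n)) * dist_seq n + of_int (Q n) * dist_seq (Suc n) = 1"
proof (induction n)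
  case (Suc n)
  have "of_int (Q (Suc (Suc n))) * dist_seq (Suc n) + of_int (Q (Suc n)) * dist_seq (Suc (Suc n))
    = of_int (Q (Suc n)) * (real (a (Suc n)) * dist_seq (Suc n) + dist_seq (Suc (Suc n))) + of_int (Q n) * dist_seq (Suc n)"
    by (simp add: algebra_simps)
  then show ?case using Suc dist_rec[of n] by simp
qed simp

text \<open>Since the determinant is 1 or -1, \<open>(j, p)\<close> is an integral combination of
  two consecutive convergents with coefficients \<open>\<alpha>\<close>, \<open>\<beta>\<close>. The
  range of \<open>j\<close> forces opposite signs unless \<open>\<beta> = 0\<close>; the two errors
  have opposite signs as well, so the contributions add up instead of cancelling.\<close>

lemma best_approximation:
  assumes n: "n \<ge> 1" and j: "0 < j" "j < Q (Suc n)"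
  shows "dist_seq n \<le> \<bar>of_int j * x 1 - of_int p\<bar>"
proof -
  define e :: int where "e = (- 1) ^ n"
  define \<alpha> where "\<alpha> = e * (p * Q (Suc n) - j * P (Suc n))"
  define \<beta> where "\<beta> = e * (j * P n - p * Q n)"
  have e2: "e * e = 1" by (simp add: e_def flip: power_mult_distrib)
  have det': "Q (Suc n) * P n - Q n * P (Suc n) = e" using det by (simp add: e_def)
  have "\<alpha> * Q n + \<beta> * Q (Suc n) = e * j * (Q (Suc n) * P n - Q n * P (Suc n))"
    unfolding \<alpha>_def \<beta>_def by (simp only: algebra_simps)
  then have jeq: "j = \<alpha> * Q n + \<beta> * Q (Suc n)"
    unfolding det' using e2 by (simp add: mult.commute mult.left_commute)
  have "\<alpha> * P n + \<beta> * P (Suc n) = e * p * (Q (Suc n) * P n - Q n * P (Suc n))"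
    unfolding \<alpha>_def \<beta>_def by (simp only: algebra_simps)
  then have peq: "p = \<alpha> * P n + \<beta> * P (Suc n)"
    unfolding det' using e2 by (simp add: mult.commute mult.left_commute)
  have "of_int j * x 1 - of_int p = of_int \<alpha> * (of_int (Q n) * x 1 - of_int (P n))
      + of_int \<beta> * (of_int (Q (Suc n)) * x 1 - of_int (P (Suc n)))"
    by (subst jeq, subst peq) (simp add: algebra_simps)
  also have "\<dots> = (- 1) ^ n * (of_int \<beta> * dist_seq (Suc n) - of_int \<alpha> * dist_seq n)"
    unfolding theta[of n, THEN conjunct1] theta[of n, THEN conjunct2] by (simp add: algebra_simps)
  finally have val: "\<bar>of_int j * x 1 - of_int p\<bar> = \<bar>of_int \<beta> * dist_seq (Suc n) - of_int \<alpha> * dist_seq n\<bar>"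
    by (simp add: abs_mult)
  have Qn: "Q n \<ge> 1" "Q (Suc n) \<ge> 1" using Q_pos[OF n] by auto
  note d = dist_pos[of n] dist_pos[of "Suc n"]
  have ge: "dist_seq n \<le> of_int t * dist_seq n" if "t \<ge> 1" for t :: int
    using mult_right_mono[of 1 "of_int t" "dist_seq n"] that d by simp
  consider "\<beta> = 0" | "\<beta> \<ge> 1" | "\<beta> \<le> - 1" by linarith
  then show ?thesis
  proof cases
    case 1
    then have "\<alpha> \<noteq> 0" using jeq j by auto
    then have "\<bar>\<alpha>\<bar> \<ge> 1" by simp
    from ge[OF this] show ?thesis unfolding val 1 using d by (simp add: abs_mult)
  next
    case 2
    then have b: "Q (Suc n) \<le> \<beta> * Q (Suc n)" using Qn by simp
    have "\<alpha> \<le> - 1"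
    proof (rule ccontr)
      assume "\<not> \<alpha> \<le> - 1"
      then have "0 \<le> \<alpha> * Q n" using Qn by simp
      then show False using jeq b j by linarith
    qed
    then have "dist_seq n \<le> of_int (- \<alpha>) * dist_seq n" by (intro ge) simp
    moreover have "0 \<le> of_int \<beta> * dist_seq (Suc n)" using 2 d by simp
    ultimately show ?thesis unfolding val by simp
  next
    case 3
    then have b: "\<beta> * Q (Suc n) \<le> 0" using Qn by (simp add: mult_nonpos_nonneg)
    have "\<alpha> \<ge> 1"
    proof (rule ccontr)
      assume "\<not> \<alpha> \<ge> 1"
      then have "\<alpha> * Q n \<le> 0" using Qn by (simp add: mult_nonpos_nonneg)
      then show False using jeq b j by linarith
    qed
    then have "dist_seq n \<le> of_int \<alpha> * dist_seq n" by (rule ge)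
    moreover have "of_int \<beta> * dist_seq (Suc n) \<le> 0" using 3 d by (simp add: mult_nonpos_nonneg)
    ultimately show ?thesis unfolding val by simp
  qed
qed

text \<open>Changing the index by \<open>Q n\<close> moves the point right by
  \<open>dist_seq n\<close>, for the proper sign \<open>e\<close>. If the index leaves its range, a
  correction by \<open>Q (Suc n)\<close> brings it back and adds \<open>dist_seq (Suc n)\<close> to
  the move.\<close>

lemma next_orbit_point:
  assumes n: "n \<ge> 1" and j: "0 \<le> j" "j < Q (Suc n)"
  shows "\<exists>j' l'. 0 \<le> j' \<and> j' < Q (Suc n) \<and>
     dist_seq n \<le> (of_int j' * x 1 + of_int l') - (of_int j * x 1 + of_int l) \<and>
     (of_int j' * x 1 + of_int l') - (of_int j * x 1 + of_int l) \<le> dist_seq n + dist_seq (Suc n)"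
proof -
  define e :: int where "e = (- 1) ^ Suc n"
  have e: "e = 1 \<or> e = - 1" by (auto simp: e_def minus_one_power_iff)
  have th: "of_int (Q n) * x 1 - of_int (P n) = of_int e * dist_seq n"
    "of_int (Q (Suc n)) * x 1 - of_int (P (Suc n)) = - of_int e * dist_seq (Suc n)"
    using theta[of n] by (simp_all add: e_def)
  have Qn: "Q n \<ge> 1" "Q (Suc n) \<ge> Q n" using Q_pos[OF n] by auto
  note d = dist_pos[of n] dist_pos[of "Suc n"]
  show ?thesis
  proof (cases "0 \<le> j + e * Q n \<and> j + e * Q n < Q (Suc n)")
    case True
    have "(of_int (j + e * Q n) * x 1 + of_int (l - e * P n)) - (of_int j * x 1 + of_int l)
        = of_int e * (of_int (Q n) * x 1 - of_int (P n))" by (simp add: algebra_simps)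
    also have "\<dots> = dist_seq n" unfolding th using e by auto
    finally show ?thesis using True d by (intro exI[of _ "j + e * Q n"] exI[of _ "l - e * P n"]) simp
  next
    case False
    then have r: "0 \<le> j + e * Q n - e * Q (Suc n)" "j + e * Q n - e * Q (Suc n) < Q (Suc n)"
      using e j Qn by auto
    have "(of_int (j + e * Q n - e * Q (Suc n)) * x 1 + of_int (l - e * P n + e * P (Suc n))) - (of_int j * x 1 + of_int l)
        = of_int e * (of_int (Q n) * x 1 - of_int (P n)) - of_int e * (of_int (Q (Suc n)) * x 1 - of_int (P (Suc n)))"
      by (simp add: algebra_simps)
    also have "\<dots> = dist_seq n + dist_seq (Suc n)" unfolding th using e by auto
    finally show ?thesis using r d
      by (intro exI[of _ "j + e * Q n - e * Q (Suc n)"] exI[of _ "l - e * P n + e * P (Suc n)"]) simp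
  qed
qed

text \<open>If no orbit point lay in the stated interval, the moves of
  \<open>next_orbit_point\<close>, too short to jump over it, would never pass \<open>y\<close>; but
  each advances by at least \<open>dist_seq n\<close>.\<close>

lemma covering:
  assumes n: "n \<ge> 1"
  shows "\<exists>j l. 0 \<le> j \<and> j < Q (Suc n) \<and> y \<le> of_int j * x 1 + of_int l \<and>
    of_int j * x 1 + of_int l \<le> y + (dist_seq n + dist_seq (Suc n))"
proof (rule ccontr)
  assume no: "\<not> ?thesis"
  have Qn: "Q (Suc n) \<ge> 1" using Q_pos[OF n] by simp
  have "\<exists>j l. 0 \<le> j \<and> j < Q (Suc n) \<and> of_int j * x 1 + of_int l < y \<and>
      of_int j * x 1 + of_int l \<ge> of_int (\<lfloor>y\<rfloor> - 1) + real k * dist_seq n" for k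
  proof (induction k)
    case 0
    \<comment> \<open>The offset \<open>- 1\<close> keeps the starting point strictly below
      \<open>y\<close> even if \<open>y\<close> is an integer.\<close>
    show ?case using Qn by (intro exI[of _ 0] exI[of _ "\<lfloor>y\<rfloor> - 1"]) (auto, linarith)
  next
    case (Suc k)
    then obtain j l where jl: "0 \<le> j" "j < Q (Suc n)" "of_int j * x 1 + of_int l < y"
      "of_int j * x 1 + of_int l \<ge> of_int (\<lfloor>y\<rfloor> - 1) + real k * dist_seq n" by blast
    obtain j' l' where j': "0 \<le> j'" "j' < Q (Suc n)"
      "dist_seq n \<le> (of_int j' * x 1 + of_int l') - (of_int j * x 1 + of_int l)"
      "(of_int j' * x 1 + of_int l') - (of_int j * x 1 + of_int l) \<le> dist_seq n + dist_seq (Suc n)"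
      using next_orbit_point[OF n jl(1,2), of l] by blast
    have "\<not> y \<le> of_int j' * x 1 + of_int l'"
    proof
      assume "y \<le> of_int j' * x 1 + of_int l'"
      moreover have "of_int j' * x 1 + of_int l' \<le> y + (dist_seq n + dist_seq (Suc n))"
        using j'(4) jl(3) by linarith
      ultimately show False using no j'(1,2) by blast
    qed
    moreover have "of_int (\<lfloor>y\<rfloor> - 1) + real (Suc k) * dist_seq n \<le> of_int j' * x 1 + of_int l'"
      using j'(3) jl(4) by (simp add: algebra_simps)
    ultimately show ?case using j'(1,2) by (intro exI[of _ j'] exI[of _ l']) simp
  qed
  moreover obtain k where "2 < real k * dist_seq n"
    using reals_Archimedean3[OF dist_pos[of n]] by blast
  ultimately have "of_int (\<lfloor>y\<rfloor> - 1) + 2 < y" by (metis add_strict_left_mono le_less_trans order_less_trans)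
  then show False by linarith
qed

text \<open>Here \<open>s\<close> is the least spacing of the first \<open>N\<close> orbit points
  and \<open>g\<close> bounds their gaps. By \<open>measure_identity\<close> the product of
  \<open>N\<close> and \<open>g\<close> is at least 1, so the threshold \<open>1 / 20\<close> yields
  the \<open>N >= 20\<close> that the colouring requires.\<close>

lemma rotation_scale_dist_seq:
  assumes n: "n \<ge> 1" and small: "dist_seq n + dist_seq (Suc n) \<le> 1 / 20"
  shows "rotation_scale \<rho> (nat (Q (Suc n))) (dist_seq n) (dist_seq n + dist_seq (Suc n))"
proof -
  note d = dist_pos[of n] dist_pos[of "Suc n"] dist_decreasing[of n]
  have QQ: "real_of_int (Q n) \<le> of_int (Q (Suc n))" using Q_pos[OF n] by simp
  have "of_int (Q n) * dist_seq (Suc n) \<le> of_int (Q (Suc n)) * dist_seq (Suc n)"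
    by (rule mult_right_mono[OF QQ]) (use d in simp)
  then have "1 \<le> of_int (Q (Suc n)) * (dist_seq n + dist_seq (Suc n))"
    using measure_identity[of n] unfolding distrib_left by linarith
  also have "\<dots> \<le> of_int (Q (Suc n)) * (1 / 20)"
    using small Q_nonneg[of "Suc n"] by (intro mult_left_mono) auto
  finally have N: "20 \<le> Q (Suc n)" by simp
  have "dist_seq n \<le> \<bar>real j * \<rho> - of_int p\<bar>" if "0 < j" "j < nat (Q (Suc n))" for j p
  proof -
    have e: "real j * \<rho> - of_int p = of_int (int j) * x 1 - of_int (p - int j * z)"
      by (simp add: rho algebra_simps)
    have "0 < int j" "int j < Q (Suc n)" using that by linarith+
    then show ?thesis unfolding e by (rule best_approximation[OF n])
  qed
  moreover have "\<exists>j l. j < nat (Q (Suc n)) \<and> y \<le> real j * \<rho> + of_int l \<and>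
      real j * \<rho> + of_int l \<le> y + (dist_seq n + dist_seq (Suc n))" for y
  proof -
    obtain j l where jl: "0 \<le> j" "j < Q (Suc n)" "y \<le> of_int j * x 1 + of_int l"
      "of_int j * x 1 + of_int l \<le> y + (dist_seq n + dist_seq (Suc n))" using covering[OF n] by blast
    have E: "real (nat j) * \<rho> + of_int (l - j * z) = of_int j * x 1 + of_int l"
      using jl(1) by (simp add: rho algebra_simps)
    have "nat j < nat (Q (Suc n))" using jl by simp
    then show ?thesis using jl(3,4) unfolding E[symmetric] by blast
  qed
  moreover have "20 \<le> nat (Q (Suc n))" using N by linarith
  moreover have "5 * dist_seq n < 1" "dist_seq n \<le> dist_seq n + dist_seq (Suc n)"
    "dist_seq n + dist_seq (Suc n) \<le> 2 * dist_seq n" using d small by linarith+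
  ultimately show ?thesis unfolding rotation_scale_def using d(1) by simp
qed

end

section \<open>Fine scales for irrational numbers and for numbers of bounded type\<close>

lemma irrational_frac_inverse:
  assumes "y \<notin> \<rat>" shows "frac y \<notin> \<rat>" "0 < frac y" "frac y < 1" "1 / y \<notin> \<rat>"
proof -
  have "y = frac y + of_int \<lfloor>y\<rfloor>" by (simp add: frac_def)
  then show 1: "frac y \<notin> \<rat>" using assms by (metis Rats_add Rats_of_int)
  show "0 < frac y" using 1 frac_ge_0[of y] by (metis Rats_0 order_le_less)
  show "frac y < 1" by (rule frac_lt_1)
  show "1 / y \<notin> \<rat>" using assms Rats_inverse[of "1 / y"] by (auto simp: inverse_eq_divide)
qed

lemma rotation_scale_exists:
  assumes irr: "\<rho> \<notin> \<rat>" and e: "\<epsilon> > 0"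
  obtains N s g where "rotation_scale \<rho> N s g" "g < \<epsilon>"
proof -
  \<comment> \<open>The Gauss map orbit of the fractional part. It starts at index 0, whereas tails
    start at 1; hence the shift \<open>n - 1\<close> below.\<close>
  define y where "y = rec_nat (frac \<rho>) (\<lambda>_ t. frac (1 / t))"
  have y0: "y 0 = frac \<rho>" and yS: "y (Suc n) = frac (1 / y n)" for n by (simp_all add: y_def)
  have yirr: "y n \<notin> \<rat>" for n
    by (induction n) (simp_all add: y0 yS irrational_frac_inverse irr)
  have y01: "0 < y n \<and> y n < 1" for n
    by (cases n) (use irrational_frac_inverse[OF irr] irrational_frac_inverse(2,3)[OF irrational_frac_inverse(4)[OF yirr]] in \<open>auto simp: y0 yS\<close>)
  interpret cfrac_data \<rho> "\<lambda>n. nat \<lfloor>1 / y (n - 1)\<rfloor>" "\<lambda>n. y (n - 1)" "\<lfloor>\<rho>\<rfloor>"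
  proof
    fix n :: nat assume n: "n \<ge> 1"
    show "0 < y (n - 1)" "y (n - 1) < 1" using y01 by auto
    have ge: "1 \<le> \<lfloor>1 / y (n - 1)\<rfloor>" using y01[of "n - 1"] by (simp add: le_floor_iff)
    then show "1 \<le> nat \<lfloor>1 / y (n - 1)\<rfloor>" by linarith
    have "y (Suc n - 1) = frac (1 / y (n - 1))" using yS[of "n - 1"] n by simp
    moreover have "real (nat \<lfloor>1 / y (n - 1)\<rfloor>) = of_int \<lfloor>1 / y (n - 1)\<rfloor>" using ge by (simp only: of_nat_nat)
    ultimately have "real (nat \<lfloor>1 / y (n - 1)\<rfloor>) + y (Suc n - 1) = 1 / y (n - 1)" by (simp only: frac_def)
    then show "y (n - 1) * (real (nat \<lfloor>1 / y (n - 1)\<rfloor>) + y (Suc n - 1)) = 1" using y01[of "n - 1"] by simp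
  next
    show "\<rho> = y (1 - 1) + of_int \<lfloor>\<rho>\<rfloor>" by (simp add: y0 frac_def)
  qed
  have "(\<lambda>n. dist_seq n + dist_seq (Suc n)) \<longlonglongrightarrow> 0 + 0"
    by (intro tendsto_add dist_tendsto_0 LIMSEQ_Suc)
  from order_tendstoD(2)[OF this, of "min \<epsilon> (1/20)"] e
  have "eventually (\<lambda>n. dist_seq n + dist_seq (Suc n) < min \<epsilon> (1/20)) sequentially" by simp
  then obtain M where M: "\<And>n. n \<ge> M \<Longrightarrow> dist_seq n + dist_seq (Suc n) < min \<epsilon> (1/20)"
    unfolding eventually_sequentially by blast
  have "dist_seq (Suc M) + dist_seq (Suc (Suc M)) < min \<epsilon> (1/20)" by (rule M) simp
  then have lt: "dist_seq (Suc M) + dist_seq (Suc (Suc M)) < \<epsilon>"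
    "dist_seq (Suc M) + dist_seq (Suc (Suc M)) \<le> 1/20" by linarith+
  show thesis by (rule that[OF rotation_scale_dist_seq[OF _ lt(2)] lt(1)]) simp
qed

lemma cfrac_convergent_bounds: "(\<And>n. n \<ge> k \<Longrightarrow> a n \<ge> 1) \<Longrightarrow> 0 \<le> cfrac_convergent a k m \<and> cfrac_convergent a k m \<le> 1"
proof (induction m arbitrary: k)
  case (Suc m)
  have "0 \<le> cfrac_convergent a (Suc k) m" using Suc.IH[of "Suc k"] Suc.prems by auto
  moreover have "1 \<le> real (a k)" using Suc.prems[of k] by simp
  ultimately show ?case by (simp add: divide_le_eq)
qed simp

text \<open>Only the whole expansion is assumed to converge. The recursion is inverted to pass the
  limit from one tail to the next; irrationality is carried along, so that no limit is 0 or 1 and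
  the bounds become strict.\<close>

lemma cfrac_tail_limits:
  assumes cf: "has_cfrac \<rho> a" and irr: "\<rho> \<notin> \<rat>"
  shows "cfrac_data \<rho> a (\<lambda>n. lim (cfrac_convergent a n)) 0"
proof -
  have apos: "a n \<ge> 1" if "n \<ge> 1" for n using cf that by (auto simp: has_cfrac_def)
  have lim1: "cfrac_convergent a 1 \<longlonglongrightarrow> \<rho>" using cf by (simp add: has_cfrac_def)
  have nxt: "cfrac_convergent a (Suc n) \<longlonglongrightarrow> 1 / L - real (a n) \<and> 1 / L - real (a n) \<notin> \<rat>"
    if L: "cfrac_convergent a n \<longlonglongrightarrow> L" "L \<notin> \<rat>" for n L
  proof
    have L0: "L \<noteq> 0" using L(2) by auto
    have "(\<lambda>m. 1 / cfrac_convergent a n (Suc m) - real (a n)) \<longlonglongrightarrow> 1 / L - real (a n)"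
      by (intro tendsto_intros LIMSEQ_Suc L L0)
    then show "cfrac_convergent a (Suc n) \<longlonglongrightarrow> 1 / L - real (a n)" by simp
    show "1 / L - real (a n) \<notin> \<rat>"
      using irrational_frac_inverse(4)[OF L(2)] Rats_add[of "1 / L - real (a n)" "real (a n)"] by auto
  qed
  have ex: "\<exists>L. cfrac_convergent a n \<longlonglongrightarrow> L \<and> L \<notin> \<rat>" if "n \<ge> 1" for n
    using that
  proof (induction n rule: nat_induct_at_least)
    case base then show ?case using lim1 irr by auto
  next
    case (Suc n) then show ?case using nxt by blast
  qed
  define x where "x n = lim (cfrac_convergent a n)" for n
  have x: "cfrac_convergent a n \<longlonglongrightarrow> x n" "x n \<notin> \<rat>" if "n \<ge> 1" for n
    using ex[OF that] by (auto simp: x_def limI)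
  have xr: "0 \<le> x n" "x n \<le> 1" if n: "n \<ge> 1" for n
  proof -
    have b: "0 \<le> cfrac_convergent a n m \<and> cfrac_convergent a n m \<le> 1" for m
      by (rule cfrac_convergent_bounds) (use n apos in auto)
    show "0 \<le> x n" by (rule LIMSEQ_le_const[OF x(1)[OF n]]) (use b in auto)
    show "x n \<le> 1" by (rule LIMSEQ_le_const2[OF x(1)[OF n]]) (use b in auto)
  qed
  have "cfrac_data \<rho> a x 0"
  proof
    fix n :: nat assume n: "n \<ge> 1"
    have ne: "x n \<noteq> 0" "x n \<noteq> 1" using x(2)[OF n] by (metis Rats_0, metis Rats_1)
    then show "0 < x n" "x n < 1" using xr[OF n] by auto
    show "a n \<ge> 1" using apos n .
    have "x (Suc n) = 1 / x n - real (a n)"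
      by (rule LIMSEQ_unique[OF x(1) conjunct1[OF nxt[OF x[OF n]]]]) simp
    then show "x n * (real (a n) + x (Suc n)) = 1" using ne by simp
  next
    show "\<rho> = x 1 + of_int 0" using LIMSEQ_unique[OF lim1 x(1)[of 1]] by simp
  qed
  then show ?thesis unfolding x_def .
qed

lemma bounded_type_scales:
  assumes cf: "has_cfrac \<rho> a" and irr: "\<rho> \<notin> \<rat>" and B: "\<And>n. n \<ge> 1 \<Longrightarrow> a n \<le> B"
  obtains d :: "nat \<Rightarrow> real" where "d 0 = 1" "\<And>n. 0 < d n" "\<And>n. d (Suc n) < d n"
    "\<And>n. d n \<le> real B * d (Suc n) + d (Suc (Suc n))" "d \<longlonglongrightarrow> 0"
    "\<And>n. n \<ge> 1 \<Longrightarrow> d n + d (Suc n) \<le> 1 / 20 \<Longrightarrow> \<exists>N. rotation_scale \<rho> N (d n) (d n + d (Suc n))"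
proof -
  interpret cfrac_data \<rho> a "\<lambda>n. lim (cfrac_convergent a n)" 0 by (rule cfrac_tail_limits[OF cf irr])
  show thesis
  proof (rule that[of dist_seq])
    show "dist_seq n \<le> real B * dist_seq (Suc n) + dist_seq (Suc (Suc n))" for n
      using dist_rec[of n] mult_right_mono[of "real (a (Suc n))" "real B" "dist_seq (Suc n)"]
        B[of "Suc n"] dist_pos[of "Suc n"] by simp
    show "\<exists>N. rotation_scale \<rho> N (dist_seq n) (dist_seq n + dist_seq (Suc n))"
      if "n \<ge> 1" "dist_seq n + dist_seq (Suc n) \<le> 1 / 20" for n
      using rotation_scale_dist_seq[OF that] by blast
  qed (simp_all add: dist_pos dist_decreasing dist_tendsto_0)
qed

section \<open>Lifts of circle homeomorphisms\<close>

lemma cis_2pi_eq_iff: "cis (2 * pi * x) = cis (2 * pi * y) \<longleftrightarrow> (\<exists>n::int. x = y + of_int n)"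
proof -
  have "cis (2 * pi * x) = cis (2 * pi * y) \<longleftrightarrow> sin (2 * pi * x) = sin (2 * pi * y) \<and> cos (2 * pi * x) = cos (2 * pi * y)"
    by (auto simp: complex_eq_iff)
  also have "\<dots> \<longleftrightarrow> (\<exists>n::int. 2 * pi * x = 2 * pi * y + 2 * pi * of_int n)"
    by (rule sin_cos_eq_iff)
  also have "\<dots> \<longleftrightarrow> (\<exists>n::int. x = y + of_int n)"
  proof -
    have "2 * pi * x = 2 * pi * y + 2 * pi * t \<longleftrightarrow> x = y + t" for t
    proof -
      have "2 * pi * x = 2 * pi * y + 2 * pi * t \<longleftrightarrow> 2 * pi * x = 2 * pi * (y + t)" by (simp only: distrib_left)
      then show ?thesis by simp
    qed
    then show ?thesis by simp
  qed
  finally show ?thesis .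
qed

lemma periodic_of_int:
  fixes f :: "real \<Rightarrow> real"
  assumes per: "\<And>x. f (x + 1) = f x + 1"
  shows "f (x + of_int n) = f x + of_int n"
proof -
  have nat: "f (x + of_nat m) = f x + of_nat m" for x m
  proof (induction m)
    case (Suc m)
    have "f (x + of_nat (Suc m)) = f ((x + of_nat m) + 1)" by (simp add: add_ac)
    also have "\<dots> = f (x + of_nat m) + 1" by (rule per)
    finally show ?case using Suc by simp
  qed simp
  show ?thesis
  proof (cases "n \<ge> 0")
    case True
    then obtain m where "n = int m" using zero_le_imp_eq_int by blast
    then show ?thesis using nat by simp
  next
    case False
    then obtain m where m: "- n = int m" using zero_le_imp_eq_int[of "- n"] by auto
    then have "n = - int m" by simp
    then show ?thesis using nat[of "x - of_nat m" m] by simp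
  qed
qed

text \<open>Equal values of \<open>f\<close> give arguments that differ by an integer, which
  periodicity forces to be 0. A continuous injection of the line is monotone, and degree 1 excludes
  decrease.\<close>

lemma degree_one_lift_strict_mono:
  assumes "degree_one_circle_homeo_lift f" shows "strict_mono f"
proof -
  have cont: "continuous_on UNIV f" and per: "\<And>x. f (x + 1) = f x + 1"
    using assms by (auto simp: degree_one_circle_homeo_lift_def)
  obtain F F' where F: "homeomorphism (sphere (0::complex) 1) (sphere 0 1) F F'"
    "\<And>x. F (cis (2 * pi * x)) = cis (2 * pi * f x)"
    using assms unfolding degree_one_circle_homeo_lift_def by blast
  have inv: "F' (F (cis t)) = cis t" for t using F(1) by (simp add: homeomorphism_def)
  have inj: "inj_on f UNIV"
  proof (rule inj_onI)
    fix x y assume e: "f x = f y"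
    have "F' (F (cis (2 * pi * x))) = F' (F (cis (2 * pi * y)))" using F(2) e by simp
    then have "cis (2 * pi * x) = cis (2 * pi * y)" unfolding inv .
    then obtain n :: int where n: "x = y + of_int n" unfolding cis_2pi_eq_iff by blast
    then have "f x = f y + of_int n" using periodic_of_int[of f, OF per] by simp
    then show "x = y" using n e by simp
  qed
  have "strict_mono_on UNIV f \<or> strict_antimono_on UNIV f"
    using injective_eq_monotone_map[of UNIV f] cont inj by (simp add: is_interval_univ)
  moreover have "\<not> strict_antimono_on UNIV f"
  proof
    assume "strict_antimono_on UNIV f"
    then have "f (0 + 1) < f 0" by (auto simp: monotone_on_def)
    then show False using per[of 0] by simp
  qed
  ultimately show ?thesis by blast
qed

text \<open>The circle map \<open>F\<close> is defined by choosing a lift of each point, and its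
  continuity comes from its graph, which is a continuous image of the compact unit interval.
  Compactness also makes the inverse continuous.\<close>

lemma circle_homeo_lift_of_strict_mono:
  fixes h :: "real \<Rightarrow> real"
  assumes cont: "continuous_on UNIV h" and per: "\<And>x. h (x + 1) = h x + 1" and mono: "strict_mono h"
  shows "degree_one_circle_homeo_lift h"
proof -
  define e where "e x = cis (2 * pi * x)" for x
  have e_eq: "e x = e y \<longleftrightarrow> (\<exists>n::int. x = y + of_int n)" for x y unfolding e_def by (rule cis_2pi_eq_iff)
  have e_cont: "continuous_on S e" for S unfolding e_def by (intro continuous_intros)
  have e_surj: "\<exists>x\<in>{0..1}. z = e x" if z: "z \<in> sphere 0 1" for z
  proof -
    have "z = cis (Arg2pi z)" using z Arg2pi_eq[of z] by (simp add: cis_conv_exp)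
    then have "z = e (Arg2pi z / (2 * pi))" by (simp add: e_def)
    moreover have "Arg2pi z / (2 * pi) \<in> {0..1}"
      using Arg2pi_ge_0[of z] Arg2pi_lt_2pi[of z] by (simp add: divide_le_eq)
    ultimately show ?thesis by blast
  qed
  have e_img: "e ` {0..1} = sphere 0 1"
  proof
    show "e ` {0..1} \<subseteq> sphere 0 1" by (auto simp: e_def)
    show "sphere 0 1 \<subseteq> e ` {0..1}" using e_surj by blast
  qed
  have perZ: "h (x + of_int n) = h x + of_int n" for x n by (rule periodic_of_int[of h, OF per])
  have inj: "h x = h y \<Longrightarrow> x = y" for x y using mono by (simp add: strict_mono_eq)
  define F where "F z = e (h (SOME x. z = e x))" for z
  have F: "F (e x) = e (h x)" for x
  proof -
    have "e x = e (SOME y. e x = e y)" by (rule someI[of "\<lambda>y. e x = e y" x]) simp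
    then obtain n :: int where "x = (SOME y. e x = e y) + of_int n" using e_eq by blast
    then have "h x = h (SOME y. e x = e y) + of_int n" using perZ by metis
    then show ?thesis unfolding F_def using e_eq by metis
  qed
  have surj: "\<exists>x. h x = y" for y
  proof -
    define n where "n = \<lfloor>y - h 0\<rfloor>"
    have "of_int n \<le> y - h 0" "y - h 0 < of_int n + 1" unfolding n_def by linarith+
    moreover have "h (of_int n) = h 0 + of_int n" using perZ[of 0 n] by simp
    ultimately have a: "h (of_int n) \<le> y" "y \<le> h (of_int n + 1)"
      using per[of "of_int n"] by linarith+
    show ?thesis using IVT'[OF a _ continuous_on_subset[OF cont]] by auto
  qed
  have Fcont: "continuous_on (sphere 0 1) F"
  proof -
    have "(\<lambda>z. (z, F z)) ` sphere 0 1 = (\<lambda>x. (e x, e (h x))) ` {0..1}"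
      unfolding e_img[symmetric] image_image F ..
    moreover have "compact ((\<lambda>x. (e x, e (h x))) ` {0..1})"
    proof (rule compact_continuous_image)
      show "continuous_on {0..1} (\<lambda>x. (e x, e (h x)))"
        by (intro continuous_on_Pair e_cont continuous_on_compose2[OF e_cont continuous_on_subset[OF cont]]) auto
    qed simp
    ultimately have cl: "closed ((\<lambda>z. (z, F z)) ` sphere 0 1)" by (simp add: compact_imp_closed)
    show ?thesis
      by (rule continuous_from_closed_graph[OF compact_sphere[of 0 1] _ cl]) (auto simp: F_def e_def)
  qed
  have Finj: "inj_on F (sphere 0 1)"
  proof (rule inj_onI)
    fix z w assume z: "z \<in> sphere 0 1" and w: "w \<in> sphere 0 1" and eq: "F z = F w"
    obtain x y where xy: "z = e x" "w = e y" using e_surj z w by blast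
    then have "e (h x) = e (h y)" using eq F by simp
    then obtain n :: int where "h x = h y + of_int n" using e_eq by blast
    then have "h x = h (y + of_int n)" using perZ by simp
    then have "x = y + of_int n" by (rule inj)
    then show "z = w" using xy e_eq by blast
  qed
  have Fimg: "F ` sphere 0 1 = sphere 0 1"
  proof
    show "F ` sphere 0 1 \<subseteq> sphere 0 1"
      by (auto simp: F_def e_def)
    show "sphere 0 1 \<subseteq> F ` sphere 0 1"
    proof
      fix z :: complex assume "z \<in> sphere 0 1"
      then obtain y where y: "z = e y" using e_surj by blast
      obtain x where "h x = y" using surj by blast
      then have "z = F (e x)" using F y by simp
      moreover have "e x \<in> sphere 0 1" by (simp add: e_def)
      ultimately show "z \<in> F ` sphere 0 1" by blast
    qed
  qed
  obtain F' where "homeomorphism (sphere 0 1) (sphere 0 1) F F'"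
    using homeomorphism_compact[OF compact_sphere Fcont Fimg Finj] by blast
  then show ?thesis unfolding degree_one_circle_homeo_lift_def
    using cont per F by (auto simp: e_def)
qed

section \<open>Rotation number and the conjugacy defined by the orbit of 0\<close>

locale circle_lift =
  fixes f :: "real \<Rightarrow> real"
  assumes f_cont: "continuous_on UNIV f" and f_mono: "strict_mono f" and f_per: "f (x + 1) = f x + 1"
begin

lemma iter_mono: "strict_mono (f ^^ n)"
  by (induction n) (use f_mono in \<open>auto simp: strict_mono_def\<close>)

lemma iter_per: "(f ^^ n) (x + 1) = (f ^^ n) x + 1"
  by (induction n) (auto simp: f_per)

lemma iter_per_int: "(f ^^ n) (x + of_int m) = (f ^^ n) x + of_int m"
  by (rule periodic_of_int[of "f ^^ n", OF iter_per])

lemma iter_near: "\<bar>((f ^^ n) x - x) - ((f ^^ n) y - y)\<bar> \<le> 1"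
proof -
  have *: "(f ^^ n) x - x - 1 \<le> (f ^^ n) y - y" for x y
  proof -
    \<comment> \<open>The integer that moves \<open>y\<close> into the interval from
      \<open>x - 1\<close> (included) to \<open>x\<close> (excluded).\<close>
    define k where "k = \<lceil>x - y\<rceil> - 1"
    have k: "x - 1 \<le> y + of_int k" "y + of_int k < x" unfolding k_def by linarith+
    have "(f ^^ n) (x - 1) \<le> (f ^^ n) (y + of_int k)" using iter_mono[of n] k(1) by (simp add: strict_mono_less_eq)
    moreover have "(f ^^ n) x = (f ^^ n) (x - 1) + 1" using iter_per[of n "x - 1"] by simp
    ultimately show ?thesis using iter_per_int[of n y k] k by linarith
  qed
  from *[of x y] *[of y x] show ?thesis by linarith
qed

lemma iter_mult: "\<bar>(f ^^ (n * m)) 0 - real m * (f ^^ n) 0\<bar> \<le> real m"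
proof (induction m)
  case (Suc m)
  have "(f ^^ (n * Suc m)) 0 = (f ^^ n) ((f ^^ (n * m)) 0)" by (simp add: funpow_add)
  then have "\<bar>(f ^^ (n * Suc m)) 0 - (f ^^ (n * m)) 0 - (f ^^ n) 0\<bar> \<le> 1"
    using iter_near[of n "(f ^^ (n * m)) 0" 0] by simp
  then have "\<bar>(f ^^ (n * Suc m)) 0 - real m * (f ^^ n) 0 - (f ^^ n) 0\<bar> \<le> real m + 1"
    using Suc by linarith
  then show ?case by (simp add: algebra_simps)
qed simp

text \<open>Both quotients are compared with the one for \<open>n * m\<close> iterates, which
  \<open>iter_mult\<close> controls from either side.\<close>

lemma rotation_cauchy: "n > 0 \<Longrightarrow> m > 0 \<Longrightarrow> \<bar>(f ^^ n) 0 / real n - (f ^^ m) 0 / real m\<bar> \<le> 1 / real n + 1 / real m"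
proof -
  assume n: "n > 0" and m: "m > 0"
  have *: "\<bar>(f ^^ (n * m)) 0 / real (n * m) - (f ^^ n) 0 / real n\<bar> \<le> 1 / real n" if "n > 0" "m > 0" for n m
  proof -
    have "(f ^^ (n * m)) 0 / real (n * m) - (f ^^ n) 0 / real n = ((f ^^ (n * m)) 0 - real m * (f ^^ n) 0) / real (n * m)"
      using that by (simp add: field_simps)
    then have "\<bar>(f ^^ (n * m)) 0 / real (n * m) - (f ^^ n) 0 / real n\<bar>
        = \<bar>(f ^^ (n * m)) 0 - real m * (f ^^ n) 0\<bar> / real (n * m)" by (simp only: abs_divide abs_of_nat)
    also have "\<dots> \<le> real m / real (n * m)"
      by (rule divide_right_mono[OF iter_mult]) simp
    finally have "\<bar>(f ^^ (n * m)) 0 / real (n * m) - (f ^^ n) 0 / real n\<bar> \<le> real m / real (n * m)" .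
    then show ?thesis using that by simp
  qed
  have "\<bar>c - a\<bar> \<le> p \<Longrightarrow> \<bar>c - b\<bar> \<le> q \<Longrightarrow> \<bar>a - b\<bar> \<le> p + q" for a b c p q :: real by linarith
  from this[OF *[OF n m] *[OF m n, unfolded mult.commute[of m n]]] show ?thesis .
qed

lemma rotation_limit_ex: "\<exists>\<rho>. \<forall>x. (\<lambda>n. ((f ^^ n) x - x) / real n) \<longlonglongrightarrow> \<rho>"
proof -
  have "Cauchy (\<lambda>n. (f ^^ n) 0 / real n)"
  proof (rule metric_CauchyI)
    fix e :: real assume e: "e > 0"
    obtain M where M: "M > 0" "inverse (real M) < e / 2" using ex_inverse_of_nat_less[of "e/2"] e by auto
    have "dist ((f ^^ m) 0 / real m) ((f ^^ n) 0 / real n) < e" if "m \<ge> M" "n \<ge> M" for m n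
    proof -
      have b: "1 / real k \<le> inverse (real M)" if "k \<ge> M" for k
        using that M(1) by (simp add: inverse_eq_divide frac_le)
      have "\<bar>(f ^^ m) 0 / real m - (f ^^ n) 0 / real n\<bar> \<le> 1 / real m + 1 / real n"
        using rotation_cauchy that M(1) by simp
      then show ?thesis using b[OF that(1)] b[OF that(2)] M(2) by (simp add: dist_real_def)
    qed
    then show "\<exists>M. \<forall>m\<ge>M. \<forall>n\<ge>M. dist ((f ^^ m) 0 / real m) ((f ^^ n) 0 / real n) < e" by blast
  qed
  then obtain \<rho> where lim: "(\<lambda>n. (f ^^ n) 0 / real n) \<longlonglongrightarrow> \<rho>"
    using Cauchy_convergent_iff convergent_def by blast
  have "(\<lambda>n. ((f ^^ n) x - x) / real n) \<longlonglongrightarrow> \<rho>" for x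
  proof -
    have "(\<lambda>n. (((f ^^ n) x - x) - (f ^^ n) 0) / real n) \<longlonglongrightarrow> 0"
    proof (rule Lim_null_comparison[OF _ lim_1_over_n])
      show "eventually (\<lambda>n. norm ((((f ^^ n) x - x) - (f ^^ n) 0) / real n) \<le> 1 / of_nat n) sequentially"
        using iter_near[of _ x 0] by (intro always_eventually allI) (simp add: divide_right_mono)
    qed
    from tendsto_add[OF this lim] show ?thesis by (simp add: diff_divide_distrib)
  qed
  then show ?thesis by blast
qed

lemma rotation_number_limit: "(\<lambda>n. ((f ^^ n) x - x) / real n) \<longlonglongrightarrow> rotation_number f"
proof -
  obtain \<rho> where \<rho>: "\<forall>x. (\<lambda>n. ((f ^^ n) x - x) / real n) \<longlonglongrightarrow> \<rho>" using rotation_limit_ex by blast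
  have "rotation_number f = \<rho>" unfolding rotation_number_def
    by (intro the_equality) (use LIMSEQ_unique \<rho> in blast)+
  then show ?thesis using \<rho> by blast
qed

lemma iter_lower: "of_int l \<le> (f ^^ k) 0 \<Longrightarrow> real j * of_int l \<le> (f ^^ (k * j)) 0"
proof (induction j)
  case (Suc j)
  have "real (Suc j) * of_int l \<le> (f ^^ (k * j)) 0 + of_int l" using Suc by (simp add: algebra_simps)
  also have "\<dots> = (f ^^ (k * j)) (0 + of_int l)" unfolding iter_per_int ..
  also have "\<dots> \<le> (f ^^ (k * j)) ((f ^^ k) 0)" using iter_mono Suc.prems by (simp add: strict_mono_less_eq)
  also have "\<dots> = (f ^^ (k * Suc j)) 0" by (simp add: funpow_add[symmetric] add.commute flip: comp_apply[of "f ^^ (k * j)" "f ^^ k"])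
  finally show ?case .
qed simp

lemma iter_upper: "(f ^^ k) 0 \<le> of_int l \<Longrightarrow> (f ^^ (k * j)) 0 \<le> real j * of_int l"
proof (induction j)
  case (Suc j)
  have "(f ^^ (k * Suc j)) 0 = (f ^^ (k * j)) ((f ^^ k) 0)"
    by (simp add: funpow_add[symmetric] add.commute flip: comp_apply[of "f ^^ (k * j)" "f ^^ k"])
  also have "\<dots> \<le> (f ^^ (k * j)) (0 + of_int l)" using iter_mono Suc.prems by (simp add: strict_mono_less_eq)
  also have "\<dots> = (f ^^ (k * j)) 0 + of_int l" unfolding iter_per_int ..
  also have "\<dots> \<le> real (Suc j) * of_int l" using Suc by (simp add: algebra_simps)
  finally show ?case .
qed simp

lemma iter_mult_limit:
  assumes k: "k > 0" shows "(\<lambda>j. (f ^^ (k * Suc j)) 0 / real (Suc j)) \<longlonglongrightarrow> real k * rotation_number f"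
proof -
  have "strict_mono (\<lambda>j. k * Suc j)" using k by (auto simp: strict_mono_def)
  from LIMSEQ_subseq_LIMSEQ[OF rotation_number_limit[of 0] this]
  have "(\<lambda>j. real k * ((f ^^ (k * Suc j)) 0 / real (k * Suc j))) \<longlonglongrightarrow> real k * rotation_number f"
    by (intro tendsto_intros) (simp add: o_def)
  moreover have "real k * (y / real (k * Suc j)) = y / real (Suc j)" for y j
    using k by (simp only: of_nat_mult) simp
  ultimately show ?thesis by simp
qed

lemma rotation_ge: "of_int l \<le> (f ^^ k) 0 \<Longrightarrow> of_int l \<le> real k * rotation_number f"
proof (cases "k = 0")
  case False
  assume "of_int l \<le> (f ^^ k) 0"
  then have "real (Suc j) * of_int l \<le> (f ^^ (k * Suc j)) 0" for j by (rule iter_lower)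
  then have "of_int l \<le> (f ^^ (k * Suc j)) 0 / real (Suc j)" for j
    by (simp only: pos_le_divide_eq of_nat_0_less_iff zero_less_Suc mult.commute)
  then show ?thesis using LIMSEQ_le_const[OF iter_mult_limit] False by blast
qed simp

lemma rotation_le: "(f ^^ k) 0 \<le> of_int l \<Longrightarrow> real k * rotation_number f \<le> of_int l"
proof (cases "k = 0")
  case False
  assume "(f ^^ k) 0 \<le> of_int l"
  then have "(f ^^ (k * Suc j)) 0 \<le> real (Suc j) * of_int l" for j by (rule iter_upper)
  then have "(f ^^ (k * Suc j)) 0 / real (Suc j) \<le> of_int l" for j
    by (simp only: pos_divide_le_eq of_nat_0_less_iff zero_less_Suc mult.commute)
  then show ?thesis using LIMSEQ_le_const2[OF iter_mult_limit] False by blast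
qed simp

text \<open>The orbits of 0 under \<open>f\<close> and under the rotation have the same order on the
  line. Cancelling common iterates reduces a wrong order to a comparison of
  \<open>(f ^^ k) 0\<close> with an integer, which bounds the rotation number and contradicts the
  assumption.\<close>

lemma orbit_order:
  assumes "real n * rotation_number f + of_int m < real n' * rotation_number f + of_int m'"
  shows "(f ^^ n) 0 + of_int m < (f ^^ n') 0 + of_int m'"
proof (rule ccontr)
  assume "\<not> ?thesis"
  then have le: "(f ^^ n') 0 + of_int m' \<le> (f ^^ n) 0 + of_int m" by simp
  show False
  proof (cases "n' \<le> n")
    case True
    define k where "k = n - n'"
    have n: "n = n' + k" using True by (simp add: k_def)
    have "(f ^^ n') (0 + of_int (m' - m)) \<le> (f ^^ n') ((f ^^ k) 0)"
      using le unfolding iter_per_int n by (simp add: funpow_add)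
    then have "of_int (m' - m) \<le> (f ^^ k) 0" using iter_mono by (simp add: strict_mono_less_eq)
    from rotation_ge[OF this] show False using assms by (simp add: n algebra_simps)
  next
    case False
    define k where "k = n' - n"
    have n: "n' = n + k" using False by (simp add: k_def)
    have "(f ^^ n) ((f ^^ k) 0) \<le> (f ^^ n) (0 + of_int (m - m'))"
      using le unfolding iter_per_int n by (simp add: funpow_add)
    then have "(f ^^ k) 0 \<le> of_int (m - m')" using iter_mono by (simp add: strict_mono_less_eq)
    from rotation_le[OF this] show False using assms by (simp add: n algebra_simps)
  qed
qed

definition orbit_above :: "real \<Rightarrow> real set" where
  "orbit_above u = {(f ^^ n) 0 + of_int m | n m. u < real n * rotation_number f + of_int m}"

text \<open>The monotone extension of the correspondence between the two orbits, in its
  right-continuous version. Wandering intervals of \<open>f\<close> would show up as jumps.\<close>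

definition conj_map :: "real \<Rightarrow> real" where "conj_map u = Inf (orbit_above u)"

lemma orbit_aboveI: "u < real n * rotation_number f + of_int m \<Longrightarrow> (f ^^ n) 0 + of_int m \<in> orbit_above u"
  unfolding orbit_above_def by blast

lemma orbit_above_nonempty: "orbit_above u \<noteq> {}"
  using orbit_aboveI[of u 0 "\<lfloor>u\<rfloor> + 1"] by force

lemma orbit_above_lower: "y \<in> orbit_above u \<Longrightarrow> of_int m \<le> u \<Longrightarrow> of_int m \<le> y"
proof -
  assume "y \<in> orbit_above u" and m: "of_int m \<le> u"
  then obtain n k where "y = (f ^^ n) 0 + of_int k" "u < real n * rotation_number f + of_int k"
    unfolding orbit_above_def by blast
  then show ?thesis using orbit_order[of 0 m n k] m by simp
qed

lemma orbit_above_bdd: "bdd_below (orbit_above u)"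
  using orbit_above_lower[of _ u "\<lfloor>u\<rfloor>"] by (intro bdd_belowI[of _ "of_int \<lfloor>u\<rfloor>"]) simp

lemma conj_map_lower: "y \<in> orbit_above u \<Longrightarrow> conj_map u \<le> y"
  unfolding conj_map_def by (rule cInf_lower[OF _ orbit_above_bdd])

lemma conj_map_greatest: "(\<And>y. y \<in> orbit_above u \<Longrightarrow> z \<le> y) \<Longrightarrow> z \<le> conj_map u"
  unfolding conj_map_def by (rule cInf_greatest[OF orbit_above_nonempty])

lemma conj_map_per: "conj_map (u + 1) = conj_map u + 1"
proof (rule antisym)
  have "conj_map (u + 1) - 1 \<le> conj_map u"
  proof (rule conj_map_greatest)
    fix y assume "y \<in> orbit_above u"
    then obtain n m where nm: "y = (f ^^ n) 0 + of_int m" "u < real n * rotation_number f + of_int m"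
      unfolding orbit_above_def by blast
    then have "conj_map (u + 1) \<le> (f ^^ n) 0 + of_int (m + 1)"
      by (intro conj_map_lower orbit_aboveI) simp
    then show "conj_map (u + 1) - 1 \<le> y" using nm by simp
  qed
  then show "conj_map (u + 1) \<le> conj_map u + 1" by simp
  show "conj_map u + 1 \<le> conj_map (u + 1)"
  proof (rule conj_map_greatest)
    fix y assume "y \<in> orbit_above (u + 1)"
    then obtain n m where nm: "y = (f ^^ n) 0 + of_int m" "u + 1 < real n * rotation_number f + of_int m"
      unfolding orbit_above_def by blast
    then have "conj_map u \<le> (f ^^ n) 0 + of_int (m - 1)"
      by (intro conj_map_lower orbit_aboveI) simp
    then show "conj_map u + 1 \<le> y" using nm by simp
  qed
qed

context
  assumes irr: "rotation_number f \<notin> \<rat>"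
begin

lemma orbit_dense:
  assumes "u < v" obtains n m where "u < real n * rotation_number f + of_int m" "real n * rotation_number f + of_int m < v"
proof -
  obtain N s g where sc: "rotation_scale (rotation_number f) N s g" "g < (v - u) / 3"
    using rotation_scale_exists[OF irr, of "(v - u) / 3"] assms by auto
  then obtain j l where "u + (v - u) / 3 \<le> real j * rotation_number f + of_int l"
    "real j * rotation_number f + of_int l \<le> u + (v - u) / 3 + g"
    unfolding rotation_scale_def by blast
  then show thesis using that[of j l] sc(2) assms by (simp add: field_simps)
qed

lemma conj_map_strict_mono: "strict_mono conj_map"
proof (rule strict_monoI)
  fix u v :: real assume uv: "u < v"
  obtain n m where nm: "u < real n * rotation_number f + of_int m" "real n * rotation_number f + of_int m < v"
    using orbit_dense[OF uv] by blast
  \<comment> \<open>Two orbit points are inserted, since passing to the infimum on either side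
    preserves only weak inequalities.\<close>
  obtain n' m' where nm': "real n * rotation_number f + of_int m < real n' * rotation_number f + of_int m'"
    "real n' * rotation_number f + of_int m' < v"
    using orbit_dense[OF nm(2)] by blast
  have "conj_map u \<le> (f ^^ n) 0 + of_int m" by (intro conj_map_lower orbit_aboveI nm)
  also have "\<dots> < (f ^^ n') 0 + of_int m'" by (rule orbit_order[OF nm'(1)])
  also have "\<dots> \<le> conj_map v"
  proof (rule conj_map_greatest)
    fix y assume "y \<in> orbit_above v"
    then obtain n1 m1 where "y = (f ^^ n1) 0 + of_int m1" "v < real n1 * rotation_number f + of_int m1"
      unfolding orbit_above_def by blast
    then show "(f ^^ n') 0 + of_int m' \<le> y"
      using orbit_order[of n' m' n1 m1] nm'(2) by simp
  qed
  finally show "conj_map u < conj_map v" .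
qed

lemma conj_map_conjugates: "f (conj_map u) = conj_map (u + rotation_number f)"
proof (rule antisym)
  show "f (conj_map u) \<le> conj_map (u + rotation_number f)"
  proof (rule conj_map_greatest)
    fix y assume "y \<in> orbit_above (u + rotation_number f)"
    then obtain n m where nm: "y = (f ^^ n) 0 + of_int m" "u + rotation_number f < real n * rotation_number f + of_int m"
      unfolding orbit_above_def by blast
    then have "u < real n * rotation_number f + of_int m - rotation_number f" by simp
    \<comment> \<open>The point \<open>y\<close> may be an integer, with no predecessor in the
      forward orbit. An orbit point slightly lower takes the place of its preimage.\<close>
    then obtain n' m' where nm': "u < real n' * rotation_number f + of_int m'"
      "real n' * rotation_number f + of_int m' < real n * rotation_number f + of_int m - rotation_number f"
      by (rule orbit_dense)
    have "conj_map u \<le> (f ^^ n') 0 + of_int m'" by (intro conj_map_lower orbit_aboveI nm')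
    then have "f (conj_map u) \<le> f ((f ^^ n') 0 + of_int m')" using f_mono by (simp add: strict_mono_less_eq)
    also have "\<dots> = (f ^^ Suc n') 0 + of_int m'" using periodic_of_int[of f, OF f_per] by simp
    also have "\<dots> < y" unfolding nm(1) by (rule orbit_order) (use nm'(2) in \<open>simp add: algebra_simps\<close>)
    finally show "f (conj_map u) \<le> y" by simp
  qed
  show "conj_map (u + rotation_number f) \<le> f (conj_map u)"
  proof (rule ccontr)
    assume "\<not> ?thesis"
    then have lt: "f (conj_map u) < conj_map (u + rotation_number f)" by simp
    \<comment> \<open>Continuity of \<open>f\<close> transfers strict inequality from the infimum to
      an orbit point near it; the image of that point then lies in
      \<open>orbit_above (u + rotation_number f)\<close> yet below its infimum.\<close>
    have "isCont f (conj_map u)" using f_cont by (simp add: continuous_on_eq_continuous_at)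
    then have "eventually (\<lambda>y. f y < conj_map (u + rotation_number f)) (at (conj_map u))"
      using lt order_tendstoD(2) unfolding isCont_def by blast
    then obtain d where d: "d > 0" "\<And>y. y \<noteq> conj_map u \<Longrightarrow> dist y (conj_map u) < d \<Longrightarrow> f y < conj_map (u + rotation_number f)"
      unfolding eventually_at by auto
    have "\<exists>y\<in>orbit_above u. y < conj_map u + d"
      using d(1) conj_map_greatest[of u "conj_map u + d"] by force
    then obtain y where y: "y \<in> orbit_above u" "y < conj_map u + d" by blast
    then have "f y < conj_map (u + rotation_number f)"
      using d lt conj_map_lower[OF y(1)] by (cases "y = conj_map u") (auto simp: dist_real_def)
    moreover have "f y \<in> orbit_above (u + rotation_number f)"
    proof -
      obtain n m where nm: "y = (f ^^ n) 0 + of_int m" "u < real n * rotation_number f + of_int m"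
        using y(1) unfolding orbit_above_def by blast
      have "f y = (f ^^ Suc n) 0 + of_int m" using periodic_of_int[of f, OF f_per] by (simp add: nm(1))
      then show ?thesis using nm(2) by (simp only:) (intro orbit_aboveI, simp add: algebra_simps)
    qed
    ultimately show False using conj_map_lower by fastforce
  qed
qed

end

end

section \<open>Propagation of cross-ratios\<close>

text \<open>The indices are cut into blocks of five followed by blocks of six, and the colour is the
  position within the block. Equal positions in different blocks are at least one block length
  apart, also cyclically.\<close>

lemma index_colouring:
  assumes N: "(20::nat) \<le> N"
  obtains c :: "nat \<Rightarrow> nat" where "\<And>i. c i < 6"
    "\<And>i j. i < j \<Longrightarrow> j < N \<Longrightarrow> c i = c j \<Longrightarrow> 5 \<le> j - i \<and> 5 \<le> N - (j - i)"
proof -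
  define b where "b = N mod 5"
  define a where "a = (N - 6 * b) div 5"
  have b: "b < 5" by (simp add: b_def)
  have "N = 5 * (N div 5) + b" by (simp add: b_def)
  moreover have "N div 5 \<ge> 4" using N by linarith
  \<comment> \<open>With \<open>N = 5 * q + b\<close> one has \<open>q >= 4 >= b\<close>, so
    \<open>N - 6 * b = 5 * (q - b)\<close> is not negative.\<close>
  ultimately have "6 * b \<le> N" "5 dvd N - 6 * b" using b by (linarith, presburger)
  then have N_eq: "N = 5 * a + 6 * b" by (simp add: a_def)
  define c where "c i = (if i < 5 * a then i mod 5 else (i - 5 * a) mod 6)" for i
  have "c i < 6" for i
  proof -
    have "i mod 5 < 5" "(i - 5 * a) mod 6 < 6" by simp_all
    then have "i mod 5 < 6" "(i - 5 * a) mod 6 < 6" by linarith+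
    then show ?thesis by (simp add: c_def)
  qed
  moreover have "5 \<le> j - i \<and> 5 \<le> N - (j - i)" if ij: "i < j" "j < N" "c i = c j" for i j
  proof -
    consider "j < 5 * a" | "i < 5 * a" "5 * a \<le> j" | "5 * a \<le> i" using ij(1) by linarith
    then show ?thesis
    proof cases
      case 1
      then have e: "i mod 5 = j mod 5" using ij by (simp add: c_def)
      define q q' where "q = i div 5" and "q' = j div 5"
      define r where "r = j mod 5"
      have "i = 5 * q + i mod 5" "j = 5 * q' + j mod 5" by (simp_all add: q_def q'_def)
      then have "i = 5 * q + r" "j = 5 * q' + r" unfolding e r_def by simp_all
      moreover have "q' < a" using 1 by (simp add: q'_def less_mult_imp_div_less mult.commute)
      moreover from calculation have "q + 1 \<le> q'" using ij(1) by linarith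
      ultimately have "5 \<le> j - i" "5 \<le> N - (j - i)" using N_eq by linarith+
      then show ?thesis by simp
    next
      case 2
      then have "i mod 5 = (j - 5 * a) mod 6" using ij by (simp add: c_def)
      moreover define t where "t = j - 5 * a"
      ultimately have t: "i mod 5 = t mod 6" "j = 5 * a + t" "t < 6 * b" using 2 ij(2) N_eq by auto
      define q where "q = i div 5"
      define r where "r = i mod 5"
      define q' where "q' = t div 6"
      have "i = 5 * q + r" "r < 5" by (simp_all add: q_def r_def)
      moreover have "t = 6 * q' + r" using t(1) by (metis r_def q'_def mult_div_mod_eq)
      moreover have "q < a" using 2(1) by (simp add: q_def less_mult_imp_div_less mult.commute)
      moreover have "q' < b" using t(3) by (simp add: q'_def less_mult_imp_div_less mult.commute)
      ultimately have "5 \<le> j - i" "5 \<le> N - (j - i)" using N_eq t(2) by linarith+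
      then show ?thesis by simp
    next
      case 3
      define s t where "s = i - 5 * a" and "t = j - 5 * a"
      have e: "s mod 6 = t mod 6" using ij 3 by (simp add: c_def s_def t_def)
      define q q' where "q = s div 6" and "q' = t div 6"
      define r where "r = t mod 6"
      have "s = 6 * q + s mod 6" "t = 6 * q' + t mod 6" by (simp_all add: q_def q'_def)
      then have "s = 6 * q + r" "t = 6 * q' + r" unfolding e r_def by simp_all
      moreover have st: "s < t" "t < 6 * b" "i = 5 * a + s" "j = 5 * a + t" using ij N_eq 3 by (simp_all add: s_def t_def)
      moreover have "q' < b" using st(2) by (simp add: q'_def less_mult_imp_div_less mult.commute)
      moreover from calculation have "q + 1 \<le> q'" by linarith
      ultimately have "5 \<le> j - i" "5 \<le> N - (j - i)" using N_eq by linarith+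
      then show ?thesis by simp
    qed
  qed
  ultimately show thesis by (rule that)
qed

lemma sorted_list_gaps:
  fixes xs :: "real list"
  assumes gap: "\<And>i. Suc i < length xs \<Longrightarrow> s \<le> xs ! Suc i - xs ! i"
  shows "i + d < length xs \<Longrightarrow> real d * s \<le> xs ! (i + d) - xs ! i"
proof (induction d)
  case (Suc d)
  then show ?case using gap[of "i + d"] by (simp add: algebra_simps)
qed simp

text \<open>The orbit points are coloured in their cyclic order by blocks of five or six consecutive ones.\<close>

lemma orbit_colouring:
  assumes N: "20 \<le> N" and s: "0 < s"
    and spacing: "\<And>j p. 0 < j \<Longrightarrow> j < N \<Longrightarrow> s \<le> \<bar>real j * \<rho> - of_int p\<bar>"
  obtains col :: "nat \<Rightarrow> nat" where "\<And>i. col i < 6"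
    "\<And>i j p. i < N \<Longrightarrow> j < N \<Longrightarrow> i \<noteq> j \<Longrightarrow> col i = col j \<Longrightarrow> 5 * s \<le> \<bar>real i * \<rho> - real j * \<rho> - of_int p\<bar>"
proof -
  define pos where "pos j = frac (real j * \<rho>)" for j
  have sep: "s \<le> \<bar>pos i - pos j - of_int p\<bar>" if ij: "i < N" "j < N" "i \<noteq> j" for i j p
  proof -
    have *: "s \<le> \<bar>pos i - pos j - of_int p\<bar>" if ij: "i < N" "j < i" for i j p
    proof -
      have E: "pos i - pos j - of_int p = real (i - j) * \<rho> - of_int (\<lfloor>real i * \<rho>\<rfloor> - \<lfloor>real j * \<rho>\<rfloor> + p)"
        using ij by (simp add: pos_def frac_def of_nat_diff algebra_simps)
      show ?thesis unfolding E by (rule spacing) (use ij in linarith)+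
    qed
    show ?thesis
    proof (cases "j < i")
      case True then show ?thesis using *[of i j p] ij by simp
    next
      case False
      then have "s \<le> \<bar>pos j - pos i - of_int (- p)\<bar>" using *[of j i "- p"] ij by simp
      then show ?thesis by simp
    qed
  qed
  have pos_inj: "inj_on pos {..<N}"
  proof (rule inj_onI, rule ccontr)
    fix i j assume "i \<in> {..<N}" "j \<in> {..<N}" "pos i = pos j" "i \<noteq> j"
    then show False using sep[of i j 0] s by simp
  qed
  define xs where "xs = sorted_list_of_set (pos ` {..<N})"
  have xs: "length xs = N" "set xs = pos ` {..<N}" "sorted xs" "distinct xs"
    using pos_inj by (simp_all add: xs_def card_image)
  have mem: "\<exists>j<N. xs ! i = pos j" if "i < N" for i
    using nth_mem[of i xs] that xs by auto
  have strict: "xs ! i < xs ! j" if "i < j" "j < N" for i j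
    using sorted_nth_mono[OF xs(3), of i j] nth_eq_iff_index_eq[OF xs(4), of i j] that xs(1) by fastforce
  have sepx: "s \<le> \<bar>xs ! i - xs ! j - of_int p\<bar>" if ij: "i < N" "j < N" "i \<noteq> j" for i j p
  proof -
    obtain i' j' where "i' < N" "xs ! i = pos i'" "j' < N" "xs ! j = pos j'" using mem ij by blast
    moreover have "xs ! i \<noteq> xs ! j" using nth_eq_iff_index_eq[OF xs(4)] ij xs(1) by simp
    ultimately show ?thesis using sep[of i' j' p] by auto
  qed
  have gap: "real (j - i) * s \<le> xs ! j - xs ! i" if "i \<le> j" "j < N" for i j
  proof -
    have "s \<le> xs ! Suc i - xs ! i" if "Suc i < length xs" for i
      using sepx[of "Suc i" i 0] strict[of i "Suc i"] that xs(1) by simp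
    from sorted_list_gaps[of xs s i "j - i", OF this] show ?thesis using that xs(1) by simp
  qed
  have range: "0 \<le> xs ! i" "xs ! i < 1" if "i < N" for i
    using mem[OF that] by (auto simp: pos_def frac_lt_1)
  have wrap: "real (N - (j - i)) * s \<le> 1 - (xs ! j - xs ! i)" if ij: "i < j" "j < N" for i j
  proof -
    have "s \<le> \<bar>xs ! (N - 1) - xs ! 0 - of_int 1\<bar>" using N by (intro sepx) auto
    then have e: "s \<le> xs ! 0 + 1 - xs ! (N - 1)" using range[of 0] range[of "N - 1"] N by simp
    have "real i * s \<le> xs ! i - xs ! 0" using gap[of 0 i] ij by simp
    moreover have "real (N - 1 - j) * s \<le> xs ! (N - 1) - xs ! j" using gap[of j "N - 1"] ij by simp
    moreover have "real (N - (j - i)) = 1 + real i + real (N - 1 - j)" using ij by (simp add: of_nat_diff)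
    ultimately show ?thesis using e by (simp add: algebra_simps)
  qed
  obtain c :: "nat \<Rightarrow> nat" where c: "\<And>i. c i < 6"
    "\<And>i j. i < j \<Longrightarrow> j < N \<Longrightarrow> c i = c j \<Longrightarrow> 5 \<le> j - i \<and> 5 \<le> N - (j - i)"
    using index_colouring[OF N] by blast
  define idx where "idx j = (SOME i. i < N \<and> xs ! i = pos j)" for j
  have idx: "idx j < N \<and> xs ! idx j = pos j" if "j < N" for j
  proof -
    have "pos j \<in> set xs" using that xs(2) by simp
    then have "\<exists>i. i < N \<and> xs ! i = pos j" using xs(1) by (auto simp: in_set_conv_nth)
    then show ?thesis unfolding idx_def by (rule someI_ex)
  qed
  \<comment> \<open>Five index steps cover at least \<open>5 * s\<close>, in both directions around
    the circle. The two estimates handle \<open>p <= 0\<close> and \<open>p >= 1\<close>.\<close>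
  have far: "5 * s \<le> \<bar>xs ! j - xs ! i - of_int p\<bar>" if ij: "i < j" "j < N" "c i = c j" for i j p
  proof -
    have "5 \<le> j - i" "5 \<le> N - (j - i)" using c(2)[OF ij] by auto
    then have "5 * s \<le> real (j - i) * s" "5 * s \<le> real (N - (j - i)) * s"
      using s by (intro mult_right_mono; linarith)+
    then have d: "5 * s \<le> xs ! j - xs ! i" "5 * s \<le> 1 - (xs ! j - xs ! i)"
      using gap[of i j] wrap[of i j] ij by linarith+
    consider "p \<le> 0" | "p \<ge> 1" by linarith
    then show ?thesis
    proof cases
      case 1
      then have "of_int p \<le> (0::real)" by simp
      then show ?thesis using d by linarith
    next
      case 2
      then have "1 \<le> (of_int p :: real)" by simp
      then show ?thesis using d by linarith
    qed
  qed
  show thesis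
  proof (rule that[of "c \<circ> idx"])
    show "(c \<circ> idx) i < 6" for i using c(1) by simp
    fix i j p assume ij: "i < N" "j < N" "i \<noteq> j" "(c \<circ> idx) i = (c \<circ> idx) j"
    have ne: "idx i \<noteq> idx j"
    proof
      assume "idx i = idx j"
      then have "pos i = pos j" using idx ij(1,2) by metis
      then show False using inj_onD[OF pos_inj] ij by auto
    qed
    have e: "real i * \<rho> - real j * \<rho> - of_int p = pos i - pos j - of_int (p - \<lfloor>real i * \<rho>\<rfloor> + \<lfloor>real j * \<rho>\<rfloor>)"
      by (simp add: pos_def frac_def)
    have e2: "pos i - pos j - of_int q = - (pos j - pos i - of_int (- q))" for q by simp
    show "5 * s \<le> \<bar>real i * \<rho> - real j * \<rho> - of_int p\<bar>"
    proof (cases "idx j < idx i")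
      case True
      then have "5 * s \<le> \<bar>pos i - pos j - of_int q\<bar>" for q
        using far[of "idx j" "idx i" q] idx[OF ij(1)] idx[OF ij(2)] ij(4) by simp
      then show ?thesis unfolding e .
    next
      case False
      then have "5 * s \<le> \<bar>pos j - pos i - of_int q\<bar>" for q
        using far[of "idx i" "idx j" q] idx[OF ij(1)] idx[OF ij(2)] ij(4) ne by simp
      then show ?thesis unfolding e unfolding e2 abs_minus_cancel .
    qed
  qed
qed

text \<open>The first \<open>m\<close> iterates of a quadruple split into six allowable configurations, so the product of the
  distortions along them telescopes to at most \<open>Q\<^sup>6\<close>.\<close>

lemma cross_ratio_propagation:
  fixes h f :: "real \<Rightarrow> real" and X :: "real \<Rightarrow> real \<Rightarrow> real \<Rightarrow> real \<Rightarrow> real"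
  assumes sc: "rotation_scale \<rho> N s g"
    and mono: "strict_mono h" and per: "\<And>u. h (u + 1) = h u + 1" and conj: "\<And>u. f (h u) = h (u + \<rho>)"
    and cri: "cross_ratio_inequality X f Q"
    and X_pos: "\<And>A B C D. A < B \<Longrightarrow> B < C \<Longrightarrow> C < D \<Longrightarrow> 0 < X A B C D"
    and u: "u1 < u2" "u2 < u3" "u3 < u4" "u4 - u1 \<le> 5 * s" and m: "m \<le> N"
  shows "X (h (u1 + real m * \<rho>)) (h (u2 + real m * \<rho>)) (h (u3 + real m * \<rho>)) (h (u4 + real m * \<rho>))
     \<le> Q ^ 6 * X (h u1) (h u2) (h u3) (h u4)"
proof -
  define Y where "Y j = X (h (u1 + real j * \<rho>)) (h (u2 + real j * \<rho>)) (h (u3 + real j * \<rho>)) (h (u4 + real j * \<rho>))" for j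
  define r where "r j = Y (Suc j) / Y j" for j
  have N: "20 \<le> N" and s: "0 < s" "5 * s < 1" using sc by (auto simp: rotation_scale_def)
  have spacing: "\<And>j p. 0 < j \<Longrightarrow> j < N \<Longrightarrow> s \<le> \<bar>real j * \<rho> - of_int p\<bar>"
    using sc by (auto simp: rotation_scale_def)
  have hlt: "h a < h b \<longleftrightarrow> a < b" and hle: "h a \<le> h b \<longleftrightarrow> a \<le> b" for a b
    using mono by (simp_all add: strict_mono_less strict_mono_less_eq)
  have perZ: "h (u + of_int n) = h u + of_int n" for u n by (rule periodic_of_int[of h, OF per])
  have Y_pos: "0 < Y j" for j unfolding Y_def using u by (intro X_pos) (simp_all add: hlt)
  have tel: "(\<Prod>j<n. r j) = Y n / Y 0" for n
    by (induction n) (use Y_pos in \<open>auto simp: r_def less_imp_neq[symmetric]\<close>)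
  have r_pos: "0 < r j" for j using Y_pos by (simp add: r_def)
  obtain col :: "nat \<Rightarrow> nat" where col: "\<And>i. col i < 6"
    "\<And>i j p. i < N \<Longrightarrow> j < N \<Longrightarrow> i \<noteq> j \<Longrightarrow> col i = col j \<Longrightarrow> 5 * s \<le> \<bar>real i * \<rho> - real j * \<rho> - of_int p\<bar>"
    using orbit_colouring[OF N s(1) spacing] by blast
  have class_le: "(\<Prod>j\<in>{j\<in>{..<m}. col j = k}. r j) \<le> Q" for k
  proof -
    define C where "C = {j\<in>{..<m}. col j = k}"
    have "finite C" by (simp add: C_def)
    then obtain \<phi> where \<phi>: "bij_betw \<phi> {1..card C} C" using ex_bij_betw_nat_finite_1 by blast
    define n where "n = card C"
    have \<phi>C: "\<phi> i < N" "col (\<phi> i) = k" if "i \<in> {1..n}" for i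
    proof -
      have "\<phi> i \<in> C" using bij_betwE[OF \<phi>] that by (simp add: n_def)
      then show "\<phi> i < N" "col (\<phi> i) = k" using m by (simp_all add: C_def)
    qed
    have \<phi>_inj: "\<phi> i \<noteq> \<phi> j" if "i \<in> {1..n}" "j \<in> {1..n}" "i \<noteq> j" for i j
      using inj_onD[OF bij_betw_imp_inj_on[OF \<phi>]] that unfolding n_def by blast
    define q where "q v i = h (v + real (\<phi> i) * \<rho>)" for v i
    have al: "allowable n (q u1) (q u2) (q u3) (q u4)"
      unfolding allowable_def
    proof (intro conjI ballI impI allI)
      fix i assume "i \<in> {1..n}"
      show "q u1 i < q u2 i" "q u2 i < q u3 i" "q u3 i < q u4 i" using u by (simp_all add: q_def hlt)
      have "q u4 i < h (u1 + real (\<phi> i) * \<rho> + 1)" unfolding q_def hlt using u(4) s(2) by linarith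
      then show "q u4 i - q u1 i < 1" by (simp add: q_def per)
    next
      fix i j and p :: int assume ij: "i \<in> {1..n}" "j \<in> {1..n}" "i \<noteq> j"
      have sh: "q v j + of_int p = h (v + real (\<phi> j) * \<rho> + of_int p)" for v by (simp add: q_def perZ)
      \<comment> \<open>The separation of equal colours matches the bound on \<open>u4 - u1\<close>,
        so the arcs are disjoint before \<open>h\<close> is applied. Monotonicity and periodicity of
        \<open>h\<close> carry this over.\<close>
      have "5 * s \<le> \<bar>real (\<phi> i) * \<rho> - real (\<phi> j) * \<rho> - of_int p\<bar>"
        using col(2)[of "\<phi> i" "\<phi> j" p] \<phi>C[OF ij(1)] \<phi>C[OF ij(2)] \<phi>_inj[OF ij] by simp
      then consider "u4 + real (\<phi> j) * \<rho> + of_int p \<le> u1 + real (\<phi> i) * \<rho>"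
        | "u4 + real (\<phi> i) * \<rho> \<le> u1 + real (\<phi> j) * \<rho> + of_int p" using u(4) by linarith
      then show "{q u1 i<..<q u4 i} \<inter> {q u1 j + of_int p<..<q u4 j + of_int p} = {}"
      proof cases
        case 1
        then have "q u4 j + of_int p \<le> q u1 i" unfolding sh by (simp add: q_def hle)
        then show ?thesis by auto
      next
        case 2
        then have "q u4 i \<le> q u1 j + of_int p" unfolding sh by (simp add: q_def hle)
        then show ?thesis by auto
      qed
    qed
    have "(\<Prod>i=1..n. X (f (q u1 i)) (f (q u2 i)) (f (q u3 i)) (f (q u4 i)) / X (q u1 i) (q u2 i) (q u3 i) (q u4 i)) \<le> Q"
      using cri al unfolding cross_ratio_inequality_def by blast
    moreover have "X (f (q u1 i)) (f (q u2 i)) (f (q u3 i)) (f (q u4 i)) / X (q u1 i) (q u2 i) (q u3 i) (q u4 i) = r (\<phi> i)" for i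
      unfolding q_def r_def Y_def conj by (simp add: algebra_simps)
    ultimately have "(\<Prod>i\<in>{1..n}. r (\<phi> i)) \<le> Q" by simp
    then show ?thesis using prod.reindex_bij_betw[OF \<phi>, of r] by (simp add: n_def C_def)
  qed
  have "(\<Prod>j<m. r j) = (\<Prod>k<6::nat. \<Prod>j\<in>{j\<in>{..<m}. col j = k}. r j)"
    using prod.group[of "{..<m}" "{..<6}" col r] col(1) by (auto simp: image_subset_iff)
  also have "\<dots> \<le> (\<Prod>k<6::nat. Q)"
    by (intro prod_mono conjI class_le prod_nonneg) (use r_pos in \<open>auto intro: less_imp_le\<close>)
  finally have "Y m / Y 0 \<le> Q ^ 6" unfolding tel by simp
  then show ?thesis using Y_pos[of 0] by (simp add: divide_le_eq Y_def)
qed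

section \<open>The conjugacy\<close>

lemma cross_ratio_modulus_eq:
  assumes "A < B" "B < C" "C < D"
  shows "cross_ratio_modulus A B C D = 1 / modulus_of (ellipse_modulus A B C D)"
  by (simp add: cross_ratio_modulus_def quad_modulus_eq[OF assms] modulus_of_def)

lemma cross_ratio_modulus_pos: "A < B \<Longrightarrow> B < C \<Longrightarrow> C < D \<Longrightarrow> 0 < cross_ratio_modulus A B C D"
  using ellipse_modulus_bounds[of A B C D] modulus_of_pos by (simp add: cross_ratio_modulus_eq)

text \<open>The square of \<open>k\<close> is the product of \<open>(B - A) / (C - A)\<close> and
  \<open>(D - C) / (D - B)\<close>, each at least \<open>0.965 / 1.965 > 0.49\<close>. Then
  \<open>log_bound_le\<close> applies, and 4.64 is twice its 2.32.\<close>

lemma cross_ratio_modulus_ge: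
  assumes ord: "A < B" "B < C" "C < D"
    and L: "965 / 1000 * (C - B) \<le> B - A" and R: "965 / 1000 * (C - B) \<le> D - C"
  shows "pi / (464 / 100) \<le> cross_ratio_modulus A B C D"
proof -
  define k where "k = ellipse_modulus A B C D"
  have k: "0 < k" "k < 1" using ellipse_modulus_bounds[OF ord] by (auto simp: k_def)
  have l: "193 * (C - B) \<le> 200 * (B - A)" and r: "193 * (C - B) \<le> 200 * (D - C)" using L R by simp_all
  have "49 * (C - A) \<le> 100 * (B - A)" using l ord by argo
  moreover have "49 * (D - B) \<le> 100 * (D - C)" using r ord by argo
  ultimately have "49 / 100 * (C - A) \<le> B - A" "49 / 100 * (D - B) \<le> D - C" by simp_all
  then have "(49 / 100 * (C - A)) * (49 / 100 * (D - B)) \<le> (B - A) * (D - C)"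
    using ord by (intro mult_mono) auto
  moreover have "(t * u) * (t * v) = t\<^sup>2 * (u * v)" for t u v :: real
    by (simp add: power2_eq_square mult_ac)
  ultimately have "(49 / 100)\<^sup>2 * ((C - A) * (D - B)) \<le> (B - A) * (D - C)" by metis
  then have "(49 / 100)\<^sup>2 \<le> (B - A) * (D - C) / ((C - A) * (D - B))"
    using ord by (simp add: pos_le_divide_eq)
  then have k49: "49 / 100 \<le> k" unfolding k_def ellipse_modulus_def by (rule real_le_rsqrt)
  have "modulus_of k \<le> 2 / pi * log_bound k" by (rule modulus_of_le[OF k])
  also have "\<dots> \<le> 2 / pi * (232 / 100)" using log_bound_le[OF k49 k(2)] by (intro mult_left_mono) auto
  finally have "modulus_of k \<le> (464 / 100) / pi" by simp
  then have "1 / ((464 / 100) / pi) \<le> 1 / modulus_of k"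
    using modulus_of_pos[OF k] by (intro divide_left_mono) auto
  then show ?thesis by (simp add: cross_ratio_modulus_eq[OF ord] k_def)
qed

text \<open>A lower bound on the product \<open>k^2\<close> bounds each of its two factors from
  below, because the other is less than 1. The rate 2.32 for \<open>ln (1 / k)\<close> doubles on
  squaring.\<close>

lemma cross_ratio_modulus_lengths:
  assumes ord: "A < B" "B < C" "C < D" and T: "T > 0"
    and X: "pi / (464 / 100) \<le> T * cross_ratio_modulus A B C D"
  shows "D - B \<le> exp (464 / 100 * T) * (D - C)" "C - A \<le> exp (464 / 100 * T) * (B - A)"
proof -
  define k where "k = ellipse_modulus A B C D"
  have k: "0 < k" "k < 1" using ellipse_modulus_bounds[OF ord] by (auto simp: k_def)
  note mp = modulus_of_pos[OF k]
  define E where "E = exp (464 / 100 * T)"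
  have "pi / (464 / 100) * modulus_of k \<le> T"
    using X mp by (simp add: cross_ratio_modulus_eq[OF ord] k_def pos_le_divide_eq)
  then have m: "modulus_of k * (pi / 2) \<le> 232 / 100 * T" by (simp add: mult_ac)
  have "ln (1 / k) \<le> modulus_of k * (pi / 2)"
    using mult_right_mono[OF modulus_of_ge[OF k], of "pi / 2"] by simp
  then have "ln (1 / k) \<le> 232 / 100 * T" using m by linarith
  then have "exp (ln (1 / k)) \<le> exp (232 / 100 * T)" by simp
  then have "1 / k \<le> exp (232 / 100 * T)" using k by simp
  then have "(1 / k)\<^sup>2 \<le> (exp (232 / 100 * T))\<^sup>2" using k by (intro power_mono) auto
  also have "\<dots> = E" unfolding E_def by (simp add: power2_eq_square flip: exp_add)
  finally have "1 \<le> E * k\<^sup>2" using k by (simp add: power_divide pos_divide_le_eq)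
  moreover have "k\<^sup>2 = (B - A) * (D - C) / ((C - A) * (D - B))"
  proof -
    have "0 \<le> (B - A) * (D - C) / ((C - A) * (D - B))" using ord by simp
    then show ?thesis unfolding k_def ellipse_modulus_def by simp
  qed
  moreover have p: "0 < (C - A) * (D - B)" using ord by simp
  ultimately have main: "(C - A) * (D - B) \<le> E * ((B - A) * (D - C))"
    by (simp add: pos_le_divide_eq)
  have "(B - A) * (D - B) \<le> (C - A) * (D - B)" using ord by (intro mult_right_mono) auto
  then have "(B - A) * (D - B) \<le> (B - A) * (E * (D - C))" using main by (simp add: mult_ac)
  then show "D - B \<le> exp (464 / 100 * T) * (D - C)" using ord by (simp add: E_def)
  have "(D - C) * (C - A) \<le> (C - A) * (D - B)" using ord by (subst mult.commute, intro mult_left_mono) auto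
  then have "(D - C) * (C - A) \<le> (D - C) * (E * (B - A))" using main by (simp add: mult_ac)
  then show "C - A \<le> exp (464 / 100 * T) * (B - A)" using ord by (simp add: E_def)
qed

text \<open>Continuity of \<open>h\<close> is deliberately absent: \<open>conj_map\<close> is not
  yet known to be continuous, and its continuity is a consequence of the estimates proved
  here.\<close>

locale conjugacy =
  fixes f h :: "real \<Rightarrow> real" and \<rho> Q :: real
  assumes h_mono: "strict_mono h" and h_per: "h (u + 1) = h u + 1" and h_conj: "f (h u) = h (u + \<rho>)"
    and cri: "cross_ratio_inequality cross_ratio_modulus f Q"
begin

abbreviation "E \<equiv> step_factor Q"

lemma Q_ge_1: "1 \<le> Q"
proof -
  \<comment> \<open>The empty configuration: its product is 1.\<close>
  have "allowable 0 (\<lambda>_. 0) (\<lambda>_. 0) (\<lambda>_. 0) (\<lambda>_. 0)" by (simp add: allowable_def)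
  then show ?thesis using cri unfolding cross_ratio_inequality_def by fastforce
qed

lemma E_ge: "2 \<le> E"
proof -
  have "1 + 464 / 100 * Q ^ 6 \<le> E" unfolding step_factor_def by (rule exp_ge_add_one_self)
  moreover have "1 \<le> Q ^ 6" using Q_ge_1 by (rule one_le_power)
  ultimately show ?thesis by linarith
qed

lemma h_less: "h a < h b \<longleftrightarrow> a < b" and h_le: "h a \<le> h b \<longleftrightarrow> a \<le> b"
  using h_mono by (simp_all add: strict_mono_less strict_mono_less_eq)

lemma h_int: "h (u + of_int n) = h u + of_int n"
  by (rule periodic_of_int[of h, OF h_per])

text \<open>Modulo 1 there are only finitely many cells of mesh \<open>1 / n\<close>, on each of
  which \<open>h\<close> increases, and every window of length \<open>W > 2 / n\<close> contains a
  whole cell.\<close>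

lemma window_lower_bound:
  assumes W: "W > 0" shows "\<exists>\<delta>>0. \<forall>y. \<delta> \<le> h (y + W) - h y"
proof -
  obtain n where n: "n > 0" "inverse (real n) < W / 2" using ex_inverse_of_nat_less[of "W / 2"] W by auto
  define c where "c i = h (real (Suc i) / real n) - h (real i / real n)" for i
  define \<delta> where "\<delta> = Min (c ` {..<n})"
  have ne: "c ` {..<n} \<noteq> {}" using n by auto
  have cpos: "0 < c i" for i using n by (simp add: c_def h_less divide_strict_right_mono)
  have "0 < \<delta>" unfolding \<delta>_def using Min_in[OF _ ne] cpos by fastforce
  moreover have "\<delta> \<le> h (y + W) - h y" for y
  proof -
    define k where "k = \<lceil>y * real n\<rceil>"
    define i where "i = nat (k mod int n)"
    define q where "q = k div int n"
    have i: "int i = k mod int n" "i < n" using n by (simp_all add: i_def nat_less_iff)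
    have k: "of_int k = real i + of_int q * real n"
    proof -
      have "k = int i + q * int n" using i(1) by (simp add: q_def)
      then have "of_int k = (of_int (int i + q * int n) :: real)" by (rule arg_cong)
      then show ?thesis by simp
    qed
    have yk: "y * real n \<le> of_int k" "of_int k < y * real n + 1" unfolding k_def by linarith+
    have e1: "real i / real n + of_int q = of_int k / real n" using k n by (simp add: add_divide_distrib)
    have e2: "real (Suc i) / real n + of_int q = (of_int k + 1) / real n" using k n by (simp add: add_divide_distrib)
    have a1: "y \<le> of_int k / real n" using yk(1) n by (simp add: pos_le_divide_eq)
    have "(of_int k + 1) / real n \<le> (y * real n + 2) / real n" using yk(2) by (intro divide_right_mono) auto
    also have "\<dots> = y + 2 * inverse (real n)" using n by (simp add: add_divide_distrib inverse_eq_divide)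
    also have "\<dots> \<le> y + W" using n(2) by simp
    finally have a2: "(of_int k + 1) / real n \<le> y + W" .
    have "\<delta> \<le> c i" unfolding \<delta>_def using i(2) by (intro Min_le) auto
    also have "c i = h (real (Suc i) / real n + of_int q) - h (real i / real n + of_int q)"
      by (simp add: c_def h_int)
    also have "\<dots> \<le> h (y + W) - h y" unfolding e1 e2 using a1 a2 h_le by (intro diff_mono) auto
    finally show ?thesis .
  qed
  ultimately show ?thesis by blast
qed

text \<open>The infimum of the increments is positive by \<open>window_lower_bound\<close>, hence
  smaller than itself divided by 0.965. It may fail to be attained, since \<open>h\<close> may
  jump.\<close>

lemma near_minimal_window:
  assumes W: "W > 0" shows "\<exists>v. \<forall>y. 965 / 1000 * (h (v + W) - h v) \<le> h (y + W) - h y"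
proof -
  obtain \<delta> where \<delta>: "\<delta> > 0" "\<And>y. \<delta> \<le> h (y + W) - h y" using window_lower_bound[OF W] by blast
  define m where "m = Inf (range (\<lambda>y. h (y + W) - h y))"
  have bdd: "bdd_below (range (\<lambda>y. h (y + W) - h y))" using \<delta>(2) by (intro bdd_belowI[of _ \<delta>]) auto
  have "\<delta> \<le> m" unfolding m_def by (intro cInf_greatest) (use \<delta>(2) in auto)
  then have "m < m / (965 / 1000)" using \<delta>(1) by simp
  then obtain v where "h (v + W) - h v < m / (965 / 1000)"
    unfolding m_def using cInf_lessD[of "range (\<lambda>y. h (y + W) - h y)"] by blast
  then have "965 / 1000 * (h (v + W) - h v) \<le> m" by simp
  moreover have "m \<le> h (y + W) - h y" for y unfolding m_def by (rule cInf_lower[OF _ bdd]) simp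
  ultimately show ?thesis by (meson order_trans)
qed

text \<open>The target quadruple is pushed into a nearly minimal window: there both outer intervals are at least
  as long, up to a factor close to 1, as the middle one.\<close>

lemma quadruple_comparison:
  assumes sc: "rotation_scale \<rho> N s g" and e: "e = s / 3" and W: "W = g + e"
  shows "h (u + e + W) - h u \<le> E * (h (u + e + W) - h (u + e))"
    and "h (u + e) - h (u - W) \<le> E * (h u - h (u - W))"
proof -
  have s: "0 < s" "s \<le> g" "g \<le> 2 * s" using sc by (auto simp: rotation_scale_def)
  have eW: "0 < e" "0 < W" using s by (auto simp: e W)
  obtain v where v: "\<And>y. 965 / 1000 * (h (v + W) - h v) \<le> h (y + W) - h y"
    using near_minimal_window[OF eW(2)] by blast
  \<comment> \<open>An iterate that moves \<open>[u, u + e]\<close> into \<open>[v, v + W]\<close>: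
    the window leaves room \<open>W - e = g\<close> for the left end, exactly the density of the
    orbit.\<close>
  obtain j l where jl: "j < N" "v - u \<le> real j * \<rho> + of_int l" "real j * \<rho> + of_int l \<le> v - u + g"
    using sc unfolding rotation_scale_def by blast
  define t where "t = real j * \<rho>"
  have M: "h (u + e + t) - h (u + t) \<le> h (v + W) - h v"
  proof -
    have "h (u + e + t) - h (u + t) = h (u + e + t + of_int l) - h (u + t + of_int l)" by (simp only: h_int)
    also have "\<dots> \<le> h (v + W) - h v"
      using jl(2,3) by (intro diff_mono) (simp_all add: h_le t_def W)
    finally show ?thesis .
  qed
  have L: "965 / 1000 * (h (v + W) - h v) \<le> h (u + t) - h (u - W + t)"
    using v[of "u - W + t"] by (simp add: algebra_simps)
  have R: "965 / 1000 * (h (v + W) - h v) \<le> h (u + e + W + t) - h (u + e + t)"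
    using v[of "u + e + t"] by (simp add: algebra_simps)
  \<comment> \<open>Propagation runs forward while the information runs backward: the bound known
    for the image quadruple passes to the original one. The total length
    \<open>2 * W + e = 2 * g + s\<close> is at most \<open>5 * s\<close>.\<close>
  have "pi / (464 / 100) \<le> cross_ratio_modulus (h (u - W + t)) (h (u + t)) (h (u + e + t)) (h (u + e + W + t))"
    by (rule cross_ratio_modulus_ge) (use eW M L R in \<open>auto simp: h_less\<close>)
  also have "\<dots> \<le> Q ^ 6 * cross_ratio_modulus (h (u - W)) (h u) (h (u + e)) (h (u + e + W))"
    unfolding t_def
    by (rule cross_ratio_propagation[OF sc h_mono h_per h_conj cri cross_ratio_modulus_pos])
       (use eW s jl(1) in \<open>auto simp: e W\<close>)
  finally have X: "pi / (464 / 100) \<le> Q ^ 6 * cross_ratio_modulus (h (u - W)) (h u) (h (u + e)) (h (u + e + W))" .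
  have "0 < Q ^ 6" using Q_ge_1 by simp
  from cross_ratio_modulus_lengths[OF _ _ _ this X] eW
  show "h (u + e + W) - h u \<le> E * (h (u + e + W) - h (u + e))"
    "h (u + e) - h (u - W) \<le> E * (h u - h (u - W))"
    by (simp_all add: h_less step_factor_def)
qed

text \<open>Each step compares the added piece of length \<open>e\<close> with the adjacent end
  piece of length \<open>W\<close>; the rest of the window is multiplied by \<open>E >= 1\<close>
  for free. The window must therefore be at least \<open>W\<close> long.\<close>

lemma extend_window:
  assumes sc: "rotation_scale \<rho> N s g" and e: "e = s / 3" and W: "W = g + e" and xy: "W \<le> y - x"
  shows "h (y + real i * e) - h x \<le> E ^ i * (h y - h x)"
    and "h y - h (x - real i * e) \<le> E ^ i * (h y - h x)"
proof -
  have s: "0 < s" "s \<le> g" using sc by (auto simp: rotation_scale_def)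
  have eW: "0 < e" "0 < W" using s by (auto simp: e W)
  have E1: "1 \<le> E" using E_ge by simp
  show "h (y + real i * e) - h x \<le> E ^ i * (h y - h x)"
  proof (induction i)
    case (Suc i)
    define z where "z = y + real i * e"
    have "0 \<le> real i * e" using eW by simp
    then have zx: "W \<le> z - x" using xy unfolding z_def by linarith
    have "h (z + e) - h x = (h (z + e) - h (z - W)) + (h (z - W) - h x)" by simp
    also have "\<dots> \<le> E * (h z - h (z - W)) + E * (h (z - W) - h x)"
    proof (rule add_mono)
      show "h (z + e) - h (z - W) \<le> E * (h z - h (z - W))" by (rule quadruple_comparison(2)[OF sc e W])
      have "0 \<le> h (z - W) - h x" using zx by (simp add: h_le)
      from mult_right_mono[OF E1 this] show "h (z - W) - h x \<le> E * (h (z - W) - h x)" by simp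
    qed
    also have "\<dots> = E * (h z - h x)" by (simp add: algebra_simps)
    also have "\<dots> \<le> E * (E ^ i * (h y - h x))" using Suc E1 by (intro mult_left_mono) (auto simp: z_def)
    finally show ?case by (simp add: z_def algebra_simps)
  qed simp
  show "h y - h (x - real i * e) \<le> E ^ i * (h y - h x)"
  proof (induction i)
    case (Suc i)
    define z where "z = x - real i * e"
    have "0 \<le> real i * e" using eW by simp
    then have zy: "W \<le> y - z" using xy unfolding z_def by linarith
    have "h y - h (z - e) = (h y - h (z + W)) + (h (z + W) - h (z - e))" by simp
    also have "\<dots> \<le> E * (h y - h (z + W)) + E * (h (z + W) - h z)"
    proof (rule add_mono)
      show "h (z + W) - h (z - e) \<le> E * (h (z + W) - h z)"
        using quadruple_comparison(1)[OF sc e W, of "z - e"] by simp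
      have "0 \<le> h y - h (z + W)" using zy by (simp add: h_le)
      from mult_right_mono[OF E1 this] show "h y - h (z + W) \<le> E * (h y - h (z + W))" by simp
    qed
    also have "\<dots> = E * (h y - h z)" by (simp add: algebra_simps)
    also have "\<dots> \<le> E * (E ^ i * (h y - h x))" using Suc E1 by (intro mult_left_mono) (auto simp: z_def)
    finally show ?case by (simp add: z_def algebra_simps)
  qed simp
qed

text \<open>If \<open>h\<close> jumped by \<open>J\<close> at \<open>u\<close>, a quadruple with
  middle interval centred at \<open>u\<close> and right neighbour inside \<open>(u, y0)\<close>
  would contradict \<open>quadruple_comparison\<close>: middle and right interval together increase
  \<open>h\<close> by at least \<open>J\<close>, the right one alone by less than
  \<open>J / E\<close>.\<close>

lemma conjugacy_continuous:
  assumes irr: "\<rho> \<notin> \<rat>" shows "continuous_on UNIV h"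
proof (rule continuous_at_imp_continuous_on, rule ballI)
  fix u :: real
  define hp where "hp = Inf (h ` {u<..})"
  define hm where "hm = Sup (h ` {..<u})"
  have hp_le: "hp \<le> h y" if "u < y" for y
    unfolding hp_def by (rule cInf_lower) (use that in \<open>auto intro!: bdd_belowI[of _ "h u"] simp: h_le\<close>)
  have hm_ge: "h y \<le> hm" if "y < u" for y
    unfolding hm_def by (rule cSup_upper) (use that in \<open>auto intro!: bdd_aboveI[of _ "h u"] simp: h_le\<close>)
  have hp_ex: "\<exists>y>u. h y < t" if "hp < t" for t
    using cInf_lessD[of "h ` {u<..}" t] that unfolding hp_def by auto
  have hm_ex: "\<exists>y<u. t < h y" if "t < hm" for t
  proof -
    have "{..<u} \<noteq> {}" using lessThan_iff[of "u - 1" u] by force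
    then show ?thesis using less_cSupD[of "h ` {..<u}" t] that unfolding hm_def by auto
  qed
  have "hp \<le> hm"
  proof (rule ccontr)
    assume "\<not> hp \<le> hm"
    define J where "J = hp - hm"
    have J: "J > 0" using \<open>\<not> hp \<le> hm\<close> by (simp add: J_def)
    have E0: "E > 0" using E_ge by simp
    obtain y0 where y0: "u < y0" "h y0 < hp + J / E" using hp_ex[of "hp + J / E"] J E0 by auto
    obtain N s g where sc: "rotation_scale \<rho> N s g" "g < (y0 - u) / 2"
      using rotation_scale_exists[OF irr, of "(y0 - u) / 2"] y0 by auto
    define e where "e = s / 3"
    define W where "W = g + e"
    have s: "0 < s" "s \<le> g" using sc by (auto simp: rotation_scale_def)
    have "h (u - e / 2 + e + W) - h (u - e / 2) \<le> E * (h (u - e / 2 + e + W) - h (u - e / 2 + e))"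
      by (rule quadruple_comparison(1)[OF sc(1) e_def W_def])
    also have "\<dots> < E * (J / E)"
    proof (rule mult_strict_left_mono[OF _ E0])
      have "h (u - e / 2 + e + W) \<le> h y0" unfolding h_le using sc(2) s by (simp add: e_def W_def)
      moreover have "hp \<le> h (u - e / 2 + e)" by (rule hp_le) (use s in \<open>simp add: e_def\<close>)
      ultimately show "h (u - e / 2 + e + W) - h (u - e / 2 + e) < J / E" using y0(2) by linarith
    qed
    also have "\<dots> = J" using E0 by simp
    finally have "h (u - e / 2 + e + W) - h (u - e / 2) < J" .
    moreover have "hp \<le> h (u - e / 2 + e + W)" by (rule hp_le) (use s in \<open>simp add: e_def W_def\<close>)
    moreover have "h (u - e / 2) \<le> hm" by (rule hm_ge) (use s in \<open>simp add: e_def\<close>)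
    ultimately show False by (simp add: J_def)
  qed
  moreover have "h u \<le> hp"
    unfolding hp_def by (intro cInf_greatest) (auto simp: h_le)
  moreover have "hm \<le> h u"
  proof -
    have "{..<u} \<noteq> {}" using lessThan_iff[of "u - 1" u] by force
    then show ?thesis unfolding hm_def by (intro cSup_least) (auto simp: h_le)
  qed
  ultimately have eq: "hp = h u" "hm = h u" by linarith+
  show "isCont h u" unfolding isCont_def
  proof (rule order_tendstoI)
    fix t assume "t < h u"
    then obtain y where y: "y < u" "t < h y" using hm_ex eq by auto
    have "eventually (\<lambda>x. y < x) (at u)" using order_tendstoD(1)[OF tendsto_ident_at y(1)] .
    then show "eventually (\<lambda>x. t < h x) (at u)"
      by eventually_elim (use y(2) h_less in \<open>auto intro: less_trans\<close>)
  next
    fix t assume "h u < t"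
    then obtain y where y: "u < y" "h y < t" using hp_ex eq by auto
    have "eventually (\<lambda>x. x < y) (at u)" using order_tendstoD(2)[OF tendsto_ident_at y(1)] .
    then show "eventually (\<lambda>x. h x < t) (at u)"
      by eventually_elim (use y(2) h_less in \<open>auto intro: less_trans\<close>)
  qed
qed

section \<open>Comparison of adjacent intervals and quasisymmetry\<close>

lemma adjacent_long:
  assumes t: "1 \<le> t"
  shows "h (x + t) - h x \<le> 2 * (h x - h (x - t))" "h x - h (x - t) \<le> 2 * (h (x + t) - h x)"
proof -
  define m where "m = \<lfloor>t\<rfloor>"
  have m: "1 \<le> m" "of_int m \<le> t" "t \<le> of_int (m + 1)" using t unfolding m_def by linarith+
  have up: "h (y + t) - h y \<le> of_int (m + 1)" and lo: "of_int m \<le> h (y + t) - h y" for y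
    using h_le[of "y + t" "y + of_int (m + 1)"] h_le[of "y + of_int m" "y + t"] m
    unfolding h_int by auto
  \<comment> \<open>True because \<open>m >= 1\<close>; long intervals account for the 2 in the
    maximum defining \<open>K2\<close>.\<close>
  have "of_int (m + 1) \<le> 2 * (of_int m :: real)" using m(1) by simp
  then show "h (x + t) - h x \<le> 2 * (h x - h (x - t))" "h x - h (x - t) \<le> 2 * (h (x + t) - h x)"
    using up[of x] lo[of x] up[of "x - t"] lo[of "x - t"] by simp_all
qed

text \<open>Let \<open>n0\<close> be the first scale that is fine enough. For
  \<open>t >= W n0\<close> a window is extended on both sides until it covers a full period; for
  shorter \<open>t\<close> the first scale with \<open>W n <= t\<close> is taken and one interval is
  extended across its neighbour. Minimality of the scale bounds the number of steps of length
  \<open>d n / 3\<close> by \<open>B\<close>. The first case is the costlier one and fixes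
  45.\<close>

lemma adjacent_short:
  assumes d: "d 0 = 1" "\<And>n. 0 < d n" "\<And>n. d (Suc n) < d n"
      "\<And>n. d n \<le> real B * d (Suc n) + d (Suc (Suc n))" "d \<longlonglongrightarrow> 0"
    and sc: "\<And>n. n \<ge> 1 \<Longrightarrow> d n + d (Suc n) \<le> 1 / 20 \<Longrightarrow> \<exists>N. rotation_scale \<rho> N (d n) (d n + d (Suc n))"
    and B: "1 \<le> B" and t: "0 < t" "t < 1"
  shows "h (x + t) - h x \<le> E ^ (45 * (B + 1)) * (h x - h (x - t))"
    and "h x - h (x - t) \<le> E ^ (45 * (B + 1)) * (h (x + t) - h x)"
proof -
  define W where "W n = d n + d (Suc n) + d n / 3" for n
  have E1: "1 \<le> E" "2 \<le> E" using E_ge by auto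
  have dB: "d n \<le> real (B + 1) * d (Suc n)" for n
    using d(4)[of n] d(3)[of "Suc n"] by (simp add: algebra_simps)
  have mono: "d n \<le> d m" if "m \<le> n" for m n
    by (rule lift_Suc_antimono_le[of d, OF _ that]) (use d(3) less_imp_le in blast)
  have g_lim: "(\<lambda>n. d n + d (Suc n)) \<longlonglongrightarrow> 0"
    using tendsto_add[OF d(5) LIMSEQ_Suc[OF d(5)]] by simp
  have W_lim: "W \<longlonglongrightarrow> 0"
    unfolding W_def[abs_def] using tendsto_add[OF g_lim tendsto_divide[OF d(5) tendsto_const, of 3]] by simp
  define n0 where "n0 = (LEAST n. d n + d (Suc n) \<le> 1 / 20)"
  have "\<exists>n. d n + d (Suc n) \<le> 1 / 20"
    using eventually_happens'[OF _ order_tendstoD(2)[OF g_lim, of "1/20"]] by (auto intro: less_imp_le)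
  then have n0: "d n0 + d (Suc n0) \<le> 1 / 20" unfolding n0_def by (rule LeastI_ex)
  have n0_min: "\<not> d n + d (Suc n) \<le> 1 / 20" if "n < n0" for n
    using not_less_Least that unfolding n0_def by blast
  have n0_pos: "n0 \<ge> 1" using n0 d(1) d(2)[of "Suc 0"] by (cases n0) auto
  have sc': "\<exists>N. rotation_scale \<rho> N (d n) (d n + d (Suc n))" if "n \<ge> n0" for n
    by (rule sc) (use that n0_pos n0 mono[of n0 n] mono[of "Suc n0" "Suc n"] in auto)
  have fin: "h (x + t) - h x \<le> E ^ (45 * (B + 1)) * (h x - h (x - t)) \<and>
             h x - h (x - t) \<le> E ^ (45 * (B + 1)) * (h (x + t) - h x)"
  proof (cases "W n0 \<le> t")
    case True
    obtain N where scn: "rotation_scale \<rho> N (d n0) (d n0 + d (Suc n0))" using sc'[of n0] by auto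
    define e where "e = d n0 / 3"
    have e: "0 < e" using d(2) by (simp add: e_def)
    have W0: "W n0 = d n0 + d (Suc n0) + e" by (simp add: W_def e_def)
    have W4: "4 * e \<le> W n0" using d(2)[of "Suc n0"] by (simp add: W0 e_def)
    define i where "i = nat \<lceil>(1 - W n0) / (2 * e)\<rceil>"
    have i_ge: "(1 - W n0) / (2 * e) \<le> real i" unfolding i_def by linarith
    have W1: "W n0 < 1" using True t by simp
    then have "0 \<le> (1 - W n0) / (2 * e)" using e by simp
    then have i_le: "real i \<le> (1 - W n0) / (2 * e) + 1" unfolding i_def by linarith
    have "1 - W n0 \<le> real i * (2 * e)" using i_ge e by (simp add: pos_divide_le_eq)
    then have cover: "1 \<le> W n0 + 2 * (real i * e)" by simp
    have i_bound: "i + 1 \<le> 45 * (B + 1)"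
    proof -
      have "(1 - W n0) / (2 * e) \<le> (1 - 4 * e) / (2 * e)" using W4 e by (intro divide_right_mono) auto
      also have "\<dots> = 1 / (2 * e) - 2" using e by (simp add: diff_divide_distrib)
      finally have "real i + 1 \<le> 1 / (2 * e)" using i_le by linarith
      also have "\<dots> \<le> 30 * (real B + 2)"
      proof -
        \<comment> \<open>Minimality of \<open>n0\<close> gives
          \<open>d n0 > 1 / (20 * (B + 2))\<close>, that is
          \<open>1 / (2 * e) < 30 * (B + 2)\<close>; for \<open>B >= 1\<close> this is at most
          \<open>45 * (B + 1)\<close>.\<close>
        have "\<not> d (n0 - 1) + d (Suc (n0 - 1)) \<le> 1 / 20" by (rule n0_min) (use n0_pos in simp)
        then have "1 / 20 < d (n0 - 1) + d n0" using n0_pos by simp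
        also have "\<dots> \<le> (real B + 2) * d n0" using dB[of "n0 - 1"] n0_pos by (simp add: algebra_simps)
        finally have "1 < 20 * ((real B + 2) * d n0)" by simp
        moreover have "30 * (real B + 2) * (2 * e) = 20 * ((real B + 2) * d n0)" by (simp add: e_def)
        ultimately have "1 \<le> 30 * (real B + 2) * (2 * e)" by linarith
        then show ?thesis using e by (simp add: pos_divide_le_eq)
      qed
      also have "\<dots> \<le> real (45 * (B + 1))" using B by simp
      finally show ?thesis by linarith
    qed
    have win: "1 \<le> E ^ (45 * (B + 1)) * (h b - h a)" if "W n0 \<le> b - a" for a b
    proof -
      have pos: "0 \<le> h b - h a" using that e W4 by (simp add: h_le)
      have "h (a - real i * e) + 1 \<le> h (b + real i * e)"
        unfolding h_per[symmetric] h_le using cover that by linarith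
      moreover note extend_window[OF scn e_def W0 that, of i]
      moreover have "0 \<le> h b - h a" by (rule pos)
      \<comment> \<open>The two extensions are estimated separately and added. The resulting factor
        2 costs one more power of \<open>E\<close>, since \<open>2 <= E\<close>.\<close>
      ultimately have "1 \<le> 2 * (E ^ i * (h b - h a))" by linarith
      also have "\<dots> \<le> E * (E ^ i * (h b - h a))" using E1 pos by (intro mult_right_mono) auto
      also have "\<dots> = E ^ (i + 1) * (h b - h a)" by simp
      also have "\<dots> \<le> E ^ (45 * (B + 1)) * (h b - h a)"
        using i_bound E1 pos by (intro mult_right_mono power_increasing) auto
      finally show ?thesis .
    qed
    have "h (x + t) \<le> h (x + 1)" "h (x - t + t) \<le> h (x - t + 1)" unfolding h_le using t by auto
    then have "h (x + t) - h x \<le> 1" "h x - h (x - t) \<le> 1" unfolding h_per by simp_all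
    then show ?thesis using win[of x "x - t"] win[of "x + t" x] True by force
  next
    case False
    define n where "n = (LEAST n. W n \<le> t)"
    have "\<exists>n. W n \<le> t"
      using eventually_happens'[OF _ order_tendstoD(2)[OF W_lim t(1)]] by (auto intro: less_imp_le)
    then have Wn: "W n \<le> t" unfolding n_def by (rule LeastI_ex)
    have n_min: "\<not> W m \<le> t" if "m < n" for m using not_less_Least that unfolding n_def by blast
    have W_anti: "W m \<le> W m'" if "m' \<le> m" for m m'
      unfolding W_def using mono[OF that] mono[of "Suc m'" "Suc m"] that by simp
    have nn: "n > n0"
    proof (rule ccontr)
      assume "\<not> n > n0"
      then have "W n0 \<le> W n" by (intro W_anti) simp
      then show False using False Wn by simp
    qed
    then have "\<not> W (n - 1) \<le> t" by (intro n_min) simp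
    then have tW: "t < 4 / 3 * d (n - 1) + d n" using nn by (simp add: W_def)
    obtain N where scn: "rotation_scale \<rho> N (d n) (d n + d (Suc n))" using sc'[of n] nn by auto
    define e where "e = d n / 3"
    have e: "0 < e" using d(2) by (simp add: e_def)
    have W0: "W n = d n + d (Suc n) + e" by (simp add: W_def e_def)
    define i where "i = nat \<lceil>t / e\<rceil>"
    have i_ge: "t / e \<le> real i" unfolding i_def by linarith
    then have cover: "t \<le> real i * e" using e by (simp add: pos_divide_le_eq)
    have "0 \<le> t / e" using t e by simp
    then have i_le: "real i \<le> t / e + 1" unfolding i_def by linarith
    have i_bound: "i \<le> 45 * (B + 1)"
    proof -
      \<comment> \<open>By minimality \<open>t < W (n - 1)\<close>, and
        \<open>d (n - 1) <= (B + 1) * d n\<close>. Measured in steps this is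
        \<open>4 * (B + 1) + 3\<close>, well below 45 per unit of \<open>B + 1\<close>.\<close>
      have "t \<le> 4 / 3 * (real (B + 1) * d n) + d n" using tW dB[of "n - 1"] nn by simp
      also have "\<dots> = (4 * real (B + 1) + 3) * e" by (simp add: e_def field_simps)
      finally have "t / e \<le> 4 * real (B + 1) + 3" using e by (simp add: pos_divide_le_eq)
      then have "real i \<le> real (45 * (B + 1))" using i_le B by simp
      then show ?thesis by linarith
    qed
    have pw: "E ^ i * y \<le> E ^ (45 * (B + 1)) * y" if "0 \<le> y" for y
      using i_bound E1 that by (intro mult_right_mono power_increasing) auto
    have 1: "h (x + t) - h x \<le> E ^ i * (h x - h (x - t))"
    proof -
      have "h (x + t) \<le> h (x + real i * e)" unfolding h_le using cover by simp
      moreover have "h (x - t) \<le> h x" unfolding h_le using t by simp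
      moreover have "h (x + real i * e) - h (x - t) \<le> E ^ i * (h x - h (x - t))"
        by (rule extend_window(1)[OF scn e_def W0]) (use Wn in simp)
      ultimately show ?thesis by linarith
    qed
    have 2: "h x - h (x - t) \<le> E ^ i * (h (x + t) - h x)"
    proof -
      have "h (x - real i * e) \<le> h (x - t)" unfolding h_le using cover by simp
      moreover have "h x \<le> h (x + t)" unfolding h_le using t by simp
      moreover have "h (x + t) - h (x - real i * e) \<le> E ^ i * (h (x + t) - h x)"
        by (rule extend_window(2)[OF scn e_def W0]) (use Wn in simp)
      ultimately show ?thesis by linarith
    qed
    have "0 \<le> h x - h (x - t)" "0 \<le> h (x + t) - h x" using t by (simp_all add: h_le)
    then show ?thesis using 1 2 pw order_trans by blast
  qed
  then show "h (x + t) - h x \<le> E ^ (45 * (B + 1)) * (h x - h (x - t))"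
    and "h x - h (x - t) \<le> E ^ (45 * (B + 1)) * (h (x + t) - h x)" by auto
qed

lemma conjugacy_quasisymmetric:
  assumes irr: "\<rho> \<notin> \<rat>" and cf: "has_cfrac \<rho> a" and bt: "\<And>n. n \<ge> 1 \<Longrightarrow> a n \<le> B"
  shows "quasisymmetric h (qs_K2 Q B)"
proof -
  define K where "K = qs_K2 Q B"
  \<comment> \<open>Partial quotients are positive, so \<open>B >= 1\<close>, on which the count of
    45 steps relies.\<close>
  have a1: "1 \<le> a 1" using cf by (simp add: has_cfrac_def)
  then have B: "1 \<le> B" using bt[of 1] by simp
  obtain d :: "nat \<Rightarrow> real" where d: "d 0 = 1" "\<And>n. 0 < d n" "\<And>n. d (Suc n) < d n"
    "\<And>n. d n \<le> real B * d (Suc n) + d (Suc (Suc n))" "d \<longlonglongrightarrow> 0"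
    "\<And>n. n \<ge> 1 \<Longrightarrow> d n + d (Suc n) \<le> 1 / 20 \<Longrightarrow> \<exists>N. rotation_scale \<rho> N (d n) (d n + d (Suc n))"
    using bounded_type_scales[OF cf irr bt] by blast
  have K: "E ^ (45 * (B + 1)) \<le> K" "2 \<le> K"
  proof -
    have "E ^ (45 * (B + 1)) = (E ^ 45) ^ (B + 1)" by (rule power_mult)
    also have "\<dots> \<le> qs_K1 Q ^ (B + 1)"
      using qs_K1_ge[OF Q_ge_1] E_ge by (intro power_mono) auto
    finally show "E ^ (45 * (B + 1)) \<le> K" "2 \<le> K" by (auto simp: K_def qs_K2_def)
  qed
  have cmp: "h (x + t) - h x \<le> K * (h x - h (x - t)) \<and> h x - h (x - t) \<le> K * (h (x + t) - h x)" if t: "0 < t" for x t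
  proof -
    have pos: "0 \<le> h x - h (x - t)" "0 \<le> h (x + t) - h x" using t by (simp_all add: h_le)
    show ?thesis
    proof (cases "1 \<le> t")
      case True
      show ?thesis
        using adjacent_long[OF True, of x] mult_right_mono[OF K(2) pos(1)] mult_right_mono[OF K(2) pos(2)] by linarith
    next
      case False
      then have "t < 1" by simp
      note s = adjacent_short[OF d B t this, of x]
      show ?thesis
        using s mult_right_mono[OF K(1) pos(1)] mult_right_mono[OF K(1) pos(2)] by linarith
    qed
  qed
  have cont: "continuous_on UNIV h" by (rule conjugacy_continuous[OF irr])
  have inj: "inj h" using h_mono by (rule strict_mono_imp_inj_on)
  have surj: "surj h"
  proof (rule surjI[of h "\<lambda>y. SOME x. h x = y"])
    fix y
    define n where "n = \<lfloor>y - h 0\<rfloor>"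
    have "of_int n \<le> y - h 0" "y - h 0 < of_int n + 1" unfolding n_def by linarith+
    moreover have "h (of_int n) = h 0 + of_int n" using h_int[of 0 n] by simp
    ultimately have "h (of_int n) \<le> y" "y \<le> h (of_int n + 1)"
      using h_per[of "of_int n"] by linarith+
    then have "\<exists>x. h x = y" using IVT'[of h "of_int n" y "of_int n + 1"] continuous_on_subset[OF cont] by auto
    then show "h (SOME x. h x = y) = y" by (rule someI_ex)
  qed
  obtain h' where "homeomorphism UNIV (range h) h h'"
    using invariance_of_domain_homeomorphism[OF open_UNIV cont _ inj] by auto
  then have "\<exists>h'. homeomorphism UNIV UNIV h h'" unfolding surj by blast
  moreover have "1 / K \<le> \<bar>h (x + \<delta>) - h x\<bar> / \<bar>h x - h (x - \<delta>)\<bar> \<and>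
        \<bar>h (x + \<delta>) - h x\<bar> / \<bar>h x - h (x - \<delta>)\<bar> \<le> K" if \<delta>: "\<delta> > 0" for x \<delta>
  proof -
    have pos: "0 < h x - h (x - \<delta>)" "0 < h (x + \<delta>) - h x" using \<delta> by (simp_all add: h_less)
    have "0 < K" using K(2) by simp
    then have "1 / K \<le> (h (x + \<delta>) - h x) / (h x - h (x - \<delta>))"
      using cmp[OF \<delta>, of x] pos by (simp add: frac_le_eq divide_le_eq le_divide_eq mult.commute)
    moreover have "(h (x + \<delta>) - h x) / (h x - h (x - \<delta>)) \<le> K"
      using cmp[OF \<delta>, of x] pos by (simp add: pos_divide_le_eq)
    ultimately show ?thesis using pos by simp
  qed
  ultimately show ?thesis unfolding quasisymmetric_def K_def[symmetric] using h_mono by blast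
qed

end

theorem proposition1:
  fixes f :: "real \<Rightarrow> real" and Q :: real
  assumes "degree_one_circle_homeo_lift f"
    and "rotation_number f \<notin> \<rat>"
    and "cross_ratio_inequality cross_ratio_modulus f Q"
  shows "\<exists>h. degree_one_circle_homeo_lift h \<and>
           (\<forall>x. f (h x) = h (x + rotation_number f)) \<and>
           (\<forall>(a :: nat \<Rightarrow> nat) (B :: nat).
              has_cfrac (rotation_number f) a \<and> (\<forall>n\<ge>1. a n \<le> B) \<longrightarrow>
              quasisymmetric h (qs_K2 Q B))"
proof -
  interpret circle_lift f
    using assms(1) degree_one_lift_strict_mono[OF assms(1)]
    by unfold_locales (auto simp: degree_one_circle_homeo_lift_def)
  interpret conjugacy f conj_map "rotation_number f" Q
    using conj_map_strict_mono[OF assms(2)] conj_map_per conj_map_conjugates[OF assms(2)] assms(3)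
    by unfold_locales auto
  have "degree_one_circle_homeo_lift conj_map"
    by (rule circle_homeo_lift_of_strict_mono[OF conjugacy_continuous[OF assms(2)] h_per h_mono])
  \<comment> \<open>\<open>conj_map\<close> depends on \<open>f\<close> alone, so one conjugacy
    serves all pairs \<open>a\<close>, \<open>B\<close>.\<close>
  then show ?thesis using h_conj conjugacy_quasisymmetric[OF assms(2)] by blast
qed

end
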